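(* (i) Assume $\Omega$ satisfies condition (A). Then for all $a>1$ sufficiently close to $1$ (i.e. there is $a_0>1$ such that for all $a\in(1,a_0)$) there exists a second eigenfunction of the eigenvalue problem $(N)$. (ii) Assume $(a,L)$ is an admissible pair and $\Omega$ satisfies condition $(L)$ for this pair. Then there exists a second eigenfunction of the eigenvalue problem $(N)$.
   Context: $\Omega\subset\mathbb{R}^2$ is a smooth bounded domain with $0\in\overline{\Omega}$ and $\sup_{x\in\Omega}|x|=1$. $B_r$ is the ball of radius $r$ centered at the origin. The eigenvalue problem $(N)$ is $$-\Delta u=\lambda\frac{u}{|x|^2\left(\log\frac{a}{|x|}\right)^2}\ \text{in }\Omega,\qquad \frac{\partial u}{\partial\nu}=0\ \text{on }\partial\Omega,$$ understood weakly: $\int_\Omega\nabla u\cdot\nabla\phi\,dx=\lambda\int_\Omega\frac{u\phi}{|x|^2(\log\frac{a}{|x|})^2}\,dx$ for all $\phi\in H^1(\Omega)$. The first eigenvalue is $0$, with constant eigenfunctions. Set $$\lambda_a=\inf\left\{\frac{\int_{\Omega}|\nabla u|^2\,dx}{\int_{\Omega}\frac{|u|^2}{|x|^2\left(\log\frac{a}{|x|}\right)^2}\,dx}\ \middle|\ u\in H^1(\Omega)\setminus\{0\},\ \int_{\Omega}\frac{u}{|x|^2\left(\log\frac{a}{|x|}\right)^2}\,dx=0\right\}.$$ A second eigenfunction of $(N)$ is a minimizer $u\in H^1(\Omega)\setminus\{0\}$ of $\lambda_a$ which is a weak solution of $(N)$ with $\lambda=\lambda_a$. Condition (A): there exist $\delta>0$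 and $0\le\theta_*<\theta^*<2\pi$ such that $\{(r,\theta)\in(1-\delta,1)\times(\theta_*,\theta^* )\}\subset\Omega$, where $(r,\theta)$ are polar coordinates in $\mathbb{R}^2$. A pair $(a,L)$ is admissible if $a>1$, $0<L<1$ and $8\pi<\int_{B_L}\frac{1}{(\log\frac{a}{|x|})^2}\,dx$. Condition $(L)$ (for the pair $(a,L)$): $B_L\subset\Omega\subset B_1$ and $\sum_{i=1}^2\left(\int_\Omega\frac{x_i}{|x|^2(\log\frac{a}{|x|})^2}\,dx\right)^2\neq0$. *)

theory Defs
  imports "HOL-Analysis.Analysis"
begin

definition dir_deriv :: "'a::euclidean_space \<Rightarrow> ('a \<Rightarrow> real) \<Rightarrow> 'a \<Rightarrow> real" where
  "dir_deriv v f x = frechet_derivative f (at x) v"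

text \<open>Differentiability of all iterated directional derivatives makes all of them continuous,
  so this is \<open>C\<^sup>\<infinity>\<close> on the whole space.\<close>

definition smooth_fun :: "('a::euclidean_space \<Rightarrow> real) \<Rightarrow> bool" where
  "smooth_fun f \<longleftrightarrow> (\<forall>vs x. fold dir_deriv vs f differentiable (at x))"

text \<open>Near each boundary point, in suitable orthonormal coordinates, the set is the strict
  epigraph of a smooth function.\<close>

definition smooth_boundary :: "(real^2) set \<Rightarrow> bool" where
  "smooth_boundary \<Omega> \<longleftrightarrow>
     (\<forall>p\<in>frontier \<Omega>. \<exists>r>0. \<exists>e1 e2 \<gamma>.
        norm e1 = 1 \<and> norm e2 = 1 \<and> e1 \<bullet> e2 = 0 \<and> smooth_fun (\<gamma> :: real \<Rightarrow> real) \<and>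
        \<Omega> \<inter> ball p r = {x \<in> ball p r. \<gamma> (x \<bullet> e1) < x \<bullet> e2})"

definition smooth_bounded_domain :: "(real^2) set \<Rightarrow> bool" where
  "smooth_bounded_domain \<Omega> \<longleftrightarrow>
     \<Omega> \<noteq> {} \<and> open \<Omega> \<and> connected \<Omega> \<and> bounded \<Omega> \<and> smooth_boundary \<Omega>"

definition test_functions :: "(real^2) set \<Rightarrow> (real^2 \<Rightarrow> real) set" where
  "test_functions \<Omega> =
     {\<phi>. smooth_fun \<phi> \<and> compact (closure {x. \<phi> x \<noteq> 0}) \<and> closure {x. \<phi> x \<noteq> 0} \<subseteq> \<Omega>}"

definition L2 :: "(real^2) set \<Rightarrow> (real^2 \<Rightarrow> 'b::euclidean_space) set" where
  "L2 \<Omega> = {f. f \<in> borel_measurable (lebesgue_on \<Omega>) \<and>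
              integrable (lebesgue_on \<Omega>) (\<lambda>x. (norm (f x))\<^sup>2)}"

definition has_weak_gradient :: "(real^2) set \<Rightarrow> (real^2 \<Rightarrow> real) \<Rightarrow> (real^2 \<Rightarrow> real^2) \<Rightarrow> bool" where
  "has_weak_gradient \<Omega> u g \<longleftrightarrow>
     (\<forall>\<phi>\<in>test_functions \<Omega>. \<forall>i.
        (LINT x|lebesgue_on \<Omega>. u x * dir_deriv (axis i 1) \<phi> x) =
        - (LINT x|lebesgue_on \<Omega>. (g x $ i) * \<phi> x))"

text \<open>Elements of \<open>H\<^sup>1\<close> are represented by functions on the plane; only their values almost
  everywhere on \<open>\<Omega>\<close> matter.\<close>

definition H1 :: "(real^2) set \<Rightarrow> (real^2 \<Rightarrow> real) set" where
  "H1 \<Omega> = {u \<in> L2 \<Omega>. \<exists>g\<in>L2 \<Omega>. has_weak_gradient \<Omega> u g}"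

text \<open>The square-integrable weak gradient is unique up to null sets, so integrals involving it do
  not depend on the choice.\<close>

definition weak_grad :: "(real^2) set \<Rightarrow> (real^2 \<Rightarrow> real) \<Rightarrow> real^2 \<Rightarrow> real^2" where
  "weak_grad \<Omega> u = (SOME g. g \<in> L2 \<Omega> \<and> has_weak_gradient \<Omega> u g)"

definition H1_zero :: "(real^2) set \<Rightarrow> (real^2 \<Rightarrow> real) \<Rightarrow> bool" where
  "H1_zero \<Omega> u \<longleftrightarrow> (AE x in lebesgue_on \<Omega>. u x = 0)"

text \<open>The value at the origin is the junk value \<open>0\<close>, on a null set.\<close>

definition weight :: "real \<Rightarrow> real^2 \<Rightarrow> real" where
  "weight a x = 1 / ((norm x)\<^sup>2 * (ln (a / norm x))\<^sup>2)"

text \<open>On a smooth bounded domain inside the unit ball and for \<open>a > 1\<close>, the critical Hardy inequality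
  makes \<open>u\<^sup>2 * weight a\<close> integrable for every \<open>u\<close> in \<open>H\<^sup>1\<close>; hence all integrals below are genuine,
  and the denominator is positive unless \<open>u\<close> vanishes almost everywhere.\<close>

definition admissible_functions :: "real \<Rightarrow> (real^2) set \<Rightarrow> (real^2 \<Rightarrow> real) set" where
  "admissible_functions a \<Omega> =
     {u \<in> H1 \<Omega>. \<not> H1_zero \<Omega> u \<and> (LINT x|lebesgue_on \<Omega>. u x * weight a x) = 0}"

definition rayleigh :: "real \<Rightarrow> (real^2) set \<Rightarrow> (real^2 \<Rightarrow> real) \<Rightarrow> real" where
  "rayleigh a \<Omega> u =
     (LINT x|lebesgue_on \<Omega>. (norm (weak_grad \<Omega> u x))\<^sup>2) /
     (LINT x|lebesgue_on \<Omega>. \<bar>u x\<bar>\<^sup>2 * weight a x)"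

definition lambda_inf :: "real \<Rightarrow> (real^2) set \<Rightarrow> real" where
  "lambda_inf a \<Omega> = (INF u\<in>admissible_functions a \<Omega>. rayleigh a \<Omega> u)"

definition weak_solution :: "real \<Rightarrow> (real^2) set \<Rightarrow> real \<Rightarrow> (real^2 \<Rightarrow> real) \<Rightarrow> bool" where
  "weak_solution a \<Omega> \<mu> u \<longleftrightarrow> u \<in> H1 \<Omega> \<and>
     (\<forall>\<phi>\<in>H1 \<Omega>.
        (LINT x|lebesgue_on \<Omega>. weak_grad \<Omega> u x \<bullet> weak_grad \<Omega> \<phi> x) =
        \<mu> * (LINT x|lebesgue_on \<Omega>. u x * \<phi> x * weight a x))"

definition second_eigenfunction :: "real \<Rightarrow> (real^2) set \<Rightarrow> (real^2 \<Rightarrow> real) \<Rightarrow> bool" where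
  "second_eigenfunction a \<Omega> u \<longleftrightarrow>
     u \<in> admissible_functions a \<Omega> \<and> rayleigh a \<Omega> u = lambda_inf a \<Omega> \<and>
     weak_solution a \<Omega> (lambda_inf a \<Omega>) u"

definition condition_A :: "(real^2) set \<Rightarrow> bool" where
  "condition_A \<Omega> \<longleftrightarrow>
     (\<exists>\<delta> \<theta>1 \<theta>2. \<delta> > 0 \<and> 0 \<le> \<theta>1 \<and> \<theta>1 < \<theta>2 \<and> \<theta>2 < 2 * pi \<and>
        (\<forall>r \<theta>. 0 < r \<and> 1 - \<delta> < r \<and> r < 1 \<and> \<theta>1 < \<theta> \<and> \<theta> < \<theta>2 \<longrightarrow>
           vector [r * cos \<theta>, r * sin \<theta>] \<in> \<Omega>))"

definition admissible_pair :: "real \<Rightarrow> real \<Rightarrow> bool" where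
  "admissible_pair a L \<longleftrightarrow> a > 1 \<and> 0 < L \<and> L < 1 \<and>
     8 * pi < (LINT x|lebesgue_on (ball (0 :: real^2) L). 1 / (ln (a / norm x))\<^sup>2)"

definition condition_L :: "real \<Rightarrow> real \<Rightarrow> (real^2) set \<Rightarrow> bool" where
  "condition_L a L \<Omega> \<longleftrightarrow> ball 0 L \<subseteq> \<Omega> \<and> \<Omega> \<subseteq> ball 0 1 \<and>
     (\<Sum>i\<in>UNIV. (LINT x|lebesgue_on \<Omega>. (x $ i) * weight a x)\<^sup>2) \<noteq> 0"

end

theory Submission
  imports Defs "HOL-Complex_Analysis.Great_Picard"
begin

text \<open>Write \<open>W\<close> for the weight. The field \<open>F = x / (|x|\<^sup>2 log (a/|x|))\<close> satisfies \<open>div F = |F|\<^sup>2 = W\<close>, which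
  gives the Hardy inequality \<open>\<integral> u\<^sup>2 W \<le> \<kappa> \<integral> |\<nabla>u|\<^sup>2 + C \<integral> u\<^sup>2\<close> for every \<open>\<kappa> > 4\<close>; if \<open>0\<close> lies on the boundary,
  a lower order correction makes \<open>F\<close> point into \<open>\<Omega>\<close>, so that the boundary term has a sign. Together with
  Rellich compactness this makes minimizing sequences converge in \<open>H\<^sup>1\<close> as soon as the infimum is below \<open>1/4\<close>.
  In case (i) a fixed trial function, odd under a reflection, near an arc of the unit circle has quotient
  tending to \<open>0\<close> as \<open>a \<rightarrow> 1\<close>, since \<open>W\<close> is not integrable up to the circle when \<open>a = 1\<close>. In case (ii) the trial function
  is linear, \<open>x \<bullet> e\<close> with \<open>e\<close> orthogonal to \<open>\<integral> x W\<close>: its energy is \<open>|\<Omega>| \<le> \<pi>\<close>, and its weighted norm is at least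
  half of \<open>\<integral>\<^bsub>B_L\<^esub> |x|\<^sup>2 W > 8\<pi>\<close>.

  Everything is derived from translations: \<open>u(x + z) - u(x)\<close> is almost everywhere the integral of the weak
  gradient along the segment. This yields both the product rule for \<open>u\<^sup>2\<close> needed for the Hardy inequality and
  the uniform approximation by averages needed for Rellich's theorem, where the averages are taken over balls
  inside a cone contained in \<open>\<Omega>\<close>.\<close>

section \<open>Smooth functions and test functions\<close>

text \<open>Nothing makes the embedding of H1 into the weighted L2 space compact: a minimizing
  sequence may try to concentrate at the origin. The threshold 1/4 excludes this. Integrating v^2
  div F = -2 v grad v . F and using Cauchy-Schwarz gives ||v||_W <= 2 ||grad v||, hence the constant
  4; a quotient \<mu> < 1/4 leaves room for some \<kappa> > 4 with \<mu> \<kappa> < 1, so that the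
  weighted norm of a difference is absorbed by its energy.

  F cannot be used as it stands: it is singular at 0, and v comes without boundary values. The
  singularity is removed by replacing |x|^2 by |x|^2 + \<epsilon>^2. The boundary is replaced by a
  cutoff in a local defining function d of \<Omega>; the derivative of this cutoff along an inward
  field is nonnegative, which plays the role of the sign of the boundary term. The constants have to
  be independent of both regularisations.

  The number 8 \<pi> is 4 * 2 * \<pi>: the inverse threshold, the half lost by keeping one
  coordinate of x, and the bound \<pi> on the energy.\<close>

lemma has_derivative_zero_off_support:
  fixes f :: "'a::real_normed_vector \<Rightarrow> 'b::real_normed_vector"
  assumes "(f has_derivative f') (at x)" "closed K" "\<And>y. y \<notin> K \<Longrightarrow> f y = 0" "x \<notin> K"
  shows "f' = (\<lambda>h. 0)"
proof -
  have "((\<lambda>x. 0) has_derivative (\<lambda>h. 0)) (at x)" by simp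
  then have "(f has_derivative (\<lambda>h. 0)) (at x)"
    by (rule has_derivative_transform_within_open[where s = "- K"]) (use assms in auto)
  then show ?thesis by (rule has_derivative_unique[OF assms(1)])
qed

lemma has_real_derivative_along_line:
  fixes f :: "'a::real_normed_vector \<Rightarrow> real"
  assumes "(f has_derivative f') (at (x + t *\<^sub>R e))"
  shows "((\<lambda>t. f (x + t *\<^sub>R e)) has_real_derivative f' e) (at t)"
proof -
  have l: "linear f'" using assms has_derivative_linear by blast
  have "((\<lambda>t. x + t *\<^sub>R e) has_derivative (\<lambda>h. h *\<^sub>R e)) (at t)"
    by (auto intro!: derivative_eq_intros)
  from has_derivative_compose[OF this assms] show ?thesis
    unfolding has_field_derivative_def
    by (rule has_derivative_eq_rhs) (auto simp: fun_eq_iff linear_cmul[OF l, simplified])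
qed

lemma Lipschitz_along_line:
  fixes f :: "'a::real_normed_vector \<Rightarrow> real"
  assumes "\<And>x. (f has_derivative f' x) (at x)" "\<And>x. \<bar>f' x e\<bar> \<le> M"
  shows "\<bar>f (x + r *\<^sub>R e) - f x\<bar> \<le> M * \<bar>r\<bar>"
proof -
  have "norm (f (x + r *\<^sub>R e) - f (x + 0 *\<^sub>R e)) \<le> M * norm (r - 0)"
    by (rule field_differentiable_bound[where S = UNIV and f' = "\<lambda>t. f' (x + t *\<^sub>R e) e"])
      (use assms in \<open>auto intro: has_field_derivative_at_within has_real_derivative_along_line\<close>)
  then show ?thesis by simp
qed

section \<open>Iterated directional derivatives\<close>

lemma smooth_fun_differentiable: "smooth_fun f \<Longrightarrow> f differentiable (at x)"
  unfolding smooth_fun_def by (drule spec[of _ "[]"]) simp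

lemma smooth_fun_dir_deriv: "smooth_fun f \<Longrightarrow> smooth_fun (dir_deriv v f)"
  unfolding smooth_fun_def by (metis fold_simps(2))

lemma smooth_fun_has_derivative:
  "smooth_fun f \<Longrightarrow> (f has_derivative (\<lambda>h. dir_deriv h f x)) (at x)"
  unfolding dir_deriv_def
  using smooth_fun_differentiable frechet_derivative_works by fastforce

lemma smooth_fun_continuous: "smooth_fun f \<Longrightarrow> continuous_on A f"
  using smooth_fun_differentiable differentiable_imp_continuous_within
  by (meson continuous_at_imp_continuous_on)

lemma smooth_fun_dir_deriv_continuous: "smooth_fun f \<Longrightarrow> continuous_on A (dir_deriv v f)"
  by (simp add: smooth_fun_continuous smooth_fun_dir_deriv)

lemma dir_deriv_eqI: "(f has_derivative f') (at x) \<Longrightarrow> dir_deriv v f x = f' v"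
  unfolding dir_deriv_def using frechet_derivative_at by metis

lemma dir_deriv_axes:
  fixes f :: "real^2 \<Rightarrow> real"
  assumes "smooth_fun f"
  shows "dir_deriv v f x = (\<Sum>i\<in>UNIV. v $ i * dir_deriv (axis i 1) f x)"
proof -
  have l: "linear (\<lambda>h. dir_deriv h f x)"
    using smooth_fun_has_derivative[OF assms] has_derivative_linear by blast
  have "dir_deriv v f x = dir_deriv (\<Sum>i\<in>UNIV. v $ i *\<^sub>R axis i 1) f x"
    using basis_expansion[of v] by (simp add: scalar_mult_eq_scaleR)
  also have "\<dots> = (\<Sum>i\<in>UNIV. v $ i * dir_deriv (axis i 1) f x)"
    unfolding linear_sum[OF l] by (intro sum.cong refl) (use linear_cmul[OF l] in auto)
  finally show ?thesis .
qed

text \<open>\<open>smooth_fun\<close> speaks about all lists of directions. A class that is stable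
  under differentiation in every direction is an invariant for the induction on the list, so one
  derivative formula per class is enough.\<close>

lemma smooth_funI_closed:
  assumes S: "\<And>f. f \<in> S \<Longrightarrow> \<exists>D. (\<forall>x. (f has_derivative D x) (at x)) \<and> (\<forall>v. (\<lambda>x. D x v) \<in> S)"
    and "f \<in> S"
  shows "smooth_fun f"
proof -
  \<comment> \<open>The claim ranges over all of S because \<open>fold\<close> hands
    \<open>dir_deriv v f\<close> to the remaining directions.\<close>
  have "\<forall>f\<in>S. \<forall>x. fold dir_deriv vs f differentiable (at x)" for vs
  proof (induction vs)
    case Nil
    show ?case unfolding fold.simps id_apply differentiable_def using S by blast
  next
    case (Cons v vs)
    have "dir_deriv v f \<in> S" if f: "f \<in> S" for f
    proof -
      obtain D where D: "\<forall>x. (f has_derivative D x) (at x)" "\<forall>v. (\<lambda>x. D x v) \<in> S"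
        using S[OF f] by blast
      then have "dir_deriv v f = (\<lambda>x. D x v)"
        by (auto intro!: dir_deriv_eqI)
      then show ?thesis using D by simp
    qed
    then show ?case using Cons by auto
  qed
  then show ?thesis using assms(2) by (auto simp: smooth_fun_def)
qed

lemma dir_deriv_translate:
  assumes "smooth_fun f"
  shows "dir_deriv v (\<lambda>x. f (x + z)) x = dir_deriv v f (x + z)"
proof -
  have 1: "((\<lambda>x. x + z) has_derivative (\<lambda>h. h)) (at x)"
    by (auto intro!: derivative_eq_intros)
  have "(f has_derivative (\<lambda>h. dir_deriv h f (x + z))) (at (x + z))"
    by (rule smooth_fun_has_derivative[OF assms])
  from has_derivative_compose[OF 1 this] show ?thesis by (rule dir_deriv_eqI)
qed

lemma smooth_fun_translate:
  assumes "smooth_fun f"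
  shows "smooth_fun (\<lambda>x. f (x + z))"
proof (rule smooth_funI_closed)
  show "(\<lambda>x. f (x + z)) \<in> {\<lambda>x. h (x + z) |h. smooth_fun h}"
    using assms by blast
next
  fix f :: "'a \<Rightarrow> real" assume "f \<in> {\<lambda>x. h (x + z) |h. smooth_fun h}"
  then obtain h where h: "f = (\<lambda>x. h (x + z))" "smooth_fun h" by blast
  have f: "smooth_fun h \<Longrightarrow> (f has_derivative (\<lambda>v. dir_deriv v h (x + z))) (at x)" for x
    unfolding h(1)
    by (rule has_derivative_compose[of "\<lambda>x. x + z" "\<lambda>h. h"])
       (auto intro!: derivative_eq_intros smooth_fun_has_derivative)
  show "\<exists>D. (\<forall>x. (f has_derivative D x) (at x)) \<and>
            (\<forall>v. (\<lambda>x. D x v) \<in> {\<lambda>x. h (x + z) |h. smooth_fun h})"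
    using f h smooth_fun_dir_deriv by (intro exI[of _ "\<lambda>x v. dir_deriv v h (x + z)"]) blast
qed

section \<open>Smooth bumps on boxes\<close>

definition exp_flat :: "real poly \<Rightarrow> real \<Rightarrow> real" where
  "exp_flat P t = (if t > 0 then poly P (1 / t) * exp (- (1 / t)) else 0)"

lemma poly_exp_tendsto_0: "((\<lambda>u. poly P u * exp (- u)) \<longlongrightarrow> (0::real)) at_top"
proof -
  have "((\<lambda>u. coeff P i * u ^ i * exp (- u)) \<longlongrightarrow> (0::real)) at_top" for i
    using tendsto_mult_right_zero[OF tendsto_power_div_exp_0[of i], of "coeff P i"]
    by (simp add: exp_minus field_simps)
  then have "((\<lambda>u. \<Sum>i\<le>degree P. coeff P i * u ^ i * exp (- u)) \<longlongrightarrow> (0::real)) at_top"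
    by (intro tendsto_null_sum) auto
  then show ?thesis by (simp add: poly_altdef sum_distrib_right)
qed

text \<open>This is why a polynomial in 1/t is carried along: differentiating P(1/t) exp(-1/t) gives
  t^(-2) (P - P')(1/t) exp(-1/t), which is of the same form, so the family is closed under
  differentiation.\<close>

lemma exp_flat_has_derivative:
  "(exp_flat P has_real_derivative exp_flat ([:0, 0, 1:] * (P - pderiv P)) t) (at t)"
proof -
  consider "t > 0" | "t < 0" | "t = 0" by linarith
  then show ?thesis
  proof cases
    case 1
    have "((\<lambda>t. poly P (1 / t) * exp (- (1 / t))) has_real_derivative
            exp_flat ([:0, 0, 1:] * (P - pderiv P)) t) (at t)"
      using 1 by (auto intro!: derivative_eq_intros poly_DERIV[THEN DERIV_chain2]
          simp: exp_flat_def field_simps power2_eq_square)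
    then show ?thesis
      by (rule has_field_derivative_transform_within_open[where S = "{0<..}"])
        (use 1 in \<open>auto simp: exp_flat_def\<close>)
  next
    case 2
    have "((\<lambda>t. 0) has_real_derivative 0) (at t)" by simp
    then have "(exp_flat P has_real_derivative 0) (at t)"
      by (rule has_field_derivative_transform_within_open[where S = "{..<0}"])
        (use 2 in \<open>auto simp: exp_flat_def\<close>)
    then show ?thesis using 2 by (simp add: exp_flat_def)
  next
    case 3
    \<comment> \<open>The right difference quotient at 0 is exp_flat(h)/h. Dividing by h multiplies
      P by the variable 1/h, which is \<open>pCons 0 P\<close>, and exponential decay beats every
      polynomial.\<close>
    have "((\<lambda>h. poly (pCons 0 P) (inverse h) * exp (- (inverse h))) \<longlongrightarrow> 0) (at_right 0)"
      by (rule filterlim_compose[OF poly_exp_tendsto_0 filterlim_inverse_at_top_right])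
    then have "((\<lambda>h. exp_flat P h / h) \<longlongrightarrow> 0) (at_right 0)"
      by (rule tendsto_cong[THEN iffD1, rotated])
        (auto simp: exp_flat_def eventually_at_right_field field_simps intro: exI[of _ 1])
    moreover have "((\<lambda>h. exp_flat P h / h) \<longlongrightarrow> 0) (at_left 0)"
      by (rule tendsto_eventually) (auto simp: exp_flat_def eventually_at_left_field intro: exI[of _ "-1"])
    ultimately have "((\<lambda>h. exp_flat P h / h) \<longlongrightarrow> 0) (at 0)"
      using filterlim_split_at by blast
    then show ?thesis using 3 by (simp add: DERIV_def exp_flat_def)
  qed
qed

text \<open>The algebra generated by flat exponentials of affine functions. It contains the products
  that make up a box bump and is stable under directional derivatives, as
  \<open>smooth_funI_closed\<close> demands.\<close>

inductive_set exp_flat_algebra :: "('a::euclidean_space \<Rightarrow> real) set" where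
  base: "(\<lambda>x. exp_flat P (v \<bullet> x + b)) \<in> exp_flat_algebra"
| add: "f \<in> exp_flat_algebra \<Longrightarrow> g \<in> exp_flat_algebra \<Longrightarrow> (\<lambda>x. f x + g x) \<in> exp_flat_algebra"
| mult: "f \<in> exp_flat_algebra \<Longrightarrow> g \<in> exp_flat_algebra \<Longrightarrow> (\<lambda>x. f x * g x) \<in> exp_flat_algebra"

lemma exp_flat_algebra_smooth: "f \<in> exp_flat_algebra \<Longrightarrow> smooth_fun f"
proof (rule smooth_funI_closed[where S = exp_flat_algebra])
  fix f :: "'a \<Rightarrow> real"
  assume "f \<in> exp_flat_algebra"
  then show "\<exists>D. (\<forall>x. (f has_derivative D x) (at x)) \<and> (\<forall>v. (\<lambda>x. D x v) \<in> exp_flat_algebra)"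
  proof induction
    case (base P v b)
    let ?Q = "[:0, 0, 1:] * (P - pderiv P)"
    let ?D = "\<lambda>x h. exp_flat ?Q (v \<bullet> x + b) * (v \<bullet> h)"
    have "((\<lambda>x. exp_flat P (v \<bullet> x + b)) has_derivative ?D x) (at x)" for x
    proof -
      have "(exp_flat P has_derivative (*) (exp_flat ?Q (v \<bullet> x + b))) (at (v \<bullet> x + b))"
        using exp_flat_has_derivative[of P "v \<bullet> x + b"] unfolding has_field_derivative_def .
      moreover have "((\<lambda>x. v \<bullet> x + b) has_derivative (\<lambda>h. v \<bullet> h)) (at x)"
        by (auto intro!: derivative_eq_intros)
      ultimately show ?thesis using has_derivative_compose by fastforce
    qed
    \<comment> \<open>The chain rule factor v \<bullet> h is absorbed into the polynomial, so the
      derivative of a generator is again a generator and no constants have to be adjoined.\<close>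
    moreover have "(\<lambda>x. ?D x h) = (\<lambda>x. exp_flat (smult (v \<bullet> h) ?Q) (v \<bullet> x + b))" for h
      by (auto simp: exp_flat_def)
    ultimately show ?case
      by (intro exI[of _ ?D]) (simp add: exp_flat_algebra.base del: mult_pCons_left)
  next
    case (add f g)
    then obtain Df Dg where
      "\<forall>x. (f has_derivative Df x) (at x)" "\<forall>v. (\<lambda>x. Df x v) \<in> exp_flat_algebra"
      "\<forall>x. (g has_derivative Dg x) (at x)" "\<forall>v. (\<lambda>x. Dg x v) \<in> exp_flat_algebra" by blast
    then show ?case
      by (intro exI[of _ "\<lambda>x h. Df x h + Dg x h"])
        (auto intro!: exp_flat_algebra.add derivative_intros)
  next
    case (mult f g)
    then obtain Df Dg where
      "\<forall>x. (f has_derivative Df x) (at x)" "\<forall>v. (\<lambda>x. Df x v) \<in> exp_flat_algebra"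
      "\<forall>x. (g has_derivative Dg x) (at x)" "\<forall>v. (\<lambda>x. Dg x v) \<in> exp_flat_algebra" by blast
    then show ?case using mult
      by (intro exI[of _ "\<lambda>x h. f x * Dg x h + Df x h * g x"])
        (auto intro!: exp_flat_algebra.add exp_flat_algebra.mult derivative_intros)
  qed
qed

text \<open>The factor \<open>Suc n\<close> steepens the profile without moving the support: each
  bump is positive exactly on the open box, and the sequence tends to the indicator of the
  box.\<close>

definition box_bump :: "real^2 \<Rightarrow> real^2 \<Rightarrow> nat \<Rightarrow> real^2 \<Rightarrow> real" where
  "box_bump a b n x = (\<Prod>i\<in>UNIV. exp_flat 1 (real (Suc n) * (x $ i - a $ i)) *
                                  exp_flat 1 (real (Suc n) * (b $ i - x $ i)))"

lemma exp_flat_1: "exp_flat 1 t = (if t > 0 then exp (- (1 / t)) else 0)"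
  by (simp add: exp_flat_def)

lemma exp_flat_1_bounds: "0 \<le> exp_flat 1 t" "exp_flat 1 t \<le> 1"
  by (auto simp: exp_flat_1)

lemma box_bump_nonzero: "box_bump a b n x \<noteq> 0 \<longleftrightarrow> x \<in> box a b"
  by (auto simp: box_bump_def exp_flat_1 mem_box_cart prod_zero_iff zero_less_mult_iff split: if_splits)

lemma box_bump_bounds: "0 \<le> box_bump a b n x" "box_bump a b n x \<le> 1"
  unfolding box_bump_def
  by (intro prod_nonneg prod_le_1 ballI conjI mult_le_one mult_nonneg_nonneg exp_flat_1_bounds)+

lemma box_bump_tendsto: "(\<lambda>n. box_bump a b n x) \<longlonglongrightarrow> indicator (box a b) x"
proof (cases "x \<in> box a b")
  case True
  have e: "(\<lambda>n. exp_flat 1 (real (Suc n) * t)) \<longlonglongrightarrow> 1" if "t > 0" for t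
  proof -
    have "(\<lambda>n. - ((1 / t) * inverse (real (Suc n)))) \<longlonglongrightarrow> - ((1 / t) * 0)"
      by (intro tendsto_intros LIMSEQ_inverse_real_of_nat)
    then have "(\<lambda>n. exp (- ((1 / t) * inverse (real (Suc n))))) \<longlonglongrightarrow> exp 0"
      by (intro tendsto_exp) simp
    moreover have "exp_flat 1 (real (Suc n) * t) = exp (- ((1 / t) * inverse (real (Suc n))))" for n
      using that by (simp add: exp_flat_1 field_simps zero_less_mult_iff del: of_nat_Suc)
    ultimately show ?thesis by simp
  qed
  have "(\<lambda>n. box_bump a b n x) \<longlonglongrightarrow> (\<Prod>i\<in>(UNIV :: 2 set). 1 * 1)"
    unfolding box_bump_def
    by (intro tendsto_prod tendsto_mult e) (use True in \<open>auto simp: mem_box_cart\<close>)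
  then show ?thesis using True by simp
next
  case False
  then have "box_bump a b n x = 0" for n using box_bump_nonzero by blast
  then show ?thesis using False by simp
qed

lemma box_bump_smooth: "smooth_fun (box_bump a b n)"
proof -
  have 1: "(\<lambda>x::real^2. exp_flat 1 (real (Suc n) * (x $ i - a $ i))) \<in> exp_flat_algebra" for i
    using exp_flat_algebra.base[of 1 "real (Suc n) *\<^sub>R (axis i 1 :: real^2)" "- real (Suc n) * a $ i"]
    by (simp add: inner_axis' right_diff_distrib inner_real_def del: of_nat_Suc)
  have 2: "(\<lambda>x::real^2. exp_flat 1 (real (Suc n) * (b $ i - x $ i))) \<in> exp_flat_algebra" for i
    using exp_flat_algebra.base[of 1 "- real (Suc n) *\<^sub>R (axis i 1 :: real^2)" "real (Suc n) * b $ i"]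
    by (simp add: inner_axis' right_diff_distrib inner_real_def del: of_nat_Suc)
  show ?thesis
    unfolding box_bump_def[abs_def] UNIV_2
    by (intro exp_flat_algebra_smooth) (simp add: exp_flat_algebra.mult 1 2 del: of_nat_Suc)
qed

lemma box_bump_test_function:
  assumes "cbox a b \<subseteq> U"
  shows "box_bump a b n \<in> test_functions U"
proof -
  have "{x. box_bump a b n x \<noteq> 0} = box a b"
    using box_bump_nonzero by blast
  moreover have "closure (box a b) \<subseteq> cbox a b"
    by (intro closure_minimal box_subset_cbox closed_cbox)
  ultimately show ?thesis
    using assms box_bump_smooth
    by (auto simp: test_functions_def bounded_closure)
qed

section \<open>Translates and uniform bounds of test functions\<close>

lemma test_function_translate:
  assumes "\<phi> \<in> test_functions U" "\<And>x. x \<in> U \<Longrightarrow> x - z \<in> V"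
  shows "(\<lambda>x. \<phi> (x + z)) \<in> test_functions V"
proof -
  let ?S = "{x. \<phi> x \<noteq> 0}"
  have "{x. \<phi> (x + z) \<noteq> 0} = (\<lambda>x. - z + x) ` ?S"
    by (auto simp: image_iff intro!: exI[of _ "_ + z"])
  then have c: "closure {x. \<phi> (x + z) \<noteq> 0} = (\<lambda>x. - z + x) ` closure ?S"
    by (simp only: closure_translation)
  show ?thesis
    using assms unfolding test_functions_def
    by (auto simp only: c mem_Collect_eq intro!: smooth_fun_translate compact_translation) (simp add: subset_iff)
qed

lemma test_function_bounds:
  fixes \<phi> :: "real^2 \<Rightarrow> real"
  assumes "\<phi> \<in> test_functions U"
  obtains K M where "compact K" "K \<subseteq> U" "\<And>x. x \<notin> K \<Longrightarrow> \<phi> x = 0"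
    "\<And>x v. x \<notin> K \<Longrightarrow> dir_deriv v \<phi> x = 0" "M \<ge> 0" "\<And>x. \<bar>\<phi> x\<bar> \<le> M"
    "\<And>x v. \<bar>dir_deriv v \<phi> x\<bar> \<le> M * norm v"
proof -
  define K where "K = closure {x. \<phi> x \<noteq> 0}"
  have sm: "smooth_fun \<phi>" and K: "compact K" "K \<subseteq> U"
    using assms by (auto simp: test_functions_def K_def)
  have "{x. \<phi> x \<noteq> 0} \<subseteq> K" unfolding K_def by (rule closure_subset)
  then have z: "\<phi> x = 0" if "x \<notin> K" for x
    using that by auto
  have dz: "dir_deriv v \<phi> x = 0" if "x \<notin> K" for x v
    using has_derivative_zero_off_support[OF smooth_fun_has_derivative[OF sm, of x] compact_imp_closed[OF K(1)] z that]
    by metis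
  have bd: "\<exists>M\<ge>0. \<forall>x. \<bar>f x\<bar> \<le> M" if "smooth_fun f" "\<And>x. x \<notin> K \<Longrightarrow> f x = 0" for f :: "real^2 \<Rightarrow> real"
  proof -
    have "bounded (f ` K)"
      using compact_continuous_image[OF smooth_fun_continuous[OF that(1)] K(1)] compact_imp_bounded by blast
    then obtain M where "M > 0" "\<forall>x\<in>K. \<bar>f x\<bar> \<le> M" by (auto simp: bounded_pos)
    then show ?thesis using that(2) by (intro exI[of _ M]) (metis abs_zero less_imp_le)
  qed
  obtain M0 where M0: "M0 \<ge> 0" "\<forall>x. \<bar>\<phi> x\<bar> \<le> M0" using bd[OF sm z] by blast
  have "\<forall>i. \<exists>M\<ge>0. \<forall>x. \<bar>dir_deriv (axis i 1) \<phi> x\<bar> \<le> M"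
    using bd[OF smooth_fun_dir_deriv[OF sm] dz] by blast
  then obtain B where B: "\<And>i::2. B i \<ge> 0" "\<And>i x. \<bar>dir_deriv (axis i 1) \<phi> x\<bar> \<le> B i" by metis
  define M where "M = M0 + (\<Sum>i\<in>UNIV. B i)"
  have "\<bar>dir_deriv v \<phi> x\<bar> \<le> M * norm v" for x v
  proof -
    have "\<bar>dir_deriv v \<phi> x\<bar> \<le> (\<Sum>i\<in>UNIV. \<bar>v $ i\<bar> * \<bar>dir_deriv (axis i 1) \<phi> x\<bar>)"
      unfolding dir_deriv_axes[OF sm, of v] abs_mult[symmetric] by (rule sum_abs)
    also have "\<dots> \<le> (\<Sum>i\<in>UNIV. norm v * B i)"
      by (intro sum_mono mult_mono B) (auto simp: component_le_norm_cart)
    also have "\<dots> \<le> M * norm v"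
      using M0 unfolding sum_distrib_left[symmetric] M_def by (simp add: algebra_simps)
    finally show ?thesis .
  qed
  moreover have "M0 \<le> M" using B by (simp add: M_def sum_nonneg)
  ultimately show ?thesis
    using that[of K M] K z dz M0 by (meson order_trans)
qed

section \<open>Integrals of squares\<close>

lemma lborel_integral_translate:
  fixes f :: "'a::euclidean_space \<Rightarrow> real"
  assumes [measurable]: "f \<in> borel_measurable borel"
  shows "(LINT x|lborel. f (x + z)) = (LINT x|lborel. f x)"
proof -
  have "(LINT x|lborel. f x) = (LINT x|distr lborel borel ((+) z). f x)"
    by (simp add: lborel_distr_plus)
  also have "\<dots> = (LINT x|lborel. f (z + x))"
    by (rule integral_distr) auto
  finally show ?thesis by (simp add: add.commute)
qed

lemma lborel_integrable_translate:
  fixes f :: "'a::euclidean_space \<Rightarrow> real"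
  assumes "integrable lborel f"
  shows "integrable lborel (\<lambda>x. f (x + z))"
proof -
  have [measurable]: "f \<in> borel_measurable borel"
    using assms by auto
  have "integrable (distr lborel borel ((+) z)) f"
    using assms by (simp add: lborel_distr_plus)
  then have "integrable lborel (\<lambda>x. f (z + x))"
    by (rule integrable_distr[rotated]) auto
  then show ?thesis by (simp add: add.commute)
qed

lemma abs_mult_le_squares: "\<bar>a * b\<bar> \<le> (a\<^sup>2 + b\<^sup>2) / 2" for a b :: real
  using sum_squares_bound[of "\<bar>a\<bar>" "\<bar>b\<bar>"] by (simp add: abs_mult)

lemma abs_mult_le_squares': "\<bar>a * b\<bar> \<le> a\<^sup>2 + b\<^sup>2" for a b :: real
  by (rule order_trans[OF abs_mult_le_squares]) simp

lemma borel_measurable_component [measurable]: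
  fixes g :: "'a \<Rightarrow> real^'n"
  shows "g \<in> borel_measurable M \<Longrightarrow> (\<lambda>x. g x $ i) \<in> borel_measurable M"
  by (rule measurable_compose[of g M borel "\<lambda>v. v $ i"])
     (auto intro!: borel_measurable_continuous_onI continuous_on_component)

lemma square_integrable_mult:
  fixes f g :: "'a \<Rightarrow> real"
  assumes [measurable]: "f \<in> borel_measurable M" "g \<in> borel_measurable M"
    and "integrable M (\<lambda>x. (f x)\<^sup>2)" "integrable M (\<lambda>x. (g x)\<^sup>2)"
  shows "integrable M (\<lambda>x. f x * g x)"
proof (rule Bochner_Integration.integrable_bound)
  show "integrable M (\<lambda>x. ((f x)\<^sup>2 + (g x)\<^sup>2) / 2)"
    using assms by auto
  show "AE x in M. norm (f x * g x) \<le> norm (((f x)\<^sup>2 + (g x)\<^sup>2) / 2)"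
    using abs_mult_le_squares[of "f _" "g _"] by (auto intro!: AE_I2 simp: abs_mult)
qed auto

lemma norm_add_square_le: "(norm (x + y))\<^sup>2 \<le> 2 * (norm x)\<^sup>2 + 2 * (norm (y::'a::real_normed_vector))\<^sup>2"
proof -
  have "(norm (x + y))\<^sup>2 \<le> (norm x + norm y)\<^sup>2"
    by (intro power_mono norm_triangle_ineq) auto
  also have "\<dots> \<le> 2 * (norm x)\<^sup>2 + 2 * (norm y)\<^sup>2"
    using sum_squares_bound[of "norm x" "norm y"] by (simp add: power2_sum)
  finally show ?thesis .
qed

lemma square_integrable_add:
  fixes f g :: "'a \<Rightarrow> 'b::euclidean_space"
  assumes [measurable]: "f \<in> borel_measurable M" "g \<in> borel_measurable M"
    and "integrable M (\<lambda>x. (norm (f x))\<^sup>2)" "integrable M (\<lambda>x. (norm (g x))\<^sup>2)"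
  shows "integrable M (\<lambda>x. (norm (f x + g x))\<^sup>2)"
proof (rule Bochner_Integration.integrable_bound)
  show "integrable M (\<lambda>x. 2 * (norm (f x))\<^sup>2 + 2 * (norm (g x))\<^sup>2)"
    using assms by auto
  show "AE x in M. norm ((norm (f x + g x))\<^sup>2) \<le> norm (2 * (norm (f x))\<^sup>2 + 2 * (norm (g x))\<^sup>2)"
    using norm_add_square_le[of "f _" "g _"] by (intro AE_I2) (simp add: abs_of_nonneg)
qed auto

lemma square_integrable_inner:
  fixes f g :: "'a \<Rightarrow> 'b::euclidean_space"
  assumes [measurable]: "f \<in> borel_measurable M" "g \<in> borel_measurable M"
    and "integrable M (\<lambda>x. (norm (f x))\<^sup>2)" "integrable M (\<lambda>x. (norm (g x))\<^sup>2)"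
  shows "integrable M (\<lambda>x. f x \<bullet> g x)"
proof (rule Bochner_Integration.integrable_bound)
  show "integrable M (\<lambda>x. norm (f x) * norm (g x))"
    using assms by (intro square_integrable_mult) auto
  show "AE x in M. norm (f x \<bullet> g x) \<le> norm (norm (f x) * norm (g x))"
    by (intro AE_I2) (simp add: Cauchy_Schwarz_ineq2)
qed auto

text \<open>The quadratic t -> integral of (f - t g)^2 is nonnegative; its value at the minimizer t
  = B / C, multiplied by C, is the claim. If C = 0 then g vanishes almost everywhere.\<close>

lemma Cauchy_Schwarz_integral:
  fixes f g :: "'a \<Rightarrow> real"
  assumes [measurable]: "f \<in> borel_measurable M" "g \<in> borel_measurable M"
    and int: "integrable M (\<lambda>x. (f x)\<^sup>2)" "integrable M (\<lambda>x. (g x)\<^sup>2)"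
  shows "(LINT x|M. f x * g x)\<^sup>2 \<le> (LINT x|M. (f x)\<^sup>2) * (LINT x|M. (g x)\<^sup>2)"
proof -
  define A B C where "A = (LINT x|M. (f x)\<^sup>2)" and "B = (LINT x|M. f x * g x)"
    and "C = (LINT x|M. (g x)\<^sup>2)"
  have fg: "integrable M (\<lambda>x. f x * g x)" by (rule square_integrable_mult) fact+
  have q: "0 \<le> A - 2 * t * B + t\<^sup>2 * C" for t
  proof -
    have "0 \<le> (LINT x|M. (f x - t * g x)\<^sup>2)" by simp
    also have "\<dots> = (LINT x|M. (f x)\<^sup>2 - 2 * t * (f x * g x) + t\<^sup>2 * (g x)\<^sup>2)"
      by (rule Bochner_Integration.integral_cong) (auto simp: power2_eq_square algebra_simps)
    also have "\<dots> = A - 2 * t * B + t\<^sup>2 * C"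
      using int fg by (simp add: A_def B_def C_def)
    finally show ?thesis .
  qed
  have "C \<ge> 0" by (simp add: C_def)
  show ?thesis
  proof (cases "C = 0")
    case True
    then have "AE x in M. (g x)\<^sup>2 = 0"
      using integral_nonneg_eq_0_iff_AE[OF int(2)] by (simp add: C_def)
    then have "AE x in M. f x * g x = 0" by auto
    then have "B = 0" unfolding B_def by (rule integral_eq_zero_AE)
    then show ?thesis by (simp add: B_def[symmetric])
  next
    case False
    then have "0 \<le> (A - 2 * (B / C) * B + (B / C)\<^sup>2 * C) * C"
      using q[of "B / C"] \<open>C \<ge> 0\<close> by (intro mult_nonneg_nonneg) auto
    also have "\<dots> = A * C - B\<^sup>2"
      using False by (simp add: field_simps power2_eq_square)
    finally show ?thesis by (simp add: A_def B_def C_def)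
  qed
qed

lemma integrable_indicator_bounded:
  fixes U :: "'a::euclidean_space set"
  shows "bounded U \<Longrightarrow> U \<in> sets borel \<Longrightarrow> integrable lborel (indicat_real U)"
  by (intro integrable_real_indicator emeasure_bounded_finite) auto

lemma indicator_power2: "(indicat_real U x)\<^sup>2 = indicat_real U x"
  by (simp add: indicator_def)

lemma integrable_of_square_bounded_support:
  fixes f :: "'a::euclidean_space \<Rightarrow> 'b::euclidean_space"
  assumes [measurable]: "f \<in> borel_measurable borel"
    and "integrable lborel (\<lambda>x. (norm (f x))\<^sup>2)" "bounded U" "\<And>x. x \<notin> U \<Longrightarrow> f x = 0"
  shows "integrable lborel f"
proof -
  obtain r where r: "\<forall>x\<in>U. norm x \<le> r"
    using assms(3) by (auto simp: bounded_iff)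
  show ?thesis
  proof (rule Bochner_Integration.integrable_bound)
    show "integrable lborel (\<lambda>x. indicator (cball 0 r) x + (norm (f x))\<^sup>2)"
      using assms by (intro Bochner_Integration.integrable_add integrable_real_indicator)
        (auto intro: emeasure_bounded_finite[unfolded infinity_ennreal_def])
    have "norm (f x) \<le> indicator (cball 0 r) x + (norm (f x))\<^sup>2" for x
    proof (cases "x \<in> U")
      case True
      have "norm (f x) * 1 \<le> ((norm (f x))\<^sup>2 + 1\<^sup>2) / 2"
        using abs_mult_le_squares[of "norm (f x)" 1] by simp
      also have "\<dots> \<le> 1 + (norm (f x))\<^sup>2" by simp
      finally show ?thesis using True r by (auto simp: indicator_def)
    qed (use assms in \<open>auto simp: indicator_def\<close>)
    then show "AE x in lborel. norm (f x) \<le> norm (indicat_real (cball 0 r) x + (norm (f x))\<^sup>2)"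
      by (intro AE_I2) simp
  qed auto
qed

section \<open>The fundamental lemma of the calculus of variations\<close>

text \<open>The bumps tend to the indicator of the box and stay below 1, so |f| dominates and the
  vanishing integrals pass to the limit.\<close>

lemma fundamental_lemma_box:
  fixes f :: "real^2 \<Rightarrow> real"
  assumes f: "integrable lborel f"
    and zero: "\<And>\<phi>. \<phi> \<in> test_functions U \<Longrightarrow> (LINT x|lborel. f x * \<phi> x) = 0"
    and "cbox a b \<subseteq> U"
  shows "(LINT x|lborel. indicator (box a b) x * f x) = 0"
proof -
  have [measurable]: "f \<in> borel_measurable borel" using f by auto
  have [measurable]: "box_bump a b n \<in> borel_measurable borel" for n
    by (intro borel_measurable_continuous_onI smooth_fun_continuous box_bump_smooth)
  have "(\<lambda>n. LINT x|lborel. f x * box_bump a b n x) \<longlonglongrightarrow> (LINT x|lborel. f x * indicator (box a b) x)"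
  proof (rule integral_dominated_convergence[where w = "\<lambda>x. \<bar>f x\<bar>"])
    show "AE x in lborel. (\<lambda>n. f x * box_bump a b n x) \<longlonglongrightarrow> f x * indicator (box a b) x"
      by (intro AE_I2 tendsto_mult tendsto_const box_bump_tendsto)
    show "AE x in lborel. norm (f x * box_bump a b n x) \<le> \<bar>f x\<bar>" for n
      using box_bump_bounds[of a b n]
      by (intro AE_I2) (simp add: abs_mult mult_left_le)
  qed (use f in auto)
  moreover have "(LINT x|lborel. f x * box_bump a b n x) = 0" for n
    by (intro zero box_bump_test_function assms)
  ultimately show ?thesis
    by (simp add: mult.commute LIMSEQ_const_iff)
qed

text \<open>Inside a fixed box, the intersection with any other box is again a box, so the truncated
  f has integral zero over all boxes. Boxes are an intersection-stable generator of the Borel sets,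
  hence its integral over every Borel set is zero. Countably many closed boxes exhaust U.\<close>

lemma fundamental_lemma:
  fixes f :: "real^2 \<Rightarrow> real"
  assumes f: "integrable lborel f" and "open U"
    and zero: "\<And>\<phi>. \<phi> \<in> test_functions U \<Longrightarrow> (LINT x|lborel. f x * \<phi> x) = 0"
  shows "AE x in lborel. x \<in> U \<longrightarrow> f x = 0"
proof -
  have fm[measurable]: "f \<in> borel_measurable borel" using f by auto
  have on_box: "AE x in lborel. x \<in> cbox a b \<longrightarrow> f x = 0" if ab: "cbox a b \<subseteq> U" for a b
  proof -
    let ?F = "\<lambda>x. indicator (box a b) x * f x"
    let ?G = "range (\<lambda>(a, b). box a b::(real^2) set)"
    have F: "integrable lborel ?F"
      using integrable_mult_indicator[OF _ f, of "box a b"] by simp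
    have G: "(LINT x:box c d|lborel. ?F x) = 0" for c d
    proof -
      obtain p q where pq: "box c d \<inter> box a b = box p q"
        using box_Int_box by blast
      have "(LINT x:box c d|lborel. ?F x) = (LINT x|lborel. indicator (box p q) x * f x)"
        unfolding set_lebesgue_integral_def
        by (rule Bochner_Integration.integral_cong) (auto simp: pq[symmetric] indicator_def)
      also have "\<dots> = 0"
      proof (cases "box p q = {}")
        case False
        then have "cbox p q \<subseteq> cbox a b"
          using pq by (metis Int_lower2 box_subset_cbox closure_box closure_minimal
              closed_cbox order_trans)
        then show ?thesis
          using ab by (intro fundamental_lemma_box[where U = U, OF f zero]) auto
      qed simp
      finally show ?thesis .
    qed
    have "set_lebesgue_integral lborel A ?F = 0" if "A \<in> sets lborel" for A
    proof -
      have "Int_stable ?G" by (auto simp: Int_stable_def box_Int_box)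
      moreover have "?G \<subseteq> Pow UNIV" by simp
      moreover have "A \<in> sigma_sets UNIV ?G" using that by (simp add: borel_eq_box)
      ultimately show ?thesis
      proof (induction rule: sigma_sets_induct_disjoint)
        case (basic A)
        then show ?case using G by auto
      next
        case empty
        then show ?case by (simp add: set_lebesgue_integral_def)
      next
        case (compl A)
        then have A[measurable]: "A \<in> sets borel" by (simp add: borel_eq_box)
        have "(LINT x|lborel. ?F x) = 0"
          using fundamental_lemma_box[OF f zero ab] by simp
        moreover have "(LINT x|lborel. ?F x) = (LINT x:(UNIV - A)|lborel. ?F x) + (LINT x:A|lborel. ?F x)"
          unfolding set_lebesgue_integral_def
          by (subst Bochner_Integration.integral_add[symmetric])
             (intro integrable_mult_indicator F Bochner_Integration.integral_cong refl; simp add: indicator_def)+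
        ultimately show ?case using compl by simp
      next
        case (union A)
        then have A: "A i \<in> sets lborel" for i by (auto simp: borel_eq_box)
        have "set_integrable lborel (\<Union>i. A i) ?F"
          unfolding set_integrable_def using A by (intro integrable_mult_indicator F) auto
        then have "(LINT x:(\<Union>i. A i)|lborel. ?F x) = (\<Sum>i. (LINT x:(A i)|lborel. ?F x))"
          using union(1) A
          by (intro lebesgue_integral_countable_add) (auto simp: disjoint_family_on_def)
        then show ?case using union by simp
      qed
    qed
    then have ae: "AE x in lborel. ?F x = 0"
      by (intro sigma_finite_measure.density_zero[OF sigma_finite_lborel F])
    \<comment> \<open>So far f is known to vanish only on the open box; the boundary of the box is a
      null set.\<close>
    have "cbox a b - box a b \<in> null_sets lborel"
      using negligible_frontier_interval[of a b] null_sets_completion_iff[of "cbox a b - box a b" lborel]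
      by (simp add: negligible_iff_null_sets)
    then have "AE x in lborel. x \<notin> cbox a b - box a b" by (rule AE_not_in)
    with ae show ?thesis by eventually_elim (auto simp: indicator_def split: if_splits)
  qed
  obtain \<D> where D: "countable \<D>" "\<D> \<subseteq> Pow U" "\<And>X. X \<in> \<D> \<Longrightarrow> \<exists>a b. X = cbox a b" "\<Union>\<D> = U"
    using open_countable_Union_open_cbox[OF \<open>open U\<close>] by metis
  have "AE x in lborel. \<forall>X\<in>\<D>. x \<in> X \<longrightarrow> f x = 0"
  proof (rule AE_ball_countable'[OF _ D(1)])
    fix X assume "X \<in> \<D>"
    then obtain a b where "X = cbox a b" "cbox a b \<subseteq> U" using D by blast
    then show "AE x in lborel. x \<in> X \<longrightarrow> f x = 0" using on_box by simp
  qed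
  then show ?thesis using D(4) by auto
qed

section \<open>Borel representatives of Sobolev functions\<close>

text \<open>Borel functions vanishing off \<open>\<Omega>\<close>, so that all integrals may be taken with respect to
  \<^term>\<open>lborel\<close> and translations preserve measurability.\<close>

definition sob :: "(real^2) set \<Rightarrow> (real^2 \<Rightarrow> real) \<Rightarrow> (real^2 \<Rightarrow> real^2) \<Rightarrow> bool" where
  "sob \<Omega> v g \<longleftrightarrow> v \<in> borel_measurable borel \<and> g \<in> borel_measurable borel \<and>
     (\<forall>x. x \<notin> \<Omega> \<longrightarrow> v x = 0) \<and> (\<forall>x. x \<notin> \<Omega> \<longrightarrow> g x = 0) \<and>
     integrable lborel (\<lambda>x. (v x)\<^sup>2) \<and> integrable lborel (\<lambda>x. (norm (g x))\<^sup>2) \<and>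
     (\<forall>\<phi>\<in>test_functions \<Omega>. \<forall>i. (LINT x|lborel. v x * dir_deriv (axis i 1) \<phi> x) =
        - (LINT x|lborel. g x $ i * \<phi> x))"

lemma
  assumes "sob \<Omega> v g"
  shows sob_measurable: "v \<in> borel_measurable borel" "g \<in> borel_measurable borel"
    and sob_off: "\<And>x. x \<notin> \<Omega> \<Longrightarrow> v x = 0" "\<And>x. x \<notin> \<Omega> \<Longrightarrow> g x = 0"
    and sob_square: "integrable lborel (\<lambda>x. (v x)\<^sup>2)" "integrable lborel (\<lambda>x. (norm (g x))\<^sup>2)"
    and sob_weak: "\<And>\<phi> i. \<phi> \<in> test_functions \<Omega> \<Longrightarrow>
       (LINT x|lborel. v x * dir_deriv (axis i 1) \<phi> x) = - (LINT x|lborel. g x $ i * \<phi> x)"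
  using assms by (auto simp: sob_def)

lemma
  assumes "\<phi> \<in> test_functions U"
  shows test_function_measurable: "\<phi> \<in> borel_measurable borel" "dir_deriv z \<phi> \<in> borel_measurable borel"
    and test_function_square_integrable: "integrable lborel (\<lambda>x. (\<phi> x)\<^sup>2)"
      "integrable lborel (\<lambda>x. (dir_deriv z \<phi> x)\<^sup>2)"
proof -
  have sm: "smooth_fun \<phi>" using assms by (simp add: test_functions_def)
  then show 1[measurable]: "\<phi> \<in> borel_measurable borel" "dir_deriv z \<phi> \<in> borel_measurable borel"
    by (auto intro!: borel_measurable_continuous_onI smooth_fun_continuous smooth_fun_dir_deriv_continuous)
  obtain K M where K: "compact K" "K \<subseteq> U" "\<And>x. x \<notin> K \<Longrightarrow> \<phi> x = 0"
    "\<And>x v. x \<notin> K \<Longrightarrow> dir_deriv v \<phi> x = 0" "M \<ge> 0" "\<And>x. \<bar>\<phi> x\<bar> \<le> M"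
    "\<And>x v. \<bar>dir_deriv v \<phi> x\<bar> \<le> M * norm v"
    using test_function_bounds[OF assms] by metis
  have bd: "integrable lborel (\<lambda>x. (f x)\<^sup>2)"
    if [measurable]: "f \<in> borel_measurable borel" and f: "\<And>x. x \<notin> K \<Longrightarrow> f x = 0" "\<And>x. \<bar>f x\<bar> \<le> B" for f :: "real^2 \<Rightarrow> real" and B
  proof (rule Bochner_Integration.integrable_bound)
    show "integrable lborel (\<lambda>x. indicat_real K x * B\<^sup>2)"
      using K(1) by (intro integrable_mult_left integrable_real_indicator)
        (auto intro: emeasure_compact_finite[unfolded infinity_ennreal_def] borel_compact)
    have "norm ((f x)\<^sup>2) \<le> norm (indicat_real K x * B\<^sup>2)" for x
      using f[of x] by (cases "x \<in> K") (auto simp: abs_le_square_iff[symmetric])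
    then show "AE x in lborel. norm ((f x)\<^sup>2) \<le> norm (indicat_real K x * B\<^sup>2)" by simp
  qed auto
  show "integrable lborel (\<lambda>x. (\<phi> x)\<^sup>2)" by (rule bd[OF 1(1) K(3,6)])
  show "integrable lborel (\<lambda>x. (dir_deriv z \<phi> x)\<^sup>2)" by (rule bd[OF 1(2) K(4,7)])
qed

lemma sob_weak_direction:
  assumes s: "sob \<Omega> v g" and \<phi>: "\<phi> \<in> test_functions \<Omega>"
  shows "(LINT x|lborel. v x * dir_deriv z \<phi> x) = - (LINT x|lborel. (g x \<bullet> z) * \<phi> x)"
proof -
  note [measurable] = sob_measurable[OF s] test_function_measurable[OF \<phi>]
  have sm: "smooth_fun \<phi>" using \<phi> by (simp add: test_functions_def)
  have gi: "integrable lborel (\<lambda>x. (g x $ i)\<^sup>2)" for i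
  proof (rule Bochner_Integration.integrable_bound[OF sob_square(2)[OF s]])
    show "AE x in lborel. norm ((g x $ i)\<^sup>2) \<le> norm ((norm (g x))\<^sup>2)"
      using component_le_norm_cart[of "g _" i] by (intro AE_I2) (simp add: abs_le_square_iff[symmetric])
  qed (auto intro!: borel_measurable_component)
  have 1: "integrable lborel (\<lambda>x. v x * dir_deriv (axis i 1) \<phi> x)" for i
    by (intro square_integrable_mult sob_square[OF s] test_function_square_integrable[OF \<phi>]) measurable
  have 2: "integrable lborel (\<lambda>x. g x $ i * \<phi> x)" for i
    by (intro square_integrable_mult gi test_function_square_integrable[OF \<phi>]) measurable
  have "(LINT x|lborel. v x * dir_deriv z \<phi> x) =
        (LINT x|lborel. (\<Sum>i\<in>UNIV. z $ i * (v x * dir_deriv (axis i 1) \<phi> x)))"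
    by (simp add: dir_deriv_axes[OF sm, of z] sum_distrib_left mult.left_commute)
  also have "\<dots> = (\<Sum>i\<in>UNIV. z $ i * - (LINT x|lborel. g x $ i * \<phi> x))"
    using 1 by (simp add: sob_weak[OF s \<phi>])
  also have "\<dots> = - (LINT x|lborel. (\<Sum>i\<in>UNIV. z $ i * (g x $ i * \<phi> x)))"
    using 2 by (simp add: sum_negf)
  also have "(\<lambda>x. (\<Sum>i\<in>UNIV. z $ i * (g x $ i * \<phi> x))) = (\<lambda>x. (g x \<bullet> z) * \<phi> x)"
    by (auto simp: inner_vec_def sum_distrib_right sum_distrib_left mult_ac)
  finally show ?thesis .
qed

section \<open>Differences of Sobolev functions\<close>

text \<open>Joint integrability comes from |f h| <= f^2 + h^2: by translation invariance the
  x-integral of the right-hand side is the same for every s.\<close>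

lemma segment_average_Fubini:
  fixes f h :: "real^2 \<Rightarrow> real"
  assumes [measurable]: "f \<in> borel_measurable borel" "h \<in> borel_measurable borel"
    and f: "integrable lborel (\<lambda>x. (f x)\<^sup>2)" and h: "integrable lborel (\<lambda>x. (h x)\<^sup>2)"
  shows "integrable lborel (\<lambda>x. f x * (LINT s|lborel. indicator {0..1} s * h (x + s *\<^sub>R z)))"
    and "integrable lborel (\<lambda>s. indicator {0..1} s * (LINT x|lborel. f x * h (x + s *\<^sub>R z)))"
    and "(LINT x|lborel. f x * (LINT s|lborel. indicator {0..1} s * h (x + s *\<^sub>R z))) =
         (LINT s|lborel. indicator {0..1} s * (LINT x|lborel. f x * h (x + s *\<^sub>R z)))"
proof -
  let ?F = "\<lambda>s x. indicator {0..1::real} s * (f x * h (x + s *\<^sub>R z))"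
  have hs: "integrable lborel (\<lambda>x. (h (x + y))\<^sup>2)" for y
    using lborel_integrable_translate[OF h] by simp
  have fh: "integrable lborel (\<lambda>x. f x * h (x + y))" for y
    by (intro square_integrable_mult f hs) auto
  have *: "integrable (lborel \<Otimes>\<^sub>M lborel) (\<lambda>(s, x). ?F s x)"
  proof (rule lborel_pair.Fubini_integrable)
    show "integrable lborel (\<lambda>s. LINT x|lborel. norm (case (s, x) of (s, x) \<Rightarrow> ?F s x))"
    proof (rule Bochner_Integration.integrable_bound)
      show "integrable lborel (\<lambda>s. indicator {0..1::real} s * ((LINT x|lborel. (f x)\<^sup>2) + (LINT x|lborel. (h x)\<^sup>2)))"
        by auto
      have "(LINT x|lborel. \<bar>f x * h (x + y)\<bar>) \<le> (LINT x|lborel. (f x)\<^sup>2) + (LINT x|lborel. (h x)\<^sup>2)" for y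
      proof -
        have "(LINT x|lborel. \<bar>f x * h (x + y)\<bar>) \<le> (LINT x|lborel. (f x)\<^sup>2 + (h (x + y))\<^sup>2)"
        proof (rule integral_mono)
          show "\<bar>f x * h (x + y)\<bar> \<le> (f x)\<^sup>2 + (h (x + y))\<^sup>2" for x
            by (rule abs_mult_le_squares')
        qed (use f hs fh in auto)
        also have "\<dots> = (LINT x|lborel. (f x)\<^sup>2) + (LINT x|lborel. (h x)\<^sup>2)"
          using f hs lborel_integral_translate[of "\<lambda>x. (h x)\<^sup>2" y] by simp
        finally show ?thesis .
      qed
      then show "AE s in lborel. norm (LINT x|lborel. norm (case (s, x) of (s, x) \<Rightarrow> ?F s x))
          \<le> norm (indicator {0..1} s * ((LINT x|lborel. (f x)\<^sup>2) + (LINT x|lborel. (h x)\<^sup>2)))"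
        by (intro AE_I2) (auto simp: indicator_def abs_mult)
    qed measurable
    show "AE s in lborel. integrable lborel (\<lambda>x. case (s, x) of (s, x) \<Rightarrow> ?F s x)"
      using fh by (intro AE_I2) auto
  qed measurable
  have 1: "(LINT s|lborel. ?F s x) = f x * (LINT s|lborel. indicator {0..1} s * h (x + s *\<^sub>R z))" for x
    by (subst integral_mult_right_zero[symmetric]) (simp add: mult_ac)
  have 2: "(LINT x|lborel. ?F s x) = indicator {0..1} s * (LINT x|lborel. f x * h (x + s *\<^sub>R z))" for s
    by simp
  show "integrable lborel (\<lambda>x. f x * (LINT s|lborel. indicator {0..1} s * h (x + s *\<^sub>R z)))"
    using lborel_pair.integrable_snd[OF *] unfolding 1 .
  show "integrable lborel (\<lambda>s. indicator {0..1} s * (LINT x|lborel. f x * h (x + s *\<^sub>R z)))"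
    using lborel_pair.integrable_fst[OF *] unfolding 2 .
  show "(LINT x|lborel. f x * (LINT s|lborel. indicator {0..1} s * h (x + s *\<^sub>R z))) =
         (LINT s|lborel. indicator {0..1} s * (LINT x|lborel. f x * h (x + s *\<^sub>R z)))"
    using lborel_pair.Fubini_integral[OF *] unfolding 1 2 .
qed

lemma sob_gradient_component:
  assumes s: "sob \<Omega> v g"
  shows "integrable lborel (\<lambda>x. (g x \<bullet> z)\<^sup>2)"
    and "(LINT x|lborel. (g x \<bullet> z)\<^sup>2) \<le> (norm z)\<^sup>2 * (LINT x|lborel. (norm (g x))\<^sup>2)"
proof -
  note [measurable] = sob_measurable[OF s]
  have i: "integrable lborel (\<lambda>x. (norm z)\<^sup>2 * (norm (g x))\<^sup>2)"
    using sob_square(2)[OF s] by auto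
  have le: "(g x \<bullet> z)\<^sup>2 \<le> (norm z)\<^sup>2 * (norm (g x))\<^sup>2" for x
    using Cauchy_Schwarz_ineq2[of "g x" z]
    by (metis abs_le_square_iff abs_mult abs_norm_cancel mult.commute power_mult_distrib)
  show 1: "integrable lborel (\<lambda>x. (g x \<bullet> z)\<^sup>2)"
    by (rule Bochner_Integration.integrable_bound[OF i]) (use le in \<open>auto intro!: AE_I2\<close>)
  have "(LINT x|lborel. (g x \<bullet> z)\<^sup>2) \<le> (LINT x|lborel. (norm z)\<^sup>2 * (norm (g x))\<^sup>2)"
    by (rule integral_mono[OF 1 i le])
  then show "(LINT x|lborel. (g x \<bullet> z)\<^sup>2) \<le> (norm z)\<^sup>2 * (LINT x|lborel. (norm (g x))\<^sup>2)"
    by simp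
qed

text \<open>The fundamental theorem of calculus in dual form. Tested against \<phi>, the difference
  of v becomes a difference of \<phi>, to which the classical theorem applies; the weak gradient
  then moves the derivative back to v. No approximation of v by smooth functions is involved. The
  segment hypothesis ensures that each intermediate translate of \<phi> is a test function on
  \<Omega>.\<close>

lemma sob_difference_AE:
  assumes s: "sob \<Omega> v g" and U: "open U" "bounded U"
    and seg: "\<And>x t. x \<in> U \<Longrightarrow> 0 \<le> t \<Longrightarrow> t \<le> 1 \<Longrightarrow> x + t *\<^sub>R z \<in> \<Omega>"
  shows "AE x in lborel. x \<in> U \<longrightarrow>
           v (x + z) - v x = (LINT t|lborel. indicator {0..1} t * (g (x + t *\<^sub>R z) \<bullet> z))"
proof -
  note [measurable] = sob_measurable[OF s]
  define h where "h x = g x \<bullet> z" for x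
  define I where "I x = (LINT t|lborel. indicator {0..1} t * h (x + t *\<^sub>R z))" for x
  have [measurable]: "h \<in> borel_measurable borel" unfolding h_def by measurable
  have h2: "integrable lborel (\<lambda>x. (h x)\<^sup>2)"
    unfolding h_def by (rule sob_gradient_component[OF s])
  have vz: "integrable lborel (\<lambda>x. (v (x + z))\<^sup>2)"
    using lborel_integrable_translate[OF sob_square(1)[OF s]] by simp
  have [measurable]: "U \<in> sets borel" using U by simp
  have iU: "integrable lborel (\<lambda>x. (indicat_real U x)\<^sup>2)"
    using integrable_indicator_bounded[OF U(2)] by (simp add: indicator_power2)
  have int_v: "integrable lborel (\<lambda>x. indicator U x * v (x + z))" "integrable lborel (\<lambda>x. indicator U x * v x)"
    by (intro square_integrable_mult iU vz sob_square[OF s]; measurable)+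
  have int_I: "integrable lborel (\<lambda>x. indicator U x * I x)"
    unfolding I_def by (rule segment_average_Fubini(1)) (use iU h2 in auto)
  define f where "f x = indicator U x * v (x + z) - indicator U x * v x - indicator U x * I x" for x
  have "AE x in lborel. x \<in> U \<longrightarrow> f x = 0"
  proof (rule fundamental_lemma[OF _ U(1)])
    show "integrable lborel f"
      unfolding f_def using int_v int_I by auto
    fix \<phi> assume \<phi>: "\<phi> \<in> test_functions U"
    note [measurable] = test_function_measurable[OF \<phi>]
    have sm: "smooth_fun \<phi>" using \<phi> by (simp add: test_functions_def)
    have off: "\<phi> x = 0" if "x \<notin> U" for x
      using test_function_bounds[OF \<phi>] that by (metis subsetD)
    \<comment> \<open>Shifting v by z amounts to shifting the test function by -z under the
      integral.\<close>
    define w where "w = - z"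
    note \<phi>2 = test_function_square_integrable[OF \<phi>]
    have \<phi>w: "integrable lborel (\<lambda>x. (\<phi> (x + w))\<^sup>2)"
      using lborel_integrable_translate[OF \<phi>2(1)] by simp
    have ftc: "\<phi> (x + w) - \<phi> x = (LINT t|lborel. indicator {0..1} t * dir_deriv w \<phi> (x + t *\<^sub>R w))" for x
    proof -
      have "((\<lambda>t. \<phi> (x + t *\<^sub>R w)) has_real_derivative dir_deriv w \<phi> (x + t *\<^sub>R w)) (at t)" for t
        by (rule has_real_derivative_along_line[OF smooth_fun_has_derivative[OF sm]])
      moreover have "isCont (\<lambda>t. dir_deriv w \<phi> (x + t *\<^sub>R w)) t" for t
        by (rule isCont_o2[where g = "dir_deriv w \<phi>"])
          (use smooth_fun_dir_deriv_continuous[OF sm, of UNIV w] in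
           \<open>auto simp: continuous_on_eq_continuous_at intro!: continuous_intros\<close>)
      ultimately have "(LINT t|lborel. dir_deriv w \<phi> (x + t *\<^sub>R w) * indicator {0..1} t) =
          \<phi> (x + 1 *\<^sub>R w) - \<phi> (x + 0 *\<^sub>R w)"
        by (intro integral_FTC_Icc_real[where F = "\<lambda>t. \<phi> (x + t *\<^sub>R w)"]) auto
      then show ?thesis by (simp add: mult.commute)
    qed
    \<comment> \<open>For each fixed t, the weak derivative of v is tested with the translate of
      \<phi>, and a change of variables moves the shift from \<phi> to g.\<close>
    have key: "(LINT x|lborel. v x * dir_deriv w \<phi> (x + t *\<^sub>R w)) = (LINT x|lborel. \<phi> x * h (x + t *\<^sub>R z))"
      if t: "0 \<le> t" "t \<le> 1" for t
    proof -
      have ts: "(\<lambda>x. \<phi> (x + t *\<^sub>R w)) \<in> test_functions \<Omega>"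
        by (rule test_function_translate[OF \<phi>]) (use seg t in \<open>auto simp: w_def\<close>)
      have "(LINT x|lborel. v x * dir_deriv w \<phi> (x + t *\<^sub>R w)) =
            - (LINT x|lborel. (g x \<bullet> w) * \<phi> (x + t *\<^sub>R w))"
        using sob_weak_direction[OF s ts, of w] by (simp add: dir_deriv_translate[OF sm])
      also have "\<dots> = (LINT x|lborel. h x * \<phi> (x + t *\<^sub>R w))"
        by (simp add: h_def w_def)
      also have "\<dots> = (LINT x|lborel. h (x + t *\<^sub>R z) * \<phi> (x + t *\<^sub>R z + t *\<^sub>R w))"
        by (rule lborel_integral_translate[symmetric]) measurable
      finally show ?thesis by (simp add: w_def mult.commute)
    qed
    have i1: "integrable lborel (\<lambda>x. v (x + z) * \<phi> x)" "integrable lborel (\<lambda>x. v x * \<phi> x)"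
      "integrable lborel (\<lambda>x. v x * \<phi> (x + w))"
      by (intro square_integrable_mult vz \<phi>2 \<phi>w sob_square[OF s]; measurable)+
    have i2: "integrable lborel (\<lambda>x. \<phi> x * I x)"
      unfolding I_def by (rule segment_average_Fubini(1)) (use \<phi>2 h2 in auto)
    have "(LINT x|lborel. f x * \<phi> x) = (LINT x|lborel. v (x + z) * \<phi> x - v x * \<phi> x - \<phi> x * I x)"
      by (rule Bochner_Integration.integral_cong) (use off in \<open>auto simp: f_def indicator_def algebra_simps\<close>)
    also have "\<dots> = (LINT x|lborel. v (x + z) * \<phi> x) - (LINT x|lborel. v x * \<phi> x) - (LINT x|lborel. \<phi> x * I x)"
      using i1 i2 by simp
    also have "(LINT x|lborel. v (x + z) * \<phi> x) = (LINT x|lborel. v (x + z) * \<phi> (x + z + w))"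
      by (simp add: w_def)
    also have "\<dots> = (LINT x|lborel. v x * \<phi> (x + w))"
      by (rule lborel_integral_translate) measurable
    also have "(LINT x|lborel. v x * \<phi> (x + w)) - (LINT x|lborel. v x * \<phi> x) = (LINT x|lborel. v x * (\<phi> (x + w) - \<phi> x))"
      using i1 by (simp add: right_diff_distrib)
    also have "\<dots> = (LINT t|lborel. indicator {0..1} t * (LINT x|lborel. v x * dir_deriv w \<phi> (x + t *\<^sub>R w)))"
      unfolding ftc
      by (rule segment_average_Fubini(3)) (use sob_square[OF s] test_function_square_integrable(2)[OF \<phi>] in auto)
    also have "\<dots> = (LINT t|lborel. indicator {0..1} t * (LINT x|lborel. \<phi> x * h (x + t *\<^sub>R z)))"
      by (rule Bochner_Integration.integral_cong) (use key in \<open>auto simp: indicator_def\<close>)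
    also have "\<dots> = (LINT x|lborel. \<phi> x * I x)"
      unfolding I_def
      by (rule segment_average_Fubini(3)[symmetric]) (use \<phi>2 h2 in auto)
    finally show "(LINT x|lborel. f x * \<phi> x) = 0" by simp
  qed
  then show ?thesis
    by eventually_elim (auto simp: f_def I_def h_def)
qed

lemma sob_difference_integral:
  assumes s: "sob \<Omega> v g" and U: "open U" "bounded U"
    and seg: "\<And>x t. x \<in> U \<Longrightarrow> 0 \<le> t \<Longrightarrow> t \<le> 1 \<Longrightarrow> x + t *\<^sub>R z \<in> \<Omega>"
    and f[measurable]: "f \<in> borel_measurable borel" and f2: "integrable lborel (\<lambda>x. (f x)\<^sup>2)"
    and off: "\<And>x. x \<notin> U \<Longrightarrow> f x = 0"
  shows "(LINT x|lborel. f x * (v (x + z) - v x)) =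
         (LINT t|lborel. indicator {0..1} t * (LINT x|lborel. f x * (g (x + t *\<^sub>R z) \<bullet> z)))"
    and "integrable lborel (\<lambda>t. indicator {0..1} t * (LINT x|lborel. f x * (g (x + t *\<^sub>R z) \<bullet> z)))"
proof -
  note [measurable] = sob_measurable[OF s]
  let ?I = "\<lambda>x. LINT t|lborel. indicator {0..1} t * (g (x + t *\<^sub>R z) \<bullet> z)"
  note F = segment_average_Fubini[OF f, of "\<lambda>x. g x \<bullet> z", OF _ f2 sob_gradient_component(1)[OF s]]
  have "(LINT x|lborel. f x * (v (x + z) - v x)) = (LINT x|lborel. f x * ?I x)"
  proof (rule integral_cong_AE)
    have "AE x in lborel. x \<in> U \<longrightarrow> v (x + z) - v x = ?I x"
      by (rule sob_difference_AE[OF s U]) (rule seg)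
    then show "AE x in lborel. f x * (v (x + z) - v x) = f x * ?I x"
      by eventually_elim (use off in fastforce)
  qed measurable
  also have "\<dots> = (LINT t|lborel. indicator {0..1} t * (LINT x|lborel. f x * (g (x + t *\<^sub>R z) \<bullet> z)))"
    by (rule F(3)) measurable
  finally show "(LINT x|lborel. f x * (v (x + z) - v x)) =
         (LINT t|lborel. indicator {0..1} t * (LINT x|lborel. f x * (g (x + t *\<^sub>R z) \<bullet> z)))" .
  show "integrable lborel (\<lambda>t. indicator {0..1} t * (LINT x|lborel. f x * (g (x + t *\<^sub>R z) \<bullet> z)))"
    by (rule F(2)) measurable
qed

lemma sob_difference_square:
  assumes s: "sob \<Omega> v g"
  shows "integrable lborel (\<lambda>x. (v (x + z) - v x)\<^sup>2)"
proof -
  note [measurable] = sob_measurable[OF s]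
  have "integrable lborel (\<lambda>x. (norm (v (x + z) + - v x))\<^sup>2)"
    using lborel_integrable_translate[OF sob_square(1)[OF s]] sob_square(1)[OF s]
    by (intro square_integrable_add) auto
  then show ?thesis by simp
qed

text \<open>The difference is paired with itself. With a b <= (a^2 + b^2) / 2 inside the segment
  integral this gives A <= (A + B) / 2, and since A is a finite number, A <= B.\<close>

lemma sob_difference_estimate:
  assumes s: "sob \<Omega> v g" and U: "open U" "bounded U"
    and seg: "\<And>x t. x \<in> U \<Longrightarrow> 0 \<le> t \<Longrightarrow> t \<le> 1 \<Longrightarrow> x + t *\<^sub>R z \<in> \<Omega>"
  shows "(LINT x|lborel. indicator U x * (v (x + z) - v x)\<^sup>2) \<le> (norm z)\<^sup>2 * (LINT x|lborel. (norm (g x))\<^sup>2)"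
    (is "?A \<le> ?B")
proof -
  note [measurable] = sob_measurable[OF s]
  have [measurable]: "U \<in> sets borel" using U by simp
  define f where "f x = indicator U x * (v (x + z) - v x)" for x
  have [measurable]: "f \<in> borel_measurable borel" unfolding f_def by measurable
  have f2: "(f x)\<^sup>2 = indicator U x * (v (x + z) - v x)\<^sup>2" for x
    by (auto simp: f_def indicator_def)
  have f2i: "integrable lborel (\<lambda>x. (f x)\<^sup>2)"
    unfolding f2 using integrable_mult_indicator[OF _ sob_difference_square[OF s, of z], of U] by simp
  have gz: "integrable lborel (\<lambda>x. (g (x + y) \<bullet> z)\<^sup>2)" for y
    using lborel_integrable_translate[OF sob_gradient_component(1)[OF s]] by simp
  have "?A = (LINT x|lborel. f x * (v (x + z) - v x))"
    by (rule Bochner_Integration.integral_cong) (auto simp: f_def indicator_def power2_eq_square)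
  also have "\<dots> = (LINT t|lborel. indicator {0..1} t * (LINT x|lborel. f x * (g (x + t *\<^sub>R z) \<bullet> z)))"
    by (rule sob_difference_integral[OF s U seg]) (use f2i in \<open>auto simp: f_def\<close>)
  also have "\<dots> \<le> (LINT t|lborel. indicator {0..1::real} t * ((?A + ?B) / 2))"
  proof (rule integral_mono)
    show "integrable lborel (\<lambda>t. indicator {0..1} t * (LINT x|lborel. f x * (g (x + t *\<^sub>R z) \<bullet> z)))"
      by (rule sob_difference_integral[OF s U seg]) (use f2i in \<open>auto simp: f_def\<close>)
    fix t :: real
    have "(LINT x|lborel. f x * (g (x + t *\<^sub>R z) \<bullet> z)) \<le> (LINT x|lborel. ((f x)\<^sup>2 + (g (x + t *\<^sub>R z) \<bullet> z)\<^sup>2) / 2)"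
    proof (rule integral_mono)
      show "integrable lborel (\<lambda>x. f x * (g (x + t *\<^sub>R z) \<bullet> z))"
        by (intro square_integrable_mult f2i gz) measurable
      show "f x * (g (x + t *\<^sub>R z) \<bullet> z) \<le> ((f x)\<^sup>2 + (g (x + t *\<^sub>R z) \<bullet> z)\<^sup>2) / 2" for x
        by (rule order_trans[OF abs_ge_self abs_mult_le_squares])
    qed (use f2i gz in auto)
    also have "\<dots> = ((LINT x|lborel. (f x)\<^sup>2) + (LINT x|lborel. (g (x + t *\<^sub>R z) \<bullet> z)\<^sup>2)) / 2"
      using f2i gz by simp
    also have "(LINT x|lborel. (g (x + t *\<^sub>R z) \<bullet> z)\<^sup>2) = (LINT x|lborel. (g x \<bullet> z)\<^sup>2)"
      by (rule lborel_integral_translate[of "\<lambda>x. (g x \<bullet> z)\<^sup>2"]) measurable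
    also have "((LINT x|lborel. (f x)\<^sup>2) + (LINT x|lborel. (g x \<bullet> z)\<^sup>2)) / 2 \<le> (?A + ?B) / 2"
      using sob_gradient_component(2)[OF s, of z] by (simp add: f2)
    finally show "indicator {0..1} t * (LINT x|lborel. f x * (g (x + t *\<^sub>R z) \<bullet> z)) \<le> indicator {0..1} t * ((?A + ?B) / 2)"
      by (auto simp: indicator_def)
  qed auto
  also have "\<dots> = (?A + ?B) / 2" by simp
  finally show ?thesis by simp
qed

section \<open>The weak derivative of a square\<close>

lemma compact_support_bounded:
  fixes f :: "'a::real_normed_vector \<Rightarrow> real"
  assumes "continuous_on UNIV f" "compact K" "\<And>x. x \<notin> K \<Longrightarrow> f x = 0"
  obtains M where "M \<ge> 0" "\<And>x. \<bar>f x\<bar> \<le> M"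
proof -
  have "bounded (f ` K)"
    by (intro compact_imp_bounded compact_continuous_image continuous_on_subset[OF assms(1)] assms(2)) simp
  then obtain M where "M > 0" "\<forall>x\<in>K. \<bar>f x\<bar> \<le> M" by (auto simp: bounded_pos)
  then show ?thesis using assms(3) by (intro that[of M]) (use assms(3) in \<open>fastforce+\<close>)
qed

text \<open>The weak derivative of v^2 in direction e is 2 v (g \<bullet> e), against C1 functions
  of compact support. The difference quotient A r of \<psi> is shifted onto v^2, whose difference,
  with \<delta> the increment of v, is 2 v \<delta> + \<delta>^2. The square is of order r^2 by the
  difference estimate; the linear term is expressed through g along segments. Both errors are O(r)
  after division by r.\<close>

lemma sob_square_derivative:
  assumes s: "sob \<Omega> v g" and "open \<Omega>"
    and d\<psi>: "\<And>x. (\<psi> has_derivative \<psi>' x) (at x)" and cont: "continuous_on UNIV (\<lambda>x. \<psi>' x e)"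
    and K: "compact K" "K \<subseteq> \<Omega>" and off: "\<And>x. x \<notin> K \<Longrightarrow> \<psi> x = 0"
  shows "(LINT x|lborel. (v x)\<^sup>2 * \<psi>' x e) = - 2 * (LINT x|lborel. v x * (g x \<bullet> e) * \<psi> x)"
proof -
  note [measurable] = sob_measurable[OF s]
  note v2 = sob_square(1)[OF s]
  define G V where "G = (LINT x|lborel. (norm (g x))\<^sup>2)" and "V = (LINT x|lborel. (v x)\<^sup>2)"
  have G0: "G \<ge> 0" and V0: "V \<ge> 0" by (auto simp: G_def V_def)
  have c\<psi>: "continuous_on UNIV \<psi>"
    using d\<psi> has_derivative_continuous by (metis continuous_at_imp_continuous_on)
  have [measurable]: "\<psi> \<in> borel_measurable borel" "(\<lambda>x. \<psi>' x e) \<in> borel_measurable borel"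
    using c\<psi> cont by (auto intro: borel_measurable_continuous_onI)
  have off': "\<psi>' x e = 0" if "x \<notin> K" for x
    using has_derivative_zero_off_support[OF d\<psi> compact_imp_closed[OF K(1)] off that] by metis
  obtain M0 where M0: "M0 \<ge> 0" "\<And>x. \<bar>\<psi> x\<bar> \<le> M0"
    using compact_support_bounded[OF c\<psi> K(1) off] by blast
  obtain M1 where M1: "M1 \<ge> 0" "\<And>x. \<bar>\<psi>' x e\<bar> \<le> M1"
    using compact_support_bounded[OF cont K(1) off'] by blast
  have d1: "((\<lambda>t. \<psi> (x + t *\<^sub>R e)) has_real_derivative \<psi>' (x + t *\<^sub>R e) e) (at t)" for x t
    by (rule has_real_derivative_along_line[OF d\<psi>])
  have lip: "\<bar>\<psi> (x + r *\<^sub>R e) - \<psi> x\<bar> \<le> M1 * \<bar>r\<bar>" for x r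
    by (rule Lipschitz_along_line[where f' = \<psi>', OF d\<psi> M1(2)])
  obtain \<eta> where \<eta>: "\<eta> > 0" "(\<Union>x\<in>K. ball x \<eta>) \<subseteq> \<Omega>"
    using compact_subset_open_imp_ball_epsilon_subset[OF K(1) \<open>open \<Omega>\<close> K(2)] by blast
  \<comment> \<open>Half of the margin \<eta> is kept in reserve, so that a segment of length below
    \<eta> / 2 that starts in U stays in \<Omega>.\<close>
  define U where "U = (\<Union>x\<in>K. ball x (\<eta> / 2))"
  have U: "open U" "K \<subseteq> U"
    using \<eta>(1) by (auto simp: U_def intro!: bexI[where x = "_"])
  have bU: "bounded U"
  proof -
    obtain B where B: "\<forall>x\<in>K. norm x \<le> B" using compact_imp_bounded[OF K(1)] by (auto simp: bounded_iff)
    have "norm y \<le> B + \<eta>" if "y \<in> U" for y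
    proof -
      have "\<exists>x\<in>K. dist x y < \<eta> / 2" using that by (simp add: U_def)
      then obtain x where x: "x \<in> K" "dist x y < \<eta> / 2" ..
      have "norm y \<le> norm x + dist x y" by (metis add.commute dist_commute dist_norm norm_triangle_sub)
      then show ?thesis using x B \<eta>(1) by fastforce
    qed
    then show ?thesis by (auto simp: bounded_iff)
  qed
  have [measurable]: "U \<in> sets borel" using U by simp
  \<comment> \<open>Admissible step sizes: |r| <= \<sigma> gives |r e| < \<eta> / 2. The summand 1
    covers e = 0.\<close>
  define \<sigma> where "\<sigma> = \<eta> / (2 * (norm e + 1))"
  have \<sigma>: "\<sigma> > 0" using \<eta>(1) by (simp add: \<sigma>_def add_nonneg_pos)
  have small: "norm (r *\<^sub>R e) < \<eta> / 2" if "\<bar>r\<bar> \<le> \<sigma>" for r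
  proof -
    have "\<bar>r\<bar> * norm e \<le> \<sigma> * norm e" by (intro mult_right_mono that) auto
    also have "\<dots> < \<sigma> * (norm e + 1)" using \<sigma> by simp
    also have "\<dots> = \<eta> / 2"
    proof -
      have "norm e + 1 > 0" by (simp add: add_nonneg_pos)
      then show ?thesis unfolding \<sigma>_def by (simp add: divide_simps)
    qed
    finally show ?thesis by simp
  qed
  have seg: "x + t *\<^sub>R (r *\<^sub>R e) \<in> \<Omega>" if "x \<in> U" "\<bar>r\<bar> \<le> \<sigma>" "0 \<le> t" "t \<le> 1" for x r t
  proof -
    have "\<exists>y\<in>K. dist y x < \<eta> / 2" using \<open>x \<in> U\<close> by (simp add: U_def)
    then obtain y where y: "y \<in> K" "dist y x < \<eta> / 2" ..
    have "norm (t *\<^sub>R (r *\<^sub>R e)) \<le> norm (r *\<^sub>R e)" using that by (auto simp: abs_mult intro!: mult_right_mono mult_left_le_one_le)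
    then have "norm (t *\<^sub>R (r *\<^sub>R e)) < \<eta> / 2" using small[OF that(2)] by simp
    moreover have "dist y (x + t *\<^sub>R (r *\<^sub>R e)) \<le> dist y x + norm (t *\<^sub>R (r *\<^sub>R e))"
      by (metis add_diff_cancel_left' dist_norm dist_triangle norm_minus_commute)
    ultimately have "x + t *\<^sub>R (r *\<^sub>R e) \<in> ball y \<eta>" using y by simp
    then show ?thesis using \<eta> y by blast
  qed
  have est: "(LINT x|lborel. indicator U x * (v (x + r *\<^sub>R e) - v x)\<^sup>2) \<le> r\<^sup>2 * (norm e)\<^sup>2 * G" if "\<bar>r\<bar> \<le> \<sigma>" for r
  proof -
    have "(LINT x|lborel. indicator U x * (v (x + r *\<^sub>R e) - v x)\<^sup>2) \<le> (norm (r *\<^sub>R e))\<^sup>2 * G"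
      unfolding G_def by (rule sob_difference_estimate[OF s U(1) bU]) (rule seg[OF _ that])
    then show ?thesis by (simp add: power_mult_distrib)
  qed
  have est_int: "integrable lborel (\<lambda>x. indicator U x * (v (x + z) - v x)\<^sup>2)" for z
    using integrable_mult_indicator[OF _ sob_difference_square[OF s, of z], of U] by simp
  define w where "w x = v x * \<psi> x" for x
  have [measurable]: "w \<in> borel_measurable borel" unfolding w_def by measurable
  have w2: "integrable lborel (\<lambda>x. (w x)\<^sup>2)"
  proof (rule Bochner_Integration.integrable_bound)
    show "integrable lborel (\<lambda>x. M0\<^sup>2 * (v x)\<^sup>2)" using v2 by simp
    have "(w x)\<^sup>2 \<le> M0\<^sup>2 * (v x)\<^sup>2" for x
      unfolding w_def power_mult_distrib
      using M0(2)[of x] by (subst mult.commute) (intro mult_right_mono, auto simp: abs_le_square_iff[symmetric] M0(1))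
    then show "AE x in lborel. norm ((w x)\<^sup>2) \<le> norm (M0\<^sup>2 * (v x)\<^sup>2)" by simp
  qed measurable
  \<comment> \<open>C r^2 bounds the squared L2 norm of w(x + r e) - w(x); its two parts are the
    differences of v and of \<psi> in the product rule.\<close>
  define C where "C = 2 * M0\<^sup>2 * (norm e)\<^sup>2 * G + 2 * M1\<^sup>2 * V"
  have C0: "C \<ge> 0" using G0 V0 by (simp add: C_def)
  have ge2: "integrable lborel (\<lambda>x. (g x \<bullet> e)\<^sup>2)" by (rule sob_gradient_component[OF s])
  define H where "H = (LINT x|lborel. (g x \<bullet> e)\<^sup>2)"
  have wt2: "integrable lborel (\<lambda>x. (w (x + y))\<^sup>2)" for y
    using lborel_integrable_translate[OF w2] by simp
  have wd2: "integrable lborel (\<lambda>x. (w (x + y) - w x)\<^sup>2)" for y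
  proof -
    have "integrable lborel (\<lambda>x. (norm (w (x + y) + - w x))\<^sup>2)"
      using wt2 w2 by (intro square_integrable_add) auto
    then show ?thesis by simp
  qed
  have wC: "(LINT x|lborel. (w (x + r *\<^sub>R e) - w x)\<^sup>2) \<le> C * r\<^sup>2" if r: "\<bar>r\<bar> \<le> \<sigma>" for r
  proof -
    \<comment> \<open>In the product rule \<psi> is taken at the shifted point in the first term.
      That point must lie in K to contribute, which forces x into U, where the difference of v is
      controlled.\<close>
    have pt: "(w (x + r *\<^sub>R e) - w x)\<^sup>2 \<le>
        2 * M0\<^sup>2 * (indicator U x * (v (x + r *\<^sub>R e) - v x)\<^sup>2) + 2 * (M1\<^sup>2 * r\<^sup>2) * (v x)\<^sup>2" for x
    proof -
      let ?a = "(v (x + r *\<^sub>R e) - v x) * \<psi> (x + r *\<^sub>R e)" and ?b = "v x * (\<psi> (x + r *\<^sub>R e) - \<psi> x)"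
      have "w (x + r *\<^sub>R e) - w x = ?a + ?b" by (simp add: w_def algebra_simps)
      then have "(w (x + r *\<^sub>R e) - w x)\<^sup>2 \<le> 2 * ?a\<^sup>2 + 2 * ?b\<^sup>2"
        using sum_squares_bound[of ?a ?b] by (simp add: power2_sum)
      also have "?a\<^sup>2 \<le> M0\<^sup>2 * (indicator U x * (v (x + r *\<^sub>R e) - v x)\<^sup>2)"
      proof (cases "x + r *\<^sub>R e \<in> K")
        case True
        then have "x \<in> U" unfolding U_def
          using small[OF r] by (intro UN_I[OF True]) (simp add: dist_norm)
        moreover have "(\<psi> (x + r *\<^sub>R e))\<^sup>2 \<le> M0\<^sup>2"
          using M0 by (metis abs_le_square_iff abs_of_nonneg)
        ultimately show ?thesis by (simp add: power_mult_distrib mult.commute mult_right_mono)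
      qed (simp add: off)
      also have "?b\<^sup>2 \<le> (M1\<^sup>2 * r\<^sup>2) * (v x)\<^sup>2"
      proof -
        have "(\<psi> (x + r *\<^sub>R e) - \<psi> x)\<^sup>2 \<le> (M1 * \<bar>r\<bar>)\<^sup>2"
          using lip[of x r] M1(1) by (metis abs_le_square_iff abs_mult abs_abs abs_of_nonneg)
        from mult_left_mono[OF this, of "(v x)\<^sup>2"] show ?thesis
          by (simp add: power_mult_distrib mult.commute)
      qed
      finally show ?thesis by simp
    qed
    have "(LINT x|lborel. (w (x + r *\<^sub>R e) - w x)\<^sup>2) \<le>
      (LINT x|lborel. 2 * M0\<^sup>2 * (indicator U x * (v (x + r *\<^sub>R e) - v x)\<^sup>2) + 2 * (M1\<^sup>2 * r\<^sup>2) * (v x)\<^sup>2)"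
      by (rule integral_mono[OF wd2 _ pt]) (use est_int v2 in auto)
    also have "\<dots> = 2 * M0\<^sup>2 * (LINT x|lborel. indicator U x * (v (x + r *\<^sub>R e) - v x)\<^sup>2) + 2 * (M1\<^sup>2 * r\<^sup>2) * V"
      using est_int v2 by (simp add: V_def)
    also have "\<dots> \<le> 2 * M0\<^sup>2 * (r\<^sup>2 * (norm e)\<^sup>2 * G) + 2 * (M1\<^sup>2 * r\<^sup>2) * V"
      by (intro add_right_mono mult_left_mono est[OF r]) auto
    also have "\<dots> = C * r\<^sup>2" by (simp add: C_def algebra_simps)
    finally show ?thesis .
  qed
  define P where "P r = (LINT x|lborel. w (x + r *\<^sub>R e) * (g x \<bullet> e))" for r
  have Pint: "integrable lborel (\<lambda>x. w (x + y) * (g x \<bullet> e))" for y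
    by (intro square_integrable_mult wt2 ge2) measurable
  have PC: "\<bar>P r - P 0\<bar> \<le> sqrt (C * H) * \<bar>r\<bar>" if r: "\<bar>r\<bar> \<le> \<sigma>" for r
  proof -
    have "P r - P 0 = (LINT x|lborel. (w (x + r *\<^sub>R e) - w x) * (g x \<bullet> e))"
      using Pint[of "r *\<^sub>R e"] Pint[of 0] by (simp add: P_def left_diff_distrib)
    then have "(P r - P 0)\<^sup>2 \<le> (LINT x|lborel. (w (x + r *\<^sub>R e) - w x)\<^sup>2) * H"
      unfolding H_def using Cauchy_Schwarz_integral[OF _ _ wd2 ge2] by simp
    also have "\<dots> \<le> (C * r\<^sup>2) * H"
      by (intro mult_right_mono wC[OF r]) (simp add: H_def)
    finally have "\<bar>P r - P 0\<bar> \<le> sqrt ((C * r\<^sup>2) * H)"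
      by (metis real_sqrt_abs real_sqrt_le_mono)
    also have "\<dots> = sqrt (C * H) * \<bar>r\<bar>" by (simp add: real_sqrt_mult)
    finally show ?thesis .
  qed
  define A where "A r = (LINT x|lborel. (v x)\<^sup>2 * ((\<psi> (x + r *\<^sub>R e) - \<psi> x) / r))" for r
  \<comment> \<open>The first summand comes from \<delta>^2 \<psi>, the second from twice the
    Lipschitz bound for P at 0.\<close>
  define D where "D = M0 * (norm e)\<^sup>2 * G + 2 * sqrt (C * H)"
  have bound: "\<bar>A r + 2 * P 0\<bar> \<le> D * r" if r: "0 < r" "r \<le> \<sigma>" for r
  proof -
    let ?\<delta> = "\<lambda>x. v (x + (- r) *\<^sub>R e) - v x"
    have r': "\<bar>- r\<bar> \<le> \<sigma>" using r by simp
    have \<delta>2: "integrable lborel (\<lambda>x. (?\<delta> x)\<^sup>2)" by (rule sob_difference_square[OF s])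
    have i1: "integrable lborel (\<lambda>x. w x * ?\<delta> x)"
      by (intro square_integrable_mult w2 \<delta>2) measurable
    have bd: "integrable lborel (\<lambda>x. f x * h x)" if "integrable lborel f" "\<And>x. \<bar>h x\<bar> \<le> M0" "h \<in> borel_measurable borel" for f h :: "real^2 \<Rightarrow> real"
    proof (rule Bochner_Integration.integrable_bound)
      show "integrable lborel (\<lambda>x. M0 * \<bar>f x\<bar>)" using that by auto
      show "AE x in lborel. norm (f x * h x) \<le> norm (M0 * \<bar>f x\<bar>)"
        using that M0(1) by (intro AE_I2) (simp add: abs_mult mult.commute[of M0] mult_left_mono)
    qed (use that in measurable)
    have i2: "integrable lborel (\<lambda>x. (?\<delta> x)\<^sup>2 * \<psi> x)"
      using \<delta>2 M0 by (intro bd) auto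
    have i3: "integrable lborel (\<lambda>x. (v x)\<^sup>2 * \<psi> x)" "integrable lborel (\<lambda>x. (v x)\<^sup>2 * \<psi> (x + r *\<^sub>R e))"
      using v2 M0 by (auto intro!: bd)
    have i4: "integrable lborel (\<lambda>x. (v (x + (- r) *\<^sub>R e))\<^sup>2 * \<psi> x)"
      using lborel_integrable_translate[OF v2, of "(- r) *\<^sub>R e"] M0 by (intro bd) auto
    have "r * A r = (LINT x|lborel. (v x)\<^sup>2 * \<psi> (x + r *\<^sub>R e)) - (LINT x|lborel. (v x)\<^sup>2 * \<psi> x)"
    proof -
      have "r * A r = (LINT x|lborel. r * ((v x)\<^sup>2 * ((\<psi> (x + r *\<^sub>R e) - \<psi> x) / r)))"
        unfolding A_def by simp
      also have "\<dots> = (LINT x|lborel. (v x)\<^sup>2 * \<psi> (x + r *\<^sub>R e) - (v x)\<^sup>2 * \<psi> x)"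
        by (rule Bochner_Integration.integral_cong) (use r in \<open>auto simp: field_simps\<close>)
      finally show ?thesis using i3 by simp
    qed
    also have "(LINT x|lborel. (v x)\<^sup>2 * \<psi> (x + r *\<^sub>R e)) =
        (LINT x|lborel. (v (x + (- r) *\<^sub>R e))\<^sup>2 * \<psi> (x + (- r) *\<^sub>R e + r *\<^sub>R e))"
      by (rule lborel_integral_translate[symmetric]) measurable
    also have "\<dots> - (LINT x|lborel. (v x)\<^sup>2 * \<psi> x) = (LINT x|lborel. (v (x + (- r) *\<^sub>R e))\<^sup>2 * \<psi> x - (v x)\<^sup>2 * \<psi> x)"
      using i3 i4 by simp
    also have "\<dots> = (LINT x|lborel. 2 * (w x * ?\<delta> x) + (?\<delta> x)\<^sup>2 * \<psi> x)"
      by (rule Bochner_Integration.integral_cong) (auto simp: w_def power2_eq_square algebra_simps)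
    also have "\<dots> = 2 * (LINT x|lborel. w x * ?\<delta> x) + (LINT x|lborel. (?\<delta> x)\<^sup>2 * \<psi> x)"
      using i1 i2 by simp
    finally have rA: "r * A r = 2 * (LINT x|lborel. w x * ?\<delta> x) + (LINT x|lborel. (?\<delta> x)\<^sup>2 * \<psi> x)" .
    have "\<bar>LINT x|lborel. (?\<delta> x)\<^sup>2 * \<psi> x\<bar> \<le> (LINT x|lborel. M0 * (indicator U x * (?\<delta> x)\<^sup>2))"
    proof (rule order_trans[OF integral_abs_bound], rule integral_mono)
      show "\<bar>(?\<delta> x)\<^sup>2 * \<psi> x\<bar> \<le> M0 * (indicator U x * (?\<delta> x)\<^sup>2)" for x
      proof (cases "x \<in> U")
        case False
        then have "\<psi> x = 0" using off U(2) by blast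
        then show ?thesis using False by simp
      qed (use M0(2)[of x] in \<open>auto simp: abs_mult mult.commute mult_right_mono\<close>)
    qed (use i2 est_int[of "(- r) *\<^sub>R e"] in auto)
    also have "\<dots> \<le> M0 * (r\<^sup>2 * (norm e)\<^sup>2 * G)"
      using est[OF r'] M0(1) by (simp add: mult_left_mono)
    finally have err: "\<bar>LINT x|lborel. (?\<delta> x)\<^sup>2 * \<psi> x\<bar> \<le> M0 * (r\<^sup>2 * (norm e)\<^sup>2 * G)" .
    have off_w: "w x = 0" if "x \<notin> U" for x using off that U(2) by (auto simp: w_def)
    let ?J = "\<lambda>t. LINT x|lborel. w x * (g (x + t *\<^sub>R ((- r) *\<^sub>R e)) \<bullet> ((- r) *\<^sub>R e))"
    \<comment> \<open>The shift is moved from g to w = v \<psi>. Translates of w converge with a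
      rate by the bound C, whereas for g only square integrability is available.\<close>
    have J: "?J t = - r * P (t * r)" for t
    proof -
      have "?J t = (LINT x|lborel. w (x + t *\<^sub>R (- r) *\<^sub>R e + (t * r) *\<^sub>R e) * (g (x + t *\<^sub>R (- r) *\<^sub>R e) \<bullet> ((- r) *\<^sub>R e)))"
        by simp
      also have "\<dots> = (LINT x|lborel. w (x + (t * r) *\<^sub>R e) * (g x \<bullet> ((- r) *\<^sub>R e)))"
        by (rule lborel_integral_translate) measurable
      also have "\<dots> = - r * P (t * r)"
        unfolding P_def by (simp add: mult.left_commute)
      finally show ?thesis .
    qed
    have w\<delta>: "(LINT x|lborel. w x * ?\<delta> x) = (LINT t|lborel. indicator {0..1} t * ?J t)"
      and Ji: "integrable lborel (\<lambda>t. indicator {0..1} t * ?J t)"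
      by (rule sob_difference_integral[OF s U(1) bU]; use seg[OF _ r'] w2 off_w in simp)+
    have Ji': "integrable lborel (\<lambda>t. indicator {0..1} t * P (t * r))"
      using Bochner_Integration.integrable_mult_right[OF Ji, of "- (1 / r)"] r unfolding J by (simp add: mult_ac)
    have "(LINT x|lborel. w x * ?\<delta> x) = - r * (LINT t|lborel. indicator {0..1} t * P (t * r))"
      unfolding w\<delta> J by (simp add: mult.left_commute)
    also have "(LINT t|lborel. indicator {0..1} t * P (t * r)) = P 0 + (LINT t|lborel. indicator {0..1} t * (P (t * r) - P 0))"
      using Ji' by (simp add: right_diff_distrib)
    finally have w\<delta>': "(LINT x|lborel. w x * ?\<delta> x) = - r * (P 0 + (LINT t|lborel. indicator {0..1} t * (P (t * r) - P 0)))" .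
    have "\<bar>LINT t|lborel. indicator {0..1} t * (P (t * r) - P 0)\<bar> \<le> (LINT t|lborel. indicator {0..1::real} t * (sqrt (C * H) * r))"
    proof (rule order_trans[OF integral_abs_bound], rule integral_mono)
      show "\<bar>indicator {0..1} t * (P (t * r) - P 0)\<bar> \<le> indicator {0..1} t * (sqrt (C * H) * r)" for t
      proof (cases "t \<in> {0..1}")
        case True
        then have tr: "0 \<le> t * r" "t * r \<le> r" using r by (auto simp: mult_left_le_one_le)
        have "\<bar>P (t * r) - P 0\<bar> \<le> sqrt (C * H) * \<bar>t * r\<bar>" using tr r by (intro PC) linarith
        also have "\<dots> \<le> sqrt (C * H) * r" using tr C0 by (intro mult_left_mono) (auto simp: H_def)
        finally show ?thesis using True by simp
      qed simp
    qed (use Ji' in \<open>auto simp: right_diff_distrib\<close>)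
    then have err2: "\<bar>LINT t|lborel. indicator {0..1} t * (P (t * r) - P 0)\<bar> \<le> sqrt (C * H) * r" by simp
    define E1 E2 where "E1 = (LINT x|lborel. (?\<delta> x)\<^sup>2 * \<psi> x)"
      and "E2 = (LINT t|lborel. indicator {0..1} t * (P (t * r) - P 0))"
    have "r * (A r + 2 * P 0) = E1 - 2 * (r * E2)"
      using rA unfolding w\<delta>' E1_def[symmetric] E2_def[symmetric] by (simp add: algebra_simps)
    then have "\<bar>r * (A r + 2 * P 0)\<bar> \<le> \<bar>E1\<bar> + 2 * \<bar>r * E2\<bar>" by simp
    also have "\<dots> \<le> M0 * (r\<^sup>2 * (norm e)\<^sup>2 * G) + 2 * (r * (sqrt (C * H) * r))"
      using err err2 r by (auto intro!: add_mono mult_left_mono simp: E1_def E2_def abs_mult)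
    also have "\<dots> = r * (D * r)" by (simp add: D_def algebra_simps power2_eq_square)
    finally show ?thesis using r by (simp add: abs_mult)
  qed
  define \<tau> where "\<tau> n = \<sigma> * inverse (real (Suc n))" for n
  have \<tau>: "0 < \<tau> n" "\<tau> n \<le> \<sigma>" for n
    using \<sigma> by (auto simp: \<tau>_def field_simps)
  have \<tau>0: "\<tau> \<longlonglongrightarrow> 0"
    using tendsto_mult[OF tendsto_const LIMSEQ_inverse_real_of_nat, of \<sigma>] by (simp add: \<tau>_def[abs_def])
  have "(\<lambda>n. A (\<tau> n)) \<longlonglongrightarrow> (LINT x|lborel. (v x)\<^sup>2 * \<psi>' x e)"
    unfolding A_def
  proof (rule integral_dominated_convergence[where w = "\<lambda>x. M1 * (v x)\<^sup>2"])
    show "AE x in lborel. (\<lambda>n. (v x)\<^sup>2 * ((\<psi> (x + \<tau> n *\<^sub>R e) - \<psi> x) / \<tau> n)) \<longlonglongrightarrow> (v x)\<^sup>2 * \<psi>' x e"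
    proof (intro AE_I2 tendsto_mult tendsto_const)
      fix x
      have "((\<lambda>h. (\<psi> (x + h *\<^sub>R e) - \<psi> x) / h) \<longlongrightarrow> \<psi>' x e) (at 0)"
        using d1[of x 0] by (simp add: DERIV_def)
      then show "(\<lambda>n. (\<psi> (x + \<tau> n *\<^sub>R e) - \<psi> x) / \<tau> n) \<longlonglongrightarrow> \<psi>' x e"
        by (rule filterlim_compose) (use \<tau>0 \<tau>(1) in \<open>auto simp: filterlim_at intro!: always_eventually less_imp_neq[THEN not_sym]\<close>)
    qed
    show "AE x in lborel. norm ((v x)\<^sup>2 * ((\<psi> (x + \<tau> n *\<^sub>R e) - \<psi> x) / \<tau> n)) \<le> M1 * (v x)\<^sup>2" for n
    proof (intro AE_I2)
      fix x
      have "\<bar>(\<psi> (x + \<tau> n *\<^sub>R e) - \<psi> x) / \<tau> n\<bar> \<le> M1"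
        using lip[of x "\<tau> n"] \<tau>(1)[of n] by (simp add: divide_le_eq)
      then show "norm ((v x)\<^sup>2 * ((\<psi> (x + \<tau> n *\<^sub>R e) - \<psi> x) / \<tau> n)) \<le> M1 * (v x)\<^sup>2"
        using mult_right_mono[of "\<bar>(\<psi> (x + \<tau> n *\<^sub>R e) - \<psi> x) / \<tau> n\<bar>" M1 "(v x)\<^sup>2"]
        by (simp add: abs_mult mult.commute)
    qed
  qed (use v2 in auto)
  moreover have "(\<lambda>n. A (\<tau> n)) \<longlonglongrightarrow> - 2 * P 0"
  proof -
    have "(\<lambda>n. D * \<tau> n) \<longlonglongrightarrow> 0" using tendsto_mult_right_zero[OF \<tau>0] by simp
    then have "(\<lambda>n. A (\<tau> n) + 2 * P 0) \<longlonglongrightarrow> 0"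
      by (rule Lim_null_comparison[rotated]) (use bound[OF \<tau>] in auto)
    then have "(\<lambda>n. A (\<tau> n) + 2 * P 0 - 2 * P 0) \<longlonglongrightarrow> 0 - 2 * P 0" by (intro tendsto_diff tendsto_const)
    then show ?thesis by simp
  qed
  ultimately have "(LINT x|lborel. (v x)\<^sup>2 * \<psi>' x e) = - 2 * P 0"
    using LIMSEQ_unique by blast
  also have "P 0 = (LINT x|lborel. v x * (g x \<bullet> e) * \<psi> x)"
    by (simp add: P_def w_def mult_ac)
  finally show ?thesis .
qed

lemma bounded_measurable_square_integrable:
  fixes v b :: "'a \<Rightarrow> real"
  assumes "integrable M (\<lambda>x. (v x)\<^sup>2)" "b \<in> borel_measurable M" "\<And>x. \<bar>b x\<bar> \<le> B"
  shows "integrable M (\<lambda>x. (v x)\<^sup>2 * b x)"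
proof (rule Bochner_Integration.integrable_bound)
  show "integrable M (\<lambda>x. B * (v x)\<^sup>2)" using assms(1) by simp
  show "AE x in M. norm ((v x)\<^sup>2 * b x) \<le> norm (B * (v x)\<^sup>2)"
  proof (rule AE_I2)
    fix x
    have "(v x)\<^sup>2 * \<bar>b x\<bar> \<le> (v x)\<^sup>2 * B" using assms(3) by (intro mult_left_mono) auto
    also have "\<dots> \<le> \<bar>B * (v x)\<^sup>2\<bar>" by (simp add: mult.commute)
    finally show "norm ((v x)\<^sup>2 * b x) \<le> norm (B * (v x)\<^sup>2)" by (simp add: abs_mult)
  qed
qed (use assms borel_measurable_integrable in measurable)

lemma sob_square_divergence:
  fixes \<Phi> :: "real^2 \<Rightarrow> real^2"
  assumes s: "sob \<Omega> v g" and "open \<Omega>"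
    and d\<Phi>: "\<And>x. (\<Phi> has_derivative \<Phi>' x) (at x)" and cont: "\<And>h. continuous_on UNIV (\<lambda>x. \<Phi>' x h)"
    and K: "compact K" "K \<subseteq> \<Omega>" and off: "\<And>x. x \<notin> K \<Longrightarrow> \<Phi> x = 0"
  shows "integrable lborel (\<lambda>x. (v x)\<^sup>2 * (\<Sum>i\<in>UNIV. \<Phi>' x (axis i 1) $ i))"
    and "integrable lborel (\<lambda>x. v x * (g x \<bullet> \<Phi> x))"
    and "(LINT x|lborel. (v x)\<^sup>2 * (\<Sum>i\<in>UNIV. \<Phi>' x (axis i 1) $ i)) = - 2 * (LINT x|lborel. v x * (g x \<bullet> \<Phi> x))"
proof -
  note [measurable] = sob_measurable[OF s]
  have c\<Phi>: "continuous_on UNIV \<Phi>"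
    using d\<Phi> has_derivative_continuous by (metis continuous_at_imp_continuous_on)
  have di: "((\<lambda>x. \<Phi> x $ i) has_derivative (\<lambda>h. \<Phi>' x h $ i)) (at x)" for i x
    by (rule bounded_linear.has_derivative[OF bounded_linear_vec_nth d\<Phi>])
  have ci: "continuous_on UNIV (\<lambda>x. \<Phi>' x h $ i)" for h i
    by (intro continuous_on_component cont)
  have cc: "continuous_on UNIV (\<lambda>x. \<Phi> x $ i)" for i
    by (intro continuous_on_component c\<Phi>)
  have [measurable]: "(\<lambda>x. \<Phi>' x h $ i) \<in> borel_measurable borel" "(\<lambda>x. \<Phi> x $ i) \<in> borel_measurable borel" for h i
    using ci cc by (auto intro: borel_measurable_continuous_onI)
  have off': "\<Phi>' x h = 0" if "x \<notin> K" for x h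
    using has_derivative_zero_off_support[OF d\<Phi> compact_imp_closed[OF K(1)] off that] by metis
  have i1: "integrable lborel (\<lambda>x. (v x)\<^sup>2 * (\<Phi>' x (axis i 1) $ i))" for i
  proof -
    obtain M where "M \<ge> 0" "\<And>x. \<bar>\<Phi>' x (axis i 1) $ i\<bar> \<le> M"
      by (rule compact_support_bounded[OF ci K(1), of "axis i 1" i]) (use off' in auto)
    then show ?thesis using sob_square(1)[OF s] by (intro bounded_measurable_square_integrable) auto
  qed
  have i2: "integrable lborel (\<lambda>x. v x * (g x $ i) * (\<Phi> x $ i))" for i
  proof -
    obtain M where M: "M \<ge> 0" "\<And>x. \<bar>\<Phi> x $ i\<bar> \<le> M"
      by (rule compact_support_bounded[OF cc K(1), of i]) (use off in auto)
    have gi: "integrable lborel (\<lambda>x. (g x $ i)\<^sup>2)"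
      using sob_gradient_component(1)[OF s, of "axis i 1"] by (simp add: inner_axis)
    show ?thesis
    proof (rule Bochner_Integration.integrable_bound)
      show "integrable lborel (\<lambda>x. M * \<bar>v x * g x $ i\<bar>)"
        using square_integrable_mult[OF _ _ sob_square(1)[OF s] gi] by simp
      show "AE x in lborel. norm (v x * (g x $ i) * (\<Phi> x $ i)) \<le> norm (M * \<bar>v x * g x $ i\<bar>)"
        using M by (intro AE_I2) (simp add: abs_mult mult.commute[of M] mult_left_mono)
    qed measurable
  qed
  have eq: "(LINT x|lborel. (v x)\<^sup>2 * (\<Phi>' x (axis i 1) $ i)) = - 2 * (LINT x|lborel. v x * (g x $ i) * (\<Phi> x $ i))" for i
    using sob_square_derivative[OF s \<open>open \<Omega>\<close> di ci K, of i "axis i 1"] off by (simp add: inner_axis)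
  have gs: "v x * (g x \<bullet> \<Phi> x) = (\<Sum>i\<in>UNIV. v x * (g x $ i) * (\<Phi> x $ i))" for x
    by (simp add: inner_vec_def sum_distrib_left mult_ac)
  have ds: "(v x)\<^sup>2 * (\<Sum>i\<in>UNIV. \<Phi>' x (axis i 1) $ i) = (\<Sum>i\<in>UNIV. (v x)\<^sup>2 * (\<Phi>' x (axis i 1) $ i))" for x
    by (rule sum_distrib_left)
  show "integrable lborel (\<lambda>x. (v x)\<^sup>2 * (\<Sum>i\<in>UNIV. \<Phi>' x (axis i 1) $ i))"
    unfolding ds using i1 by simp
  show "integrable lborel (\<lambda>x. v x * (g x \<bullet> \<Phi> x))"
    unfolding gs using i2 by simp
  show "(LINT x|lborel. (v x)\<^sup>2 * (\<Sum>i\<in>UNIV. \<Phi>' x (axis i 1) $ i)) = - 2 * (LINT x|lborel. v x * (g x \<bullet> \<Phi> x))"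
    unfolding gs ds using i1 i2 by (simp add: eq sum_distrib_left sum_negf)
qed

section \<open>Cutoff functions\<close>

lemma max0_square_deriv: "((\<lambda>t::real. (max 0 t)\<^sup>2) has_real_derivative 2 * max 0 t) (at t)"
proof -
  consider "t > 0" | "t < 0" | "t = 0" by linarith
  then show ?thesis
  proof cases
    case 1
    have "((\<lambda>t::real. t\<^sup>2) has_real_derivative 2 * max 0 t) (at t)"
      using 1 by (auto intro!: derivative_eq_intros)
    then show ?thesis
      by (rule has_field_derivative_transform_within_open[where S = "{0<..}"]) (use 1 in auto)
  next
    case 2
    have "((\<lambda>t::real. 0) has_real_derivative 2 * max 0 t) (at t)"
      using 2 by (auto intro!: derivative_eq_intros)
    then show ?thesis
      by (rule has_field_derivative_transform_within_open[where S = "{..<0}"]) (use 2 in auto)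
  next
    case 3
    have "((\<lambda>h::real. max 0 h) \<longlongrightarrow> max 0 0) (at 0)" by (intro tendsto_intros)
    moreover have "(max 0 h)\<^sup>2 / h = max 0 h" for h :: real
      by (simp add: max_def power2_eq_square)
    ultimately show ?thesis using 3 by (simp add: DERIV_def)
  qed
qed

text \<open>A C1 cutoff suffices because the divergence identity only asks for C1 fields. Vanishing
  for t <= 0 makes \<open>soft_step (n * d - 1)\<close> live where d > 1/n, its nonnegative
  derivative preserves the inward sign, and it tends to 1 wherever d > 0.\<close>

definition soft_step :: "real \<Rightarrow> real" where
  "soft_step t = (max 0 t)\<^sup>2 / (1 + (max 0 t)\<^sup>2)"

definition soft_step' :: "real \<Rightarrow> real" where
  "soft_step' t = 2 * max 0 t / (1 + (max 0 t)\<^sup>2)\<^sup>2"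

lemma one_plus_square_pos: "1 + (x::real)\<^sup>2 > 0" "1 + (x::real)\<^sup>2 \<noteq> 0"
  by (simp_all add: add_pos_nonneg) (metis add_nonneg_eq_0_iff zero_le_one zero_le_power2 zero_neq_one)

lemma soft_step_deriv: "(soft_step has_real_derivative soft_step' t) (at t)"
proof -
  let ?m = "max 0 t"
  have "(soft_step has_real_derivative
      (2 * ?m * (1 + ?m\<^sup>2) - ?m\<^sup>2 * (0 + 2 * ?m)) / ((1 + ?m\<^sup>2) * (1 + ?m\<^sup>2))) (at t)"
    unfolding soft_step_def[abs_def]
    by (intro DERIV_divide DERIV_add DERIV_const max0_square_deriv) (rule one_plus_square_pos)
  then show ?thesis
    by (rule DERIV_cong) (simp add: soft_step'_def power2_eq_square algebra_simps)
qed

lemma soft_step_bounds: "0 \<le> soft_step t" "soft_step t \<le> 1" "0 \<le> soft_step' t"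
  by (auto simp: soft_step_def soft_step'_def one_plus_square_pos divide_le_eq)

lemma soft_step_nonpos: "t \<le> 0 \<Longrightarrow> soft_step t = 0"
  by (simp add: soft_step_def)

lemma soft_step_tendsto:
  assumes "d > 0"
  shows "(\<lambda>n. soft_step (real n * d - 1)) \<longlonglongrightarrow> 1"
proof -
  have f: "filterlim (\<lambda>n. real n * d - 1) at_top sequentially"
    using assms by real_asymp
  have "((\<lambda>t::real. t\<^sup>2 / (1 + t\<^sup>2)) \<longlongrightarrow> 1) at_top" by real_asymp
  moreover have "\<forall>\<^sub>F t in at_top. t\<^sup>2 / (1 + t\<^sup>2) = soft_step t"
    using eventually_ge_at_top[of 0] by eventually_elim (simp add: soft_step_def)
  ultimately have "(soft_step \<longlongrightarrow> 1) at_top" by (rule Lim_transform_eventually)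
  then show ?thesis by (rule filterlim_compose[OF _ f])
qed

text \<open>No plateau near 0 is needed: 1 minus this cutoff is of order |x|^2, which cancels the
  factor |x|^(-2) of the weight in the part that is cut away.\<close>

definition radial_cutoff :: "real \<Rightarrow> 'a::euclidean_space \<Rightarrow> real" where
  "radial_cutoff s x = (max 0 (1 - (norm x)\<^sup>2 / s\<^sup>2))\<^sup>2"

definition radial_cutoff' :: "real \<Rightarrow> 'a::euclidean_space \<Rightarrow> 'a \<Rightarrow> real" where
  "radial_cutoff' s x h = - 4 * max 0 (1 - (norm x)\<^sup>2 / s\<^sup>2) * (x \<bullet> h) / s\<^sup>2"

lemma norm_square_deriv: "((\<lambda>x::'a::euclidean_space. (norm x)\<^sup>2) has_derivative (\<lambda>h. 2 * (x \<bullet> h))) (at x)"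
  unfolding power2_norm_eq_inner
  by (auto intro!: derivative_eq_intros simp: inner_commute)

lemma radial_cutoff_deriv: "(radial_cutoff s has_derivative radial_cutoff' s x) (at x)"
proof -
  have "((\<lambda>x. 1 - (norm x)\<^sup>2 / s\<^sup>2) has_derivative (\<lambda>h. - (2 * (x \<bullet> h) / s\<^sup>2))) (at x)"
    by (rule has_derivative_eq_rhs[OF has_derivative_diff[OF has_derivative_const
          bounded_linear.has_derivative[OF bounded_linear_divide norm_square_deriv]]]) simp
  from has_derivative_compose[OF this max0_square_deriv[unfolded has_field_derivative_def]]
  have "((\<lambda>x. (max 0 (1 - (norm x)\<^sup>2 / s\<^sup>2))\<^sup>2) has_derivative
     (\<lambda>h. 2 * max 0 (1 - (norm x)\<^sup>2 / s\<^sup>2) * (- (2 * (x \<bullet> h) / s\<^sup>2)))) (at x)" .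
  then show ?thesis
    unfolding radial_cutoff_def[abs_def]
    by (rule has_derivative_eq_rhs) (simp add: radial_cutoff'_def fun_eq_iff)
qed

lemma radial_cutoff_bounds: "0 \<le> radial_cutoff s x" "radial_cutoff s x \<le> 1"
  by (auto simp: radial_cutoff_def power_le_one)

lemma radial_cutoff_outside:
  assumes "s > 0" "s \<le> norm x"
  shows "radial_cutoff s x = 0" "radial_cutoff' s x h = 0"
proof -
  have "(norm x)\<^sup>2 / s\<^sup>2 \<ge> 1" using assms by (simp add: power_mono)
  then have "max 0 (1 - (norm x)\<^sup>2 / s\<^sup>2) = 0" by simp
  then show "radial_cutoff s x = 0" "radial_cutoff' s x h = 0"
    by (simp_all add: radial_cutoff_def radial_cutoff'_def)
qed

lemma one_minus_radial_cutoff: "1 - radial_cutoff s x \<le> 2 * (norm x)\<^sup>2 / s\<^sup>2"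
proof -
  define t where "t = (norm x)\<^sup>2 / s\<^sup>2"
  have t: "t \<ge> 0" by (simp add: t_def)
  have "1 - (max 0 (1 - t))\<^sup>2 \<le> 2 * t"
  proof (cases "t \<le> 1")
    case True
    then have "1 - (max 0 (1 - t))\<^sup>2 = 2 * t - t\<^sup>2" by (simp add: power2_eq_square algebra_simps)
    then show ?thesis by simp
  qed (simp add: max_def)
  then show ?thesis by (simp add: radial_cutoff_def t_def)
qed

text \<open>F is under control only in the ball of radius 2 s. The product is differentiable there
  and vanishes outside the closed ball of radius s; these two open sets overlap and cover the
  plane.\<close>

lemma radial_cutoff_extension:
  fixes F :: "'a::euclidean_space \<Rightarrow> 'b::euclidean_space"
  assumes "s > 0"
    and dF: "\<And>x. norm x < 2 * s \<Longrightarrow> (F has_derivative F' x) (at x)"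
    and cF: "\<And>h. continuous_on (ball 0 (2 * s)) (\<lambda>x. F' x h)"
  shows "((\<lambda>x. radial_cutoff s x *\<^sub>R F x) has_derivative
           (\<lambda>h. radial_cutoff s x *\<^sub>R F' x h + radial_cutoff' s x h *\<^sub>R F x)) (at x)"
    and "continuous_on UNIV (\<lambda>x. radial_cutoff s x *\<^sub>R F' x h + radial_cutoff' s x h *\<^sub>R F x)"
proof -
  let ?D = "\<lambda>x h. radial_cutoff s x *\<^sub>R F' x h + radial_cutoff' s x h *\<^sub>R F x"
  show "((\<lambda>x. radial_cutoff s x *\<^sub>R F x) has_derivative ?D x) (at x)"
  proof (cases "norm x < 2 * s")
    case True
    then show ?thesis
      using has_derivative_scaleR[OF radial_cutoff_deriv dF] by simp
  next
    case False
    have "((\<lambda>x. 0) has_derivative (\<lambda>h. 0)) (at x)" by simp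
    then have "((\<lambda>x. radial_cutoff s x *\<^sub>R F x) has_derivative (\<lambda>h. 0)) (at x)"
      by (rule has_derivative_transform_within_open[where s = "- cball 0 s"])
        (use False \<open>s > 0\<close> in \<open>auto simp: radial_cutoff_outside\<close>)
    then show ?thesis using radial_cutoff_outside[of s x] False \<open>s > 0\<close> by simp
  qed
  have cont_F: "continuous_on (ball 0 (2 * s)) F"
    using has_derivative_continuous[OF dF] by (intro continuous_at_imp_continuous_on) auto
  have "continuous_on (ball 0 (2 * s)) (\<lambda>x. ?D x h)"
    unfolding radial_cutoff_def radial_cutoff'_def using \<open>s > 0\<close>
    by (intro continuous_intros cF cont_F) auto
  moreover have "continuous_on (- cball 0 s) (\<lambda>x. ?D x h)"
    by (rule continuous_on_eq[of _ "\<lambda>x. 0"]) (use \<open>s > 0\<close> in \<open>auto simp: radial_cutoff_outside\<close>)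
  ultimately have "continuous_on (ball 0 (2 * s) \<union> - cball 0 s) (\<lambda>x. ?D x h)"
    by (intro continuous_on_open_Un) auto
  moreover have "ball 0 (2 * s) \<union> - cball 0 s = (UNIV :: 'a set)"
    using \<open>s > 0\<close> by auto
  ultimately show "continuous_on UNIV (\<lambda>x. ?D x h)" by simp
qed

section \<open>A vector field with divergence the Hardy weight\<close>

definition reg_square :: "real \<Rightarrow> real^2 \<Rightarrow> real" where
  "reg_square \<epsilon> x = (norm x)\<^sup>2 + \<epsilon>\<^sup>2"

definition reg_log :: "real \<Rightarrow> real \<Rightarrow> real^2 \<Rightarrow> real" where
  "reg_log a \<epsilon> x = ln a - ln (reg_square \<epsilon> x) / 2"

text \<open>Writing R = |x|^2 + \<epsilon>^2 and L = log(a / sqrt R), this is (x + K R e) / (R L).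
  For \<epsilon> = K = 0 it is the unregularised radial field; the correction K R e has relative
  size K sqrt R at most up to the regularisation, so it costs little near the origin.\<close>

definition hardy_field :: "real \<Rightarrow> real \<Rightarrow> real \<Rightarrow> real^2 \<Rightarrow> real^2 \<Rightarrow> real^2" where
  "hardy_field a \<epsilon> K e x = (1 / reg_log a \<epsilon> x) *\<^sub>R ((1 / reg_square \<epsilon> x) *\<^sub>R x + K *\<^sub>R e)"

definition hardy_field' :: "real \<Rightarrow> real \<Rightarrow> real \<Rightarrow> real^2 \<Rightarrow> real^2 \<Rightarrow> real^2 \<Rightarrow> real^2" where
  "hardy_field' a \<epsilon> K e x h =
     ((x \<bullet> h) / (reg_square \<epsilon> x * (reg_log a \<epsilon> x)\<^sup>2)) *\<^sub>R ((1 / reg_square \<epsilon> x) *\<^sub>R x + K *\<^sub>R e) +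
     (1 / reg_log a \<epsilon> x) *\<^sub>R ((1 / reg_square \<epsilon> x) *\<^sub>R h - (2 * (x \<bullet> h) / (reg_square \<epsilon> x)\<^sup>2) *\<^sub>R x)"

lemma reg_square_pos: "\<epsilon> > 0 \<Longrightarrow> reg_square \<epsilon> x > 0"
  by (simp add: reg_square_def add_nonneg_pos)

lemma reg_square_deriv: "(reg_square \<epsilon> has_derivative (\<lambda>h. 2 * (x \<bullet> h))) (at x)"
  unfolding reg_square_def[abs_def] by (auto intro!: derivative_eq_intros norm_square_deriv)

lemma reg_log_deriv:
  assumes "\<epsilon> > 0"
  shows "(reg_log a \<epsilon> has_derivative (\<lambda>h. - ((x \<bullet> h) / reg_square \<epsilon> x))) (at x)"
proof -
  have "((\<lambda>x. ln (reg_square \<epsilon> x)) has_derivative (\<lambda>h. inverse (reg_square \<epsilon> x) * (2 * (x \<bullet> h)))) (at x)"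
    using has_derivative_compose[OF reg_square_deriv, of ln] DERIV_ln[OF reg_square_pos[OF assms]]
    by (auto simp: has_field_derivative_def)
  then show ?thesis unfolding reg_log_def[abs_def]
    by (intro has_derivative_eq_rhs[OF has_derivative_diff[OF has_derivative_const
          bounded_linear.has_derivative[OF bounded_linear_divide]]])
      (auto simp: fun_eq_iff field_simps)
qed

lemma hardy_field_deriv:
  assumes "\<epsilon> > 0" "reg_log a \<epsilon> x > 0"
  shows "(hardy_field a \<epsilon> K e has_derivative hardy_field' a \<epsilon> K e x) (at x)"
proof -
  have R: "reg_square \<epsilon> x \<noteq> 0" using reg_square_pos[OF assms(1), of x] by simp
  have 1: "((\<lambda>x. 1 / reg_log a \<epsilon> x) has_derivative
      (\<lambda>h. (x \<bullet> h) / (reg_square \<epsilon> x * (reg_log a \<epsilon> x)\<^sup>2))) (at x)"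
    using assms R
    by (auto intro!: derivative_eq_intros reg_log_deriv simp: power2_eq_square divide_simps)
  have 2: "((\<lambda>x. (1 / reg_square \<epsilon> x) *\<^sub>R x + K *\<^sub>R e) has_derivative
      (\<lambda>h. (1 / reg_square \<epsilon> x) *\<^sub>R h - (2 * (x \<bullet> h) / (reg_square \<epsilon> x)\<^sup>2) *\<^sub>R x)) (at x)"
    using R by (auto intro!: derivative_eq_intros reg_square_deriv simp: power2_eq_square divide_simps)
  from has_derivative_scaleR[OF 1 2] show ?thesis
    unfolding hardy_field_def[abs_def]
    by (rule has_derivative_eq_rhs) (simp add: hardy_field'_def fun_eq_iff add.commute)
qed

lemma hardy_field'_continuous:
  assumes "\<epsilon> > 0" "\<And>x. x \<in> S \<Longrightarrow> reg_log a \<epsilon> x > 0"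
  shows "continuous_on S (\<lambda>x. hardy_field' a \<epsilon> K e x h)"
proof -
  have [continuous_intros]: "continuous_on S (reg_square \<epsilon>)" "continuous_on S (reg_log a \<epsilon>)"
    using reg_square_deriv reg_log_deriv[OF assms(1)] has_derivative_continuous
    by (metis continuous_at_imp_continuous_on)+
  have "reg_log a \<epsilon> x \<noteq> 0" if "x \<in> S" for x using assms(2)[OF that] by simp
  moreover have "reg_square \<epsilon> x \<noteq> 0" for x using reg_square_pos[OF assms(1), of x] by simp
  ultimately show ?thesis
    unfolding hardy_field'_def by (intro continuous_intros) auto
qed

text \<open>The divergence is exactly (|x|^2 / R + K (x \<bullet> e) + 2 L \<epsilon>^2 / R) / (R
  L^2). As L >= 1, the last summand is at least \<epsilon>^2 / R, which restores |x|^2 / R +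
  \<epsilon>^2 / R = 1; the correction by e costs at most \<delta>. Hence the regularisation does
  not spoil the constant.\<close>

lemma hardy_field_divergence:
  assumes "\<epsilon> > 0" "reg_log a \<epsilon> x \<ge> 1" "K \<ge> 0" "norm e \<le> 1" "K * norm x \<le> \<delta>"
  shows "(1 - \<delta>) / (reg_square \<epsilon> x * (reg_log a \<epsilon> x)\<^sup>2) \<le> (\<Sum>i\<in>UNIV. hardy_field' a \<epsilon> K e x (axis i 1) $ i)"
proof -
  define R L where "R = reg_square \<epsilon> x" and "L = reg_log a \<epsilon> x"
  have R: "R > 0" "R = (norm x)\<^sup>2 + \<epsilon>\<^sup>2"
    using reg_square_pos[OF assms(1)] by (auto simp: R_def reg_square_def)
  have L: "L \<ge> 1" using assms by (simp add: L_def)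
  have nx: "(norm x)\<^sup>2 = (x $ 1)\<^sup>2 + (x $ 2)\<^sup>2"
    unfolding power2_norm_eq_inner by (simp add: inner_vec_def sum_2 power2_eq_square)
  have xe: "x \<bullet> e = x $ 1 * e $ 1 + x $ 2 * e $ 2"
    by (simp add: inner_vec_def sum_2)
  have "(\<Sum>i\<in>UNIV. hardy_field' a \<epsilon> K e x (axis i 1) $ i) =
     ((norm x)\<^sup>2 / R + K * (x \<bullet> e)) / (R * L\<^sup>2) + (2 / R - 2 * (norm x)\<^sup>2 / R\<^sup>2) / L"
    unfolding hardy_field'_def R_def[symmetric] L_def[symmetric] sum_2 nx xe
    by (simp add: inner_axis algebra_simps add_divide_distrib diff_divide_distrib power2_eq_square)
  also have "\<dots> = ((norm x)\<^sup>2 / R + K * (x \<bullet> e) + 2 * L * (\<epsilon>\<^sup>2 / R)) / (R * L\<^sup>2)"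
  proof -
    have "2 / R - 2 * (norm x)\<^sup>2 / R\<^sup>2 = 2 * \<epsilon>\<^sup>2 / R\<^sup>2"
    proof -
      have "2 / R = 2 * R / R\<^sup>2" using R(1) by (simp add: power2_eq_square)
      then have "2 / R - 2 * (norm x)\<^sup>2 / R\<^sup>2 = (2 * R - 2 * (norm x)\<^sup>2) / R\<^sup>2"
        by (simp add: diff_divide_distrib)
      then show ?thesis by (simp add: R(2))
    qed
    moreover have "L \<noteq> 0" "R \<noteq> 0" using R(1) L by auto
    ultimately show ?thesis by (simp add: add_divide_distrib power2_eq_square)
  qed
  also have "\<dots> \<ge> (1 - \<delta>) / (R * L\<^sup>2)"
  proof (rule divide_right_mono)
    have "- (K * (x \<bullet> e)) \<le> K * norm x"
    proof -
      have "- (x \<bullet> e) \<le> norm x * norm e" using Cauchy_Schwarz_ineq2[of x e] by linarith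
      also have "\<dots> \<le> norm x" using assms(4) by (simp add: mult_left_le)
      finally show ?thesis using assms(3) mult_left_mono[of "- (x \<bullet> e)" "norm x" K] by simp
    qed
    moreover have "\<epsilon>\<^sup>2 / R \<le> 2 * L * (\<epsilon>\<^sup>2 / R)"
      using L R mult_right_mono[of 1 "2 * L" "\<epsilon>\<^sup>2 / R"] by simp
    moreover have "(norm x)\<^sup>2 / R + \<epsilon>\<^sup>2 / R = 1"
      using R(1) by (simp add: add_divide_distrib[symmetric]) (simp add: R(2))
    ultimately show "1 - \<delta> \<le> (norm x)\<^sup>2 / R + K * (x \<bullet> e) + 2 * L * (\<epsilon>\<^sup>2 / R)"
      using assms(5) by linarith
  qed (use R in auto)
  finally show ?thesis by (simp add: R_def L_def)
qed

text \<open>The first bound matches the divergence up to factors close to 1, which keeps the Hardy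
  constant near 4. The second controls the derivative of the radial cutoff along the field and does
  not involve \<epsilon>.\<close>

lemma hardy_field_norm:
  assumes "\<epsilon> > 0" "reg_log a \<epsilon> x \<ge> 1" "K \<ge> 0" "norm e \<le> 1" "K * sqrt (reg_square \<epsilon> x) \<le> \<delta>"
  shows "(norm (hardy_field a \<epsilon> K e x))\<^sup>2 \<le> (1 + \<delta>)\<^sup>2 / (reg_square \<epsilon> x * (reg_log a \<epsilon> x)\<^sup>2)"
    and "norm x * norm (hardy_field a \<epsilon> K e x) \<le> 1 + K * norm x"
proof -
  define R L where "R = reg_square \<epsilon> x" and "L = reg_log a \<epsilon> x"
  have R: "R > 0" "(norm x)\<^sup>2 \<le> R"
    using reg_square_pos[OF assms(1)] by (auto simp: R_def reg_square_def)
  have L: "L \<ge> 1" using assms by (simp add: L_def)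
  have nx: "norm x \<le> sqrt R" using R by (simp add: real_le_rsqrt)
  have "norm ((1 / R) *\<^sub>R x + K *\<^sub>R e) \<le> norm ((1 / R) *\<^sub>R x) + norm (K *\<^sub>R e)"
    by (rule norm_triangle_ineq)
  also have "\<dots> \<le> norm x / R + K"
    using R assms by (simp add: mult_left_le)
  finally have n: "norm ((1 / R) *\<^sub>R x + K *\<^sub>R e) \<le> norm x / R + K" .
  have G: "norm (hardy_field a \<epsilon> K e x) = norm ((1 / R) *\<^sub>R x + K *\<^sub>R e) / L"
    unfolding hardy_field_def R_def[symmetric] L_def[symmetric] using L by simp
  have "norm x / R \<le> sqrt R / R" using nx R by (simp add: divide_right_mono)
  also have "\<dots> = 1 / sqrt R" using R by (simp add: real_div_sqrt divide_simps)
  finally have "norm x / R + K \<le> (1 + K * sqrt R) / sqrt R"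
    using R by (simp add: add_divide_distrib)
  also have "\<dots> \<le> (1 + \<delta>) / sqrt R" using assms(5) R by (simp add: R_def divide_right_mono)
  finally have "norm (hardy_field a \<epsilon> K e x) \<le> (1 + \<delta>) / sqrt R / L"
    unfolding G using n L by (intro divide_right_mono) auto
  then have "(norm (hardy_field a \<epsilon> K e x))\<^sup>2 \<le> ((1 + \<delta>) / sqrt R / L)\<^sup>2"
    by (rule power_mono) simp
  then show "(norm (hardy_field a \<epsilon> K e x))\<^sup>2 \<le> (1 + \<delta>)\<^sup>2 / (reg_square \<epsilon> x * (reg_log a \<epsilon> x)\<^sup>2)"
    using R by (simp add: power_divide power_mult_distrib R_def L_def)
  have "norm (hardy_field a \<epsilon> K e x) \<le> norm ((1 / R) *\<^sub>R x + K *\<^sub>R e)"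
    unfolding G using L by (simp add: divide_le_eq mult_le_cancel_left1)
  then have "norm (hardy_field a \<epsilon> K e x) \<le> norm x / R + K" using n by simp
  then have "norm x * norm (hardy_field a \<epsilon> K e x) \<le> norm x * (norm x / R + K)"
    by (intro mult_left_mono) auto
  also have "\<dots> = (norm x)\<^sup>2 / R + K * norm x" by (simp add: power2_eq_square algebra_simps)
  also have "\<dots> \<le> 1 + K * norm x" using R by (simp add: divide_le_eq)
  finally show "norm x * norm (hardy_field a \<epsilon> K e x) \<le> 1 + K * norm x" .
qed

section \<open>The Hardy inequality\<close>

lemma Fatou_real:
  fixes f :: "nat \<Rightarrow> 'a \<Rightarrow> real"
  assumes int: "\<And>n. integrable M (f n)" and nonneg: "\<And>n x. 0 \<le> f n x"
    and bound: "\<And>n. integral\<^sup>L M (f n) \<le> B"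
    and [measurable]: "g \<in> borel_measurable M"
    and lim: "AE x in M. (\<lambda>n. f n x) \<longlonglongrightarrow> g x"
  shows "integrable M g" and "integral\<^sup>L M g \<le> B" and "AE x in M. 0 \<le> g x"
proof -
  have [measurable]: "f n \<in> borel_measurable M" for n using int by auto
  show pos: "AE x in M. 0 \<le> g x"
    using lim by eventually_elim (rule LIMSEQ_le_const, use nonneg in auto)
  have "0 \<le> integral\<^sup>L M (f 0)" using nonneg by (intro Bochner_Integration.integral_nonneg)
  then have "B \<ge> 0" using bound[of 0] by simp
  have "(\<integral>\<^sup>+ x. ennreal (g x) \<partial>M) = (\<integral>\<^sup>+ x. liminf (\<lambda>n. ennreal (f n x)) \<partial>M)"
  proof (rule nn_integral_cong_AE)
    show "AE x in M. ennreal (g x) = liminf (\<lambda>n. ennreal (f n x))"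
      using lim by eventually_elim (metis lim_imp_Liminf tendsto_ennrealI trivial_limit_sequentially)
  qed
  also have "\<dots> \<le> liminf (\<lambda>n. \<integral>\<^sup>+ x. ennreal (f n x) \<partial>M)"
    by (rule nn_integral_liminf) measurable
  also have "\<dots> \<le> ennreal B"
  proof -
    have "(\<integral>\<^sup>+ x. ennreal (f n x) \<partial>M) \<le> ennreal B" for n
      using nn_integral_eq_integral[OF int[of n]] nonneg bound by (simp add: ennreal_leI)
    then have "liminf (\<lambda>n. \<integral>\<^sup>+ x. ennreal (f n x) \<partial>M) \<le> liminf (\<lambda>n. ennreal B)"
      by (intro Liminf_mono) auto
    then show ?thesis by (simp add: Liminf_const)
  qed
  finally have *: "(\<integral>\<^sup>+ x. ennreal (g x) \<partial>M) \<le> ennreal B" .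
  show i: "integrable M g"
    by (rule integrableI_nonneg[OF _ pos]) (use * in \<open>auto simp: order_le_less_trans\<close>)
  show "integral\<^sup>L M g \<le> B"
    using * nn_integral_eq_integral[OF i pos] \<open>B \<ge> 0\<close> by simp
qed

text \<open>Near the origin, \<open>\<Omega>\<close> is \<open>{d > 0}\<close>, and adding the small multiple \<open>K |x|\<^sup>2 e\<close> to the radial
  field makes it point into \<open>\<Omega>\<close>.\<close>

definition inward_chart ::
    "(real^2) set \<Rightarrow> real \<Rightarrow> real \<Rightarrow> real^2 \<Rightarrow> (real^2 \<Rightarrow> real) \<Rightarrow> (real^2 \<Rightarrow> real^2 \<Rightarrow> real) \<Rightarrow> bool" where
  "inward_chart \<Omega> r K e d d' \<longleftrightarrow> r > 0 \<and> K \<ge> 0 \<and> norm e \<le> 1 \<and>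
     (\<forall>x. (d has_derivative d' x) (at x)) \<and> (\<forall>h. continuous_on UNIV (\<lambda>x. d' x h)) \<and>
     (\<forall>x\<in>ball 0 r. x \<in> \<Omega> \<longleftrightarrow> d x > 0) \<and>
     (\<forall>x\<in>ball 0 r. d x > 0 \<longrightarrow> 0 \<le> d' x e \<and> 0 \<le> d' x x + K * (norm x)\<^sup>2 * d' x e)"

lemma inward_chart_interior:
  assumes "open \<Omega>" "0 \<in> \<Omega>"
  shows "\<exists>r K e d d'. inward_chart \<Omega> r K e d d'"
proof -
  obtain r where "r > 0" "ball 0 r \<subseteq> \<Omega>" using openE[OF assms] by blast
  \<comment> \<open>Around an interior point there is no boundary to respect, so a constant d and
    the zero direction serve; for this the chart asks for \<open>norm e \<le> 1\<close> and not for
    a unit vector.\<close>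
  then have "inward_chart \<Omega> r 0 0 (\<lambda>x. 1) (\<lambda>x h. 0)"
    by (auto simp: inward_chart_def)
  then show ?thesis by blast
qed

lemma smooth_fun_real_deriv:
  fixes \<gamma> :: "real \<Rightarrow> real"
  assumes "smooth_fun \<gamma>"
  shows "(\<gamma> has_real_derivative dir_deriv 1 \<gamma> t) (at t)"
proof -
  have l: "linear (\<lambda>h. dir_deriv h \<gamma> t)"
    using smooth_fun_has_derivative[OF assms] has_derivative_linear by blast
  have "dir_deriv h \<gamma> t = dir_deriv 1 \<gamma> t * h" for h
    using linear_cmul[OF l, of h 1] by (simp add: mult.commute)
  then show ?thesis unfolding has_field_derivative_def
    by (intro has_derivative_eq_rhs[OF smooth_fun_has_derivative[OF assms]] ext)
qed

lemma smooth_fun_real_Lipschitz: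
  fixes \<gamma> :: "real \<Rightarrow> real"
  assumes "smooth_fun \<gamma>"
  obtains K where "K \<ge> 0" "\<And>s t. \<bar>s\<bar> \<le> r \<Longrightarrow> \<bar>t\<bar> \<le> r \<Longrightarrow> \<bar>\<gamma> s - \<gamma> t\<bar> \<le> K * \<bar>s - t\<bar>"
proof -
  have "bounded (dir_deriv 1 \<gamma> ` {-r..r})"
    by (intro compact_imp_bounded compact_continuous_image smooth_fun_dir_deriv_continuous assms) simp
  then obtain K where K: "K > 0" "\<forall>t\<in>{-r..r}. \<bar>dir_deriv 1 \<gamma> t\<bar> \<le> K" by (auto simp: bounded_pos)
  have "\<bar>\<gamma> s - \<gamma> t\<bar> \<le> K * \<bar>s - t\<bar>" if "\<bar>s\<bar> \<le> r" "\<bar>t\<bar> \<le> r" for s t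
  proof -
    have "norm (\<gamma> s - \<gamma> t) \<le> K * norm (s - t)"
      by (rule field_differentiable_bound[where S = "{-r..r}" and f' = "dir_deriv 1 \<gamma>"])
        (use that K in \<open>auto intro: has_field_derivative_at_within smooth_fun_real_deriv assms\<close>)
    then show ?thesis by simp
  qed
  then show ?thesis using K(1) by (intro that[of K]) auto
qed

text \<open>With d(x) = x \<bullet> e2 - \<gamma>(\<sigma>), \<sigma> = x \<bullet> e1, the radial
  derivative of d is x \<bullet> e2 - \<sigma> \<gamma>'(\<sigma>), which exceeds \<gamma>(\<sigma>)
  - \<sigma> \<gamma>'(\<sigma>) where d > 0. As \<gamma>(0) = 0, the mean value theorem turns this
  into \<sigma> (\<gamma>'(\<xi>) - \<gamma>'(\<sigma>)), at least -K |x|^2 for K a Lipschitz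
  constant of \<gamma>'. The derivative of d along e2 is 1, so adding K |x|^2 e2
  compensates.\<close>

lemma inward_chart_boundary:
  assumes "open \<Omega>" "smooth_boundary \<Omega>" "0 \<in> closure \<Omega>" "0 \<notin> \<Omega>"
  shows "\<exists>r K e d d'. inward_chart \<Omega> r K e d d'"
proof -
  have "0 \<in> frontier \<Omega>" using assms by (simp add: frontier_def interior_open)
  then obtain r e1 e2 \<gamma> where r: "r > 0" and e: "norm e1 = 1" "norm e2 = 1" "e1 \<bullet> e2 = 0"
    and sm: "smooth_fun (\<gamma> :: real \<Rightarrow> real)"
    and loc: "\<Omega> \<inter> ball 0 r = {x \<in> ball 0 r. \<gamma> (x \<bullet> e1) < x \<bullet> e2}"
    using assms(2) unfolding smooth_boundary_def by blast
  let ?\<gamma>' = "dir_deriv 1 \<gamma>"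
  have s1: "\<bar>x \<bullet> e1\<bar> \<le> norm x" for x using Cauchy_Schwarz_ineq2[of x e1] e by simp
  obtain K where K: "K \<ge> 0" "\<And>s t. \<bar>s\<bar> \<le> r \<Longrightarrow> \<bar>t\<bar> \<le> r \<Longrightarrow> \<bar>?\<gamma>' s - ?\<gamma>' t\<bar> \<le> K * \<bar>s - t\<bar>"
    using smooth_fun_real_Lipschitz[OF smooth_fun_dir_deriv[OF sm, of 1], of r] by metis
  define d where "d x = x \<bullet> e2 - \<gamma> (x \<bullet> e1)" for x
  define d' where "d' x h = h \<bullet> e2 - ?\<gamma>' (x \<bullet> e1) * (h \<bullet> e1)" for x h
  have D: "(d has_derivative d' x) (at x)" for x
  proof -
    have "((\<lambda>x. x \<bullet> e1) has_derivative (\<lambda>h. h \<bullet> e1)) (at x)"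
      by (auto intro!: derivative_eq_intros)
    from has_derivative_compose[OF this smooth_fun_real_deriv[OF sm, unfolded has_field_derivative_def]]
    have "((\<lambda>x. \<gamma> (x \<bullet> e1)) has_derivative (\<lambda>h. ?\<gamma>' (x \<bullet> e1) * (h \<bullet> e1))) (at x)" .
    then show ?thesis unfolding d_def[abs_def] d'_def
      by (auto intro!: derivative_eq_intros)
  qed
  have C: "continuous_on UNIV (\<lambda>x. d' x h)" for h
    unfolding d'_def
    by (intro continuous_intros continuous_on_compose2[OF smooth_fun_dir_deriv_continuous[OF sm, of UNIV 1]]) auto
  have inO: "x \<in> \<Omega> \<longleftrightarrow> d x > 0" if "x \<in> ball 0 r" for x
  proof -
    have "x \<in> \<Omega> \<inter> ball 0 r \<longleftrightarrow> \<gamma> (x \<bullet> e1) < x \<bullet> e2" unfolding loc using that by simp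
    then show ?thesis using that by (simp add: d_def)
  qed
  \<comment> \<open>The graph passes through the origin: 0 is not in \<Omega>, which gives one
    inequality, and it is a limit of points of \<Omega>, which gives the other.\<close>
  have "\<gamma> 0 = 0"
  proof (rule antisym)
    show "\<gamma> 0 \<ge> 0" using inO[of 0] assms(4) r by (simp add: d_def)
    show "\<gamma> 0 \<le> 0"
    proof (rule ccontr)
      assume "\<not> \<gamma> 0 \<le> 0"
      then have "d 0 < 0" by (simp add: d_def)
      have "continuous_on UNIV d"
        using D has_derivative_continuous by (metis continuous_at_imp_continuous_on)
      then have "open (ball 0 r \<inter> d -` {..<0})"
        by (intro open_Int open_ball open_vimage) auto
      moreover have "0 \<in> ball 0 r \<inter> d -` {..<0}" using r \<open>d 0 < 0\<close> by simp
      ultimately have "\<Omega> \<inter> (ball 0 r \<inter> d -` {..<0}) \<noteq> {}"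
        using assms(3) open_Int_closure_eq_empty by blast
      then show False using inO by force
    qed
  qed
  have "0 \<le> d' x x + K * (norm x)\<^sup>2 * d' x e2" if x: "x \<in> ball 0 r" "d x > 0" for x
  proof -
    define \<sigma> where "\<sigma> = x \<bullet> e1"
    have \<sigma>: "\<bar>\<sigma>\<bar> \<le> norm x" "\<bar>\<sigma>\<bar> \<le> r" using s1[of x] x by (auto simp: \<sigma>_def)
    \<comment> \<open>Mean value point between 0 and \<sigma>; only its distance to \<sigma> matters
      afterwards.\<close>
    obtain \<xi> where \<xi>: "\<bar>\<xi>\<bar> \<le> r" "\<bar>\<xi> - \<sigma>\<bar> \<le> \<bar>\<sigma>\<bar>" "\<gamma> \<sigma> = \<sigma> * ?\<gamma>' \<xi>"
    proof (cases rule: linorder_cases[of \<sigma> 0])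
      case less
      obtain z where "\<sigma> < z" "z < 0" "\<gamma> 0 - \<gamma> \<sigma> = (0 - \<sigma>) * ?\<gamma>' z"
        using MVT2[OF less, of \<gamma> ?\<gamma>'] smooth_fun_real_deriv[OF sm] by blast
      then show ?thesis using that[of z] \<sigma> \<open>\<gamma> 0 = 0\<close> by simp
    next
      case equal
      then show ?thesis using that[of 0] r \<open>\<gamma> 0 = 0\<close> by simp
    next
      case greater
      obtain z where "0 < z" "z < \<sigma>" "\<gamma> \<sigma> - \<gamma> 0 = (\<sigma> - 0) * ?\<gamma>' z"
        using MVT2[OF greater, of \<gamma> ?\<gamma>'] smooth_fun_real_deriv[OF sm] by blast
      then show ?thesis using that[of z] \<sigma> \<open>\<gamma> 0 = 0\<close> by simp
    qed
    have "\<bar>\<sigma> * (?\<gamma>' \<xi> - ?\<gamma>' \<sigma>)\<bar> \<le> \<bar>\<sigma>\<bar> * (K * \<bar>\<xi> - \<sigma>\<bar>)"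
      unfolding abs_mult using K(2)[OF \<xi>(1) \<sigma>(2)] by (intro mult_left_mono) auto
    also have "\<dots> \<le> norm x * (K * norm x)"
      using \<xi>(2) \<sigma>(1) K(1) by (intro mult_mono) auto
    finally have "- (\<sigma> * (?\<gamma>' \<xi> - ?\<gamma>' \<sigma>)) \<le> K * (norm x)\<^sup>2"
      by (simp add: power2_eq_square algebra_simps abs_le_iff)
    moreover have "x \<bullet> e2 > \<sigma> * ?\<gamma>' \<xi>" using x(2) \<xi>(3) by (simp add: d_def \<sigma>_def)
    moreover have "d' x e2 = 1" using e by (simp add: d'_def inner_commute flip: power2_norm_eq_inner)
    moreover have "d' x x = x \<bullet> e2 - ?\<gamma>' \<sigma> * \<sigma>" by (simp add: d'_def \<sigma>_def)
    ultimately show ?thesis by (simp add: algebra_simps)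
  qed
  moreover have "d' x e2 = 1" for x using e by (simp add: d'_def inner_commute flip: power2_norm_eq_inner)
  ultimately have "inward_chart \<Omega> r K e2 d d'"
    using r K(1) e D C inO by (simp add: inward_chart_def)
  then show ?thesis by blast
qed

lemma linear_sum_axis:
  fixes f :: "real^2 \<Rightarrow> real"
  assumes "linear f"
  shows "(\<Sum>i\<in>UNIV. f (axis i 1) * G $ i) = f G"
proof -
  have "f G = f (\<Sum>i\<in>UNIV. G $ i *\<^sub>R axis i 1)"
    using basis_expansion[of G] by (simp add: scalar_mult_eq_scaleR)
  also have "\<dots> = (\<Sum>i\<in>UNIV. G $ i * f (axis i 1))"
    unfolding linear_sum[OF assms] by (intro sum.cong refl) (use linear_cmul[OF assms] in auto)
  finally show ?thesis by (simp add: mult.commute)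
qed

lemma reg_log_ge:
  assumes "a > 1" "\<epsilon> > 0" "reg_square \<epsilon> x \<le> 1 / 9"
  shows "reg_log a \<epsilon> x \<ge> 1"
proof -
  \<comment> \<open>The bound 1/9 is chosen for e <= 3, which gives -ln(1/9) / 2 = ln 3 >=
    1.\<close>
  have "exp 2 = (exp (1::real))\<^sup>2" using exp_double[of "1::real"] by simp
  also have "\<dots> \<le> (3::real)\<^sup>2" by (intro power_mono exp_le) auto
  finally have "exp (2::real) \<le> 9" by simp
  then have "2 \<le> ln (9::real)" by (subst ln_ge_iff) auto
  moreover have "ln (reg_square \<epsilon> x) \<le> ln (1 / 9)"
    using assms reg_square_pos[of \<epsilon> x] by simp
  ultimately have "ln (reg_square \<epsilon> x) \<le> - 2" by (simp add: ln_div)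
  moreover have "ln a \<ge> 0" using assms by simp
  ultimately show ?thesis by (simp add: reg_log_def)
qed

lemma reg_log_pos:
  assumes "a > 1" "\<epsilon> > 0" "reg_square \<epsilon> x < 1"
  shows "reg_log a \<epsilon> x > 0"
proof -
  have "ln (reg_square \<epsilon> x) < 0" using assms reg_square_pos[of \<epsilon> x] by simp
  moreover have "ln a > 0" using assms by simp
  ultimately show ?thesis by (simp add: reg_log_def)
qed

text \<open>Complete the square of p \<Lambda> v + y and divide by p \<Lambda>. Here p is the share
  of the divergence spent on absorbing the gradient term.\<close>

lemma weighted_AM_GM:
  fixes v y p \<Lambda> q m :: real
  assumes "p > 0" "\<Lambda> > 0" "y\<^sup>2 \<le> m * (q * \<Lambda>)"
  shows "- (p * \<Lambda> * v\<^sup>2 + q * m / p) \<le> 2 * v * y"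
proof -
  have "0 \<le> (p * \<Lambda> * v + y)\<^sup>2" by simp
  then have "0 \<le> (p * \<Lambda>)\<^sup>2 * v\<^sup>2 + 2 * (p * \<Lambda>) * v * y + m * (q * \<Lambda>)"
    using assms(3) by (simp add: power2_eq_square algebra_simps)
  also have "\<dots> = (p * \<Lambda>) * (p * \<Lambda> * v\<^sup>2 + 2 * v * y + q * m / p)"
    using assms by (simp add: field_simps power2_eq_square)
  finally have "0 \<le> p * \<Lambda> * v\<^sup>2 + 2 * v * y + q * m / p"
    using mult_pos_pos[OF assms(1,2)] zero_le_mult_iff not_le by blast
  then show ?thesis by simp
qed

text \<open>The integral of v^2 div \<Phi> + 2 v (g \<bullet> \<Phi>) is zero for the field cut off
  near the boundary and away from the origin. Pointwise, the divergence of the field provides (1 -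
  \<delta>) times the regularised weight; half of it absorbs the product with the gradient and half
  remains. The boundary cutoff contributes with a good sign, the radial one a bounded multiple of
  v^2. Neither n nor \<epsilon> enters the constants.\<close>

lemma hardy_regularised:
  fixes n :: nat
  assumes sob: "sob \<Omega> v g" and "open \<Omega>" and chart: "inward_chart \<Omega> r K e d d'"
    and \<delta>: "0 < \<delta>" "\<delta> < 1" and s: "0 < s" "s < r" "s \<le> 1 / 5" "2 * K * s \<le> \<delta>"
    and a: "a > 1" and \<epsilon>: "0 < \<epsilon>" "\<epsilon> \<le> s"
  defines "b \<equiv> \<lambda>x. radial_cutoff s x * soft_step (real n * d x - 1) / (reg_square \<epsilon> x * (reg_log a \<epsilon> x)\<^sup>2)"
  shows "integrable lborel (\<lambda>x. (v x)\<^sup>2 * b x)" and "\<And>x. 0 \<le> b x"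
    and "(1 - \<delta>) / 2 * (LINT x|lborel. (v x)\<^sup>2 * b x) \<le>
         (1 + \<delta>)\<^sup>2 / ((1 - \<delta>) / 2) * (LINT x|lborel. (norm (g x))\<^sup>2) + 4 * (1 + K) / s\<^sup>2 * (LINT x|lborel. (v x)\<^sup>2)"
proof -
  note [measurable] = sob_measurable[OF sob]
  have K: "K \<ge> 0" "norm e \<le> 1" and D: "\<And>x. (d has_derivative d' x) (at x)"
    and D': "\<And>h. continuous_on UNIV (\<lambda>x. d' x h)"
    and in\<Omega>: "\<And>x. norm x < r \<Longrightarrow> x \<in> \<Omega> \<longleftrightarrow> d x > 0"
    and inw: "\<And>x. norm x < r \<Longrightarrow> d x > 0 \<Longrightarrow> 0 \<le> d' x e \<and> 0 \<le> d' x x + K * (norm x)\<^sup>2 * d' x e"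
    using chart by (auto simp: inward_chart_def)
  have cd: "continuous_on UNIV d"
    using D has_derivative_continuous by (metis continuous_at_imp_continuous_on)
  define c where "c x = soft_step (real n * d x - 1)" for x
  define c' where "c' x h = soft_step' (real n * d x - 1) * (real n * d' x h)" for x h
  have c01: "0 \<le> c x" "c x \<le> 1" for x by (auto simp: c_def soft_step_bounds)
  have dc: "(c has_derivative c' x) (at x)" for x
  proof -
    have "((\<lambda>x. real n * d x - 1) has_derivative (\<lambda>h. real n * d' x h)) (at x)"
      by (auto intro!: derivative_eq_intros D)
    from has_derivative_compose[OF this soft_step_deriv[unfolded has_field_derivative_def]]
    show ?thesis unfolding c_def[abs_def] c'_def .
  qed
  have cc: "continuous_on UNIV c"
    using dc has_derivative_continuous by (metis continuous_at_imp_continuous_on)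
  have cc': "continuous_on UNIV (\<lambda>x. c' x h)" for h
    unfolding c'_def soft_step'_def by (intro continuous_intros cd D') (simp add: one_plus_square_pos)
  let ?R = "reg_square \<epsilon>" and ?L = "reg_log a \<epsilon>" and ?G = "hardy_field a \<epsilon> K e" and ?G' = "hardy_field' a \<epsilon> K e"
  let ?\<eta> = "radial_cutoff s :: real^2 \<Rightarrow> real" and ?\<eta>' = "radial_cutoff' s :: real^2 \<Rightarrow> real^2 \<Rightarrow> real"
  have Rpos: "?R x > 0" for x using reg_square_pos[OF \<epsilon>(1)] .
  have R1: "?R x \<le> 2 * s\<^sup>2" if "norm x \<le> s" for x
  proof -
    have "(norm x)\<^sup>2 \<le> s\<^sup>2" using that by (intro power_mono) auto
    moreover have "\<epsilon>\<^sup>2 \<le> s\<^sup>2" using \<epsilon> by (intro power_mono) auto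
    ultimately show ?thesis by (simp add: reg_square_def)
  qed
  \<comment> \<open>The bound 1/5 gives R <= 2 s^2 <= 2/25 < 1/9 where the cutoff lives, so that L
    >= 1 there, and R <= 5 s^2 <= 1/5 < 1 on the ball of radius 2 s, so that L > 0 there.\<close>
  have s2: "s\<^sup>2 \<le> 1 / 25" using power_mono[OF s(3), of 2] s(1) by (simp add: power2_eq_square)
  have L1: "?L x \<ge> 1" if "norm x \<le> s" for x
    by (rule reg_log_ge[OF a \<epsilon>(1)]) (use R1[OF that] s2 in linarith)
  have L0: "?L x > 0" if "norm x < 2 * s" for x
  proof (rule reg_log_pos[OF a \<epsilon>(1)])
    have "(norm x)\<^sup>2 \<le> (2 * s)\<^sup>2" using that by (intro power_mono) auto
    moreover have "\<epsilon>\<^sup>2 \<le> s\<^sup>2" using \<epsilon> by (intro power_mono) auto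
    ultimately show "?R x < 1" using s2 by (simp add: reg_square_def power_mult_distrib)
  qed
  define F where "F x = c x *\<^sub>R ?G x" for x
  define F' where "F' x h = c x *\<^sub>R ?G' x h + c' x h *\<^sub>R ?G x" for x h
  define \<Phi> where "\<Phi> x = ?\<eta> x *\<^sub>R F x" for x
  define \<Phi>' where "\<Phi>' x h = ?\<eta> x *\<^sub>R F' x h + ?\<eta>' x h *\<^sub>R F x" for x h
  have dG: "(?G has_derivative ?G' x) (at x)" if "norm x < 2 * s" for x
    by (rule hardy_field_deriv[OF \<epsilon>(1) L0[OF that]])
  have dF: "(F has_derivative F' x) (at x)" if "norm x < 2 * s" for x
    unfolding F_def[abs_def] F'_def using has_derivative_scaleR[OF dc dG[OF that]] .
  have cG: "continuous_on (ball 0 (2 * s)) ?G"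
    using has_derivative_continuous[OF dG] by (intro continuous_at_imp_continuous_on) auto
  have cF': "continuous_on (ball 0 (2 * s)) (\<lambda>x. F' x h)" for h
    unfolding F'_def
    by (intro continuous_intros cG hardy_field'_continuous \<epsilon> continuous_on_subset[OF cc] continuous_on_subset[OF cc'])
      (use L0 in auto)
  have d\<Phi>: "(\<Phi> has_derivative \<Phi>' x) (at x)" "continuous_on UNIV (\<lambda>x. \<Phi>' x h)" for x h
    unfolding \<Phi>_def[abs_def] \<Phi>'_def using radial_cutoff_extension[OF s(1) dF cF'] by auto
  \<comment> \<open>A closed condition with a margin: d >= 1/n on Z, so Z is a compact subset of
    \<Omega>. For n = 0 it is empty.\<close>
  define Z where "Z = cball 0 s \<inter> {x. real n * d x - 1 \<ge> 0}"
  have Z: "compact Z"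
    unfolding Z_def by (intro compact_Int_closed closed_Collect_le continuous_intros cd) auto
  have Z\<Omega>: "Z \<subseteq> \<Omega>"
  proof
    fix x assume x: "x \<in> Z"
    then have "real n * d x \<ge> 1" "norm x < r" using s by (auto simp: Z_def)
    then have "d x > 0" by (metis mult_nonneg_nonpos not_le of_nat_0_le_iff order_trans zero_less_one less_le_not_le)
    then show "x \<in> \<Omega>" using in\<Omega> \<open>norm x < r\<close> by simp
  qed
  have off: "\<Phi> x = 0" if "x \<notin> Z" for x
  proof (cases "norm x \<le> s")
    case True
    then have "c x = 0" using that by (simp add: Z_def c_def soft_step_nonpos)
    then show ?thesis by (simp add: \<Phi>_def F_def)
  qed (use s in \<open>simp add: \<Phi>_def radial_cutoff_outside\<close>)
  note div = sob_square_divergence[OF sob \<open>open \<Omega>\<close> d\<Phi> Z Z\<Omega> off]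
  define Dv where "Dv x = (\<Sum>i\<in>UNIV. \<Phi>' x (axis i 1) $ i)" for x
  have Dv_eq: "Dv x = ?\<eta> x * c x * (\<Sum>i\<in>UNIV. ?G' x (axis i 1) $ i) + ?\<eta> x * c' x (?G x) + c x * ?\<eta>' x (?G x)" for x
  proof -
    have "linear (c' x)" using dc has_derivative_linear by blast
    moreover have "linear (?\<eta>' x)" using radial_cutoff_deriv has_derivative_linear by blast
    ultimately have "c' x (?G x) = (\<Sum>i\<in>UNIV. c' x (axis i 1) * ?G x $ i)"
      "?\<eta>' x (?G x) = (\<Sum>i\<in>UNIV. ?\<eta>' x (axis i 1) * ?G x $ i)"
      by (simp_all add: linear_sum_axis)
    then show ?thesis
      by (simp add: Dv_def \<Phi>'_def F'_def F_def sum.distrib sum_distrib_left algebra_simps)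
  qed
  define p where "p = (1 - \<delta>) / 2"
  have p: "p > 0" "1 - \<delta> = 2 * p" using \<delta> by (auto simp: p_def)
  define C1 where "C1 = 4 * (1 + K) / s\<^sup>2"
  show b0: "\<And>x. 0 \<le> b x"
    unfolding b_def using Rpos by (intro divide_nonneg_nonneg mult_nonneg_nonneg)
      (auto simp: radial_cutoff_bounds soft_step_bounds less_imp_le)
  have b_eq: "b x = ?\<eta> x * c x * (1 / (?R x * (?L x)\<^sup>2))" for x by (simp add: b_def c_def)
  \<comment> \<open>All of the estimate is in this pointwise bound, whose right-hand side integrates
    to zero.\<close>
  have key: "p * ((v x)\<^sup>2 * b x) - C1 * (v x)\<^sup>2 - (1 + \<delta>)\<^sup>2 / p * (norm (g x))\<^sup>2
      \<le> (v x)\<^sup>2 * Dv x + 2 * (v x * (g x \<bullet> \<Phi> x))" for x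
  proof (cases "x \<in> \<Omega>")
    case False
    then show ?thesis using sob_off[OF sob False] by simp
  next
    case True
    have C1: "C1 \<ge> 0" using K by (simp add: C1_def)
    show ?thesis
    proof (cases "norm x < s")
      case False
      then have "?\<eta> x = 0" "\<And>h. ?\<eta>' x h = 0" using radial_cutoff_outside[of s x] s by auto
      moreover have "0 \<le> C1 * (v x)\<^sup>2" "0 \<le> (1 + \<delta>)\<^sup>2 / p * (norm (g x))\<^sup>2" using C1 p by auto
      ultimately show ?thesis by (simp add: b_eq Dv_eq \<Phi>_def)
    next
      case xs: True
      define \<Lambda> where "\<Lambda> = 1 / (?R x * (?L x)\<^sup>2)"
      have L: "?L x \<ge> 1" using L1 xs by simp
      have \<Lambda>: "\<Lambda> > 0" using Rpos[of x] L by (simp add: \<Lambda>_def)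
      have dx: "d x > 0" using in\<Omega>[of x] True xs s by simp
      have "?R x \<le> (2 * s)\<^sup>2"
        by (rule order_trans[OF R1]) (use xs in \<open>simp_all add: power_mult_distrib\<close>)
      then have "sqrt (?R x) \<le> 2 * s" using s by (intro real_le_lsqrt) auto
      then have "K * sqrt (?R x) \<le> K * (2 * s)" using K by (intro mult_left_mono)
      then have KR: "K * sqrt (?R x) \<le> \<delta>" using s(4) by simp
      have "norm x \<le> 2 * s" using xs s by simp
      then have "K * norm x \<le> K * (2 * s)" using K by (intro mult_left_mono)
      then have Kx: "K * norm x \<le> \<delta>" using s(4) by simp
      have Kx1: "K * norm x \<le> K" using K(1) xs s by (intro mult_left_le) auto
      note Gn = hardy_field_norm[OF \<epsilon>(1) L K KR]
      define k where "k = ?\<eta> x * c x"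
      have k: "0 \<le> k" "k \<le> 1"
        using radial_cutoff_bounds[of s x] c01[of x] by (auto simp: k_def mult_le_one)
      have 1: "k * (2 * p * \<Lambda>) \<le> ?\<eta> x * c x * (\<Sum>i\<in>UNIV. ?G' x (axis i 1) $ i)"
        using hardy_field_divergence[OF \<epsilon>(1) L K Kx] k
        unfolding k_def[symmetric] by (intro mult_left_mono) (auto simp: \<Lambda>_def p)
      \<comment> \<open>The derivative of d along the field is (d' x x + K R d' x e) / (L R). Since
        R >= |x|^2 and d' x e >= 0, the chart makes it nonnegative.\<close>
      have 2: "0 \<le> ?\<eta> x * c' x (?G x)"
      proof -
        have l: "linear (d' x)" using D has_derivative_linear by blast
        have "d' x (?G x) = (1 / ?L x) * ((1 / ?R x) * d' x x + K * d' x e)"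
          unfolding hardy_field_def using linear_add[OF l] linear_cmul[OF l] by simp
        also have "\<dots> = (d' x x + K * ?R x * d' x e) / (?L x * ?R x)"
          using L Rpos[of x] by (simp add: field_simps)
        also have "\<dots> \<ge> 0"
        proof (rule divide_nonneg_nonneg)
          have "K * (norm x)\<^sup>2 * d' x e \<le> K * ?R x * d' x e"
            using K inw[of x] dx xs s by (intro mult_right_mono mult_left_mono) (auto simp: reg_square_def)
          then show "0 \<le> d' x x + K * ?R x * d' x e" using inw[of x] dx xs s by simp
        qed (use L Rpos[of x] in auto)
        finally have "0 \<le> d' x (?G x)" .
        then show ?thesis
          by (simp add: c'_def soft_step_bounds radial_cutoff_bounds)
      qed
      \<comment> \<open>The radial cutoff has derivative at most 4 |x \<bullet> G| / s^2 along the
        field G, and |x| |G| <= 1 + K.\<close>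
      have 3: "- C1 \<le> c x * ?\<eta>' x (?G x)"
      proof -
        have t: "\<bar>max 0 (1 - (norm x)\<^sup>2 / s\<^sup>2)\<bar> \<le> 1" by simp
        have "\<bar>?\<eta>' x (?G x)\<bar> = 4 * \<bar>max 0 (1 - (norm x)\<^sup>2 / s\<^sup>2)\<bar> * \<bar>x \<bullet> ?G x\<bar> / s\<^sup>2"
          by (simp add: radial_cutoff'_def abs_mult)
        also have "\<dots> \<le> 4 * 1 * (1 + K) / s\<^sup>2"
        proof (intro divide_right_mono mult_mono t)
          show "\<bar>x \<bullet> ?G x\<bar> \<le> 1 + K"
            using Cauchy_Schwarz_ineq2[of x "?G x"] Gn(2) Kx1 by linarith
        qed (use K in auto)
        finally have "\<bar>?\<eta>' x (?G x)\<bar> \<le> C1" by (simp add: C1_def)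
        then have "\<bar>c x * ?\<eta>' x (?G x)\<bar> \<le> 1 * C1"
          unfolding abs_mult using c01[of x] by (intro mult_mono) auto
        then show ?thesis by simp
      qed
      have "k * (2 * p * \<Lambda>) - C1 \<le> Dv x" using 1 2 3 by (simp add: Dv_eq)
      then have D1: "(v x)\<^sup>2 * (k * (2 * p * \<Lambda>) - C1) \<le> (v x)\<^sup>2 * Dv x" by (intro mult_left_mono) auto
      define m q where "m = (norm (g x))\<^sup>2" and "q = (1 + \<delta>)\<^sup>2"
      have "(g x \<bullet> ?G x)\<^sup>2 \<le> (norm (g x) * norm (?G x))\<^sup>2"
        using Cauchy_Schwarz_ineq2[of "g x" "?G x"] by (metis abs_ge_zero power2_abs power_mono)
      also have "\<dots> \<le> m * (q * \<Lambda>)"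
        unfolding power_mult_distrib m_def using Gn(1) by (intro mult_left_mono) (auto simp: \<Lambda>_def q_def)
      finally have "- (p * \<Lambda> * (v x)\<^sup>2 + q * m / p) \<le> 2 * v x * (g x \<bullet> ?G x)"
        by (rule weighted_AM_GM[OF p(1) \<Lambda>])
      then have "k * - (p * \<Lambda> * (v x)\<^sup>2 + q * m / p) \<le> k * (2 * v x * (g x \<bullet> ?G x))"
        using k by (intro mult_left_mono)
      moreover have "k * (2 * v x * (g x \<bullet> ?G x)) = 2 * (v x * (g x \<bullet> \<Phi> x))"
        by (simp add: \<Phi>_def F_def k_def mult_ac)
      moreover have "k * (q * m / p) \<le> q * m / p"
        using k p by (intro mult_left_le_one_le) (auto simp: q_def m_def)
      moreover have "k * - (p * \<Lambda> * (v x)\<^sup>2 + q * m / p) = - (k * (p * \<Lambda> * (v x)\<^sup>2)) - k * (q * m / p)"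
        by (simp add: algebra_simps)
      ultimately have D2: "- (k * (p * \<Lambda> * (v x)\<^sup>2)) - q * m / p \<le> 2 * (v x * (g x \<bullet> \<Phi> x))"
        by linarith
      have "b x = k * \<Lambda>" by (simp add: b_eq k_def \<Lambda>_def)
      then show ?thesis using D1 D2 by (simp add: algebra_simps m_def q_def)
    qed
  qed
  have bm: "b \<in> borel_measurable borel"
  proof -
    have "?\<eta> \<in> borel_measurable borel" "c \<in> borel_measurable borel" "?R \<in> borel_measurable borel"
      using cc radial_cutoff_deriv[THEN has_derivative_continuous] reg_square_deriv[THEN has_derivative_continuous]
      by (auto intro!: borel_measurable_continuous_onI continuous_at_imp_continuous_on)
    moreover from this have "?L \<in> borel_measurable borel" unfolding reg_log_def[abs_def] by measurable
    ultimately show ?thesis unfolding b_eq[abs_def] by measurable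
  qed
  have bb: "\<bar>b x\<bar> \<le> 1 / \<epsilon>\<^sup>2" for x
  proof (cases "norm x < s")
    case True
    have "\<epsilon>\<^sup>2 * 1 \<le> ?R x * (?L x)\<^sup>2"
      using L1[of x] True Rpos[of x] by (intro mult_mono) (auto simp: reg_square_def one_le_power)
    then have "1 / (?R x * (?L x)\<^sup>2) \<le> 1 / \<epsilon>\<^sup>2"
      using \<epsilon> by (intro divide_left_mono) (auto intro!: mult_pos_pos Rpos)
    moreover have "?\<eta> x * c x \<le> 1"
      using radial_cutoff_bounds[of s x] c01[of x] by (auto simp: mult_le_one)
    ultimately have "?\<eta> x * c x * (1 / (?R x * (?L x)\<^sup>2)) \<le> 1 * (1 / \<epsilon>\<^sup>2)"
      using Rpos[of x] by (intro mult_mono) auto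
    then show ?thesis using b0[of x] by (simp add: b_eq)
  next
    case False
    then show ?thesis using radial_cutoff_outside[of s x] s by (simp add: b_eq)
  qed
  show vb: "integrable lborel (\<lambda>x. (v x)\<^sup>2 * b x)"
    using sob_square(1)[OF sob] bm bb by (intro bounded_measurable_square_integrable) auto
  have "(LINT x|lborel. p * ((v x)\<^sup>2 * b x) - C1 * (v x)\<^sup>2 - (1 + \<delta>)\<^sup>2 / p * (norm (g x))\<^sup>2)
      \<le> (LINT x|lborel. (v x)\<^sup>2 * Dv x + 2 * (v x * (g x \<bullet> \<Phi> x)))"
    by (rule integral_mono[OF _ _ key]) (use vb div sob_square[OF sob] in \<open>auto simp: Dv_def\<close>)
  also have "\<dots> = 0" using div by (simp add: Dv_def)
  finally show "(1 - \<delta>) / 2 * (LINT x|lborel. (v x)\<^sup>2 * b x) \<le>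
         (1 + \<delta>)\<^sup>2 / ((1 - \<delta>) / 2) * (LINT x|lborel. (norm (g x))\<^sup>2) + 4 * (1 + K) / s\<^sup>2 * (LINT x|lborel. (v x)\<^sup>2)"
    unfolding p_def[symmetric] C1_def[symmetric]
    using vb sob_square[OF sob] by (simp add: algebra_simps)
qed

lemma weight_measurable [measurable]: "weight a \<in> borel_measurable borel"
  unfolding weight_def[abs_def] by measurable

lemma weight_nonneg: "0 \<le> weight a x"
  by (simp add: weight_def)

lemma ln_quotient_ge:
  fixes a t :: real
  assumes "a > 1" "0 < t" "t < 1"
  shows "ln a \<le> ln (a / t)" "0 < ln (a / t)"
proof -
  have "a \<le> a / t" using assms mult_left_le[of t a] by (simp add: pos_le_divide_eq)
  then show "ln a \<le> ln (a / t)" using assms by simp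
  moreover have "ln a > 0" using assms by simp
  ultimately show "0 < ln (a / t)" by simp
qed

text \<open>The weight is split by the radial cutoff. Near the origin the regularised inequality
  holds with uniform constants and Fatou's lemma removes the regularisation; the rest of the weight
  is bounded on the unit ball and costs only a multiple of the L2 norm.\<close>

lemma hardy_inequality:
  assumes \<Omega>: "open \<Omega>" "\<Omega> \<subseteq> ball 0 1" "smooth_boundary \<Omega>" "0 \<in> closure \<Omega>" and a: "a > 1" and "\<kappa> > 4"
  obtains C where "C \<ge> 0"
    "\<And>v g. sob \<Omega> v g \<Longrightarrow> integrable lborel (\<lambda>x. (v x)\<^sup>2 * weight a x)"
    "\<And>v g. sob \<Omega> v g \<Longrightarrow> (LINT x|lborel. (v x)\<^sup>2 * weight a x) \<le>
        \<kappa> * (LINT x|lborel. (norm (g x))\<^sup>2) + C * (LINT x|lborel. (v x)\<^sup>2)"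
proof -
  obtain r K e d d' where chart: "inward_chart \<Omega> r K e d d'"
    using inward_chart_interior[OF \<Omega>(1)] inward_chart_boundary[OF \<Omega>(1,3,4)] by blast
  then have rK: "r > 0" "K \<ge> 0" and in\<Omega>: "\<And>x. norm x < r \<Longrightarrow> x \<in> \<Omega> \<longleftrightarrow> d x > 0"
    by (auto simp: inward_chart_def)
  define m where "m = sqrt \<kappa> / 2"
  have "sqrt \<kappa> > sqrt 4" using \<open>\<kappa> > 4\<close> by (simp only: real_sqrt_less_iff)
  then have m: "m > 1" by (simp add: m_def)
  \<comment> \<open>Chosen so that (1 + \<delta>) / (1 - \<delta>) = m. Then (1 + \<delta>)^2 / p^2
    = 4 m^2 = \<kappa>, exactly the constant to be reached.\<close>
  define \<delta> where "\<delta> = (m - 1) / (m + 1)"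
  have \<delta>: "0 < \<delta>" "\<delta> < 1" using m by (auto simp: \<delta>_def)
  define p where "p = (1 - \<delta>) / 2"
  have p: "p > 0" using \<delta> by (simp add: p_def)
  have "(1 + \<delta>) / p = 2 * m" using m by (simp add: p_def \<delta>_def divide_simps)
  then have "((1 + \<delta>) / p)\<^sup>2 = 4 * m\<^sup>2" by (simp add: power_mult_distrib)
  then have p\<kappa>: "(1 + \<delta>)\<^sup>2 / p\<^sup>2 = \<kappa>" using \<open>\<kappa> > 4\<close> by (simp add: m_def power_divide)
  define s where "s = Min {r / 2, 1 / 5, \<delta> / (2 * K + 1)}"
  have "s \<in> {r / 2, 1 / 5, \<delta> / (2 * K + 1)}" unfolding s_def by (rule Min_in) auto
  then have s0: "s > 0" using rK \<delta> by auto
  have s1: "s \<le> r / 2" "s \<le> 1 / 5" "s \<le> \<delta> / (2 * K + 1)" unfolding s_def by (intro Min_le; simp)+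
  have "s * (2 * K + 1) \<le> \<delta>" using s1(3) rK by (simp add: pos_le_divide_eq)
  then have s3: "2 * K * s \<le> \<delta>" using s0 by (simp add: algebra_simps)
  have sr: "s < r" using s1(1) rK by simp
  define C1 where "C1 = 4 * (1 + K) / s\<^sup>2"
  \<comment> \<open>From 1 - cutoff <= 2 |x|^2 / s^2 and ln(a / |x|) >= ln a inside the unit
    ball.\<close>
  define C2 where "C2 = 2 / (s\<^sup>2 * (ln a)\<^sup>2)"
  have C: "C1 \<ge> 0" "C2 \<ge> 0" using rK by (auto simp: C1_def C2_def)
  let ?\<eta> = "radial_cutoff s :: real^2 \<Rightarrow> real"
  have [measurable]: "?\<eta> \<in> borel_measurable borel"
    using radial_cutoff_deriv[THEN has_derivative_continuous]
    by (auto intro!: borel_measurable_continuous_onI continuous_at_imp_continuous_on)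
  have main: "integrable lborel (\<lambda>x. (v x)\<^sup>2 * weight a x) \<and> (LINT x|lborel. (v x)\<^sup>2 * weight a x) \<le>
        \<kappa> * (LINT x|lborel. (norm (g x))\<^sup>2) + (C1 / p + C2) * (LINT x|lborel. (v x)\<^sup>2)"
    if sob: "sob \<Omega> v g" for v g
  proof -
    note [measurable] = sob_measurable[OF sob]
    define G V where "G = (LINT x|lborel. (norm (g x))\<^sup>2)" and "V = (LINT x|lborel. (v x)\<^sup>2)"
    define \<epsilon> where "\<epsilon> n = s * inverse (real (Suc n))" for n
    have \<epsilon>: "0 < \<epsilon> n" "\<epsilon> n \<le> s" for n using s0 by (auto simp: \<epsilon>_def field_simps)
    have \<epsilon>0: "\<epsilon> \<longlonglongrightarrow> 0"
      using tendsto_mult[OF tendsto_const LIMSEQ_inverse_real_of_nat, of s] by (simp add: \<epsilon>_def[abs_def])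
    \<comment> \<open>A single index drives both limits: the boundary cutoff opens up while
      \<epsilon> tends to 0.\<close>
    define b where "b n x = ?\<eta> x * soft_step (real n * d x - 1) / (reg_square (\<epsilon> n) x * (reg_log a (\<epsilon> n) x)\<^sup>2)" for n x
    have reg: "integrable lborel (\<lambda>x. (v x)\<^sup>2 * b n x)" "0 \<le> b n x"
      "p * (LINT x|lborel. (v x)\<^sup>2 * b n x) \<le> (1 + \<delta>)\<^sup>2 / p * G + C1 * V" for n x
      unfolding b_def p_def C1_def G_def V_def
      by (rule hardy_regularised[OF sob \<Omega>(1) chart \<delta> s0 sr s1(2) s3 a \<epsilon>])+
    have bound: "(LINT x|lborel. (v x)\<^sup>2 * b n x) \<le> \<kappa> * G + (C1 / p) * V" for n
    proof -
      have "(LINT x|lborel. (v x)\<^sup>2 * b n x) \<le> ((1 + \<delta>)\<^sup>2 / p * G + C1 * V) / p"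
        using reg(3)[of n] p by (simp add: pos_le_divide_eq mult.commute)
      also have "\<dots> = (1 + \<delta>)\<^sup>2 / p\<^sup>2 * G + (C1 / p) * V"
        by (simp add: add_divide_distrib power2_eq_square)
      finally show ?thesis by (simp add: p\<kappa>)
    qed
    have lim: "AE x in lborel. (\<lambda>n. (v x)\<^sup>2 * b n x) \<longlonglongrightarrow> (v x)\<^sup>2 * (?\<eta> x * weight a x)"
    proof -
      have "AE x in lborel. x \<noteq> (0::real^2)" by (rule AE_lborel_singleton)
      then show ?thesis
      proof eventually_elim
        case (elim x)
        show ?case
        proof (cases "x \<in> \<Omega> \<and> norm x < s")
          case True
          then have dx: "d x > 0" using in\<Omega>[of x] sr by simp
          have nx: "0 < norm x" "norm x < 1" using elim True s1 by auto
          have R: "(\<lambda>n. reg_square (\<epsilon> n) x) \<longlonglongrightarrow> (norm x)\<^sup>2"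
            unfolding reg_square_def using tendsto_add[OF tendsto_const tendsto_power[OF \<epsilon>0, of 2], of "(norm x)\<^sup>2"] by simp
          have "(\<lambda>n. reg_log a (\<epsilon> n) x) \<longlonglongrightarrow> ln a - ln ((norm x)\<^sup>2) / 2"
            unfolding reg_log_def using nx by (intro tendsto_intros R) auto
          also have "ln a - ln ((norm x)\<^sup>2) / 2 = ln (a / norm x)"
            using nx a by (simp add: ln_div ln_realpow)
          finally have L: "(\<lambda>n. reg_log a (\<epsilon> n) x) \<longlonglongrightarrow> ln (a / norm x)" .
          have "ln (a / norm x) > 0" using ln_quotient_ge[OF a nx] by simp
          then have "(\<lambda>n. b n x) \<longlonglongrightarrow> ?\<eta> x * 1 / ((norm x)\<^sup>2 * (ln (a / norm x))\<^sup>2)"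
            unfolding b_def using nx
            by (intro tendsto_divide tendsto_mult tendsto_const soft_step_tendsto[OF dx] R tendsto_power L) auto
          then show ?thesis by (intro tendsto_mult tendsto_const) (simp add: weight_def)
        next
          case False
          then have "v x = 0 \<or> ?\<eta> x = 0" using sob_off[OF sob] radial_cutoff_outside[of s x] s0 by auto
          then show ?thesis by (auto simp: b_def)
        qed
      qed
    qed
    note F = Fatou_real[OF reg(1) _ bound _ lim]
    have int1: "integrable lborel (\<lambda>x. (v x)\<^sup>2 * (?\<eta> x * weight a x))"
      and le1: "(LINT x|lborel. (v x)\<^sup>2 * (?\<eta> x * weight a x)) \<le> \<kappa> * G + (C1 / p) * V"
      by (rule F; use reg(2) in simp)+
    \<comment> \<open>The remaining part of the weight. The indicator is there because for |x| near
      a the weight is unbounded; v vanishes outside the unit ball anyway.\<close>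
    define c where "c x = indicator (ball 0 1) x * ((1 - ?\<eta> x) * weight a x)" for x
    have cb: "0 \<le> c x" "c x \<le> C2" for x
    proof -
      show "0 \<le> c x" using radial_cutoff_bounds(2)[of s x] by (simp add: c_def weight_nonneg)
      show "c x \<le> C2"
      proof (cases "x = 0 \<or> norm x \<ge> 1")
        case True
        then show ?thesis using C by (auto simp: c_def weight_def)
      next
        case False
        then have nx: "0 < norm x" "norm x < 1" by auto
        have la: "0 < ln a" using a by simp
        have "(1 - ?\<eta> x) * weight a x \<le> (2 * (norm x)\<^sup>2 / s\<^sup>2) * weight a x"
          by (intro mult_right_mono one_minus_radial_cutoff weight_nonneg)
        also have "\<dots> = 2 / (s\<^sup>2 * (ln (a / norm x))\<^sup>2)" using nx by (simp add: weight_def)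
        also have "\<dots> \<le> C2" unfolding C2_def
          using ln_quotient_ge[OF a nx] la s0
          by (intro divide_left_mono mult_left_mono power_mono mult_pos_pos) auto
        finally show ?thesis using nx by (simp add: c_def)
      qed
    qed
    have [measurable]: "ball (0::real^2) 1 \<in> sets borel" by simp
    have cm[measurable]: "c \<in> borel_measurable borel" unfolding c_def[abs_def] by measurable
    have int2: "integrable lborel (\<lambda>x. (v x)\<^sup>2 * c x)"
      using sob_square(1)[OF sob] cb by (intro bounded_measurable_square_integrable[where B = C2]) auto
    have "(LINT x|lborel. (v x)\<^sup>2 * c x) \<le> (LINT x|lborel. C2 * (v x)\<^sup>2)"
      using int2 sob_square(1)[OF sob] mult_left_mono[OF cb(2), of "(v _)\<^sup>2"]
      by (intro integral_mono) (auto simp: mult.commute)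
    then have le2: "(LINT x|lborel. (v x)\<^sup>2 * c x) \<le> C2 * V" by (simp add: V_def)
    have eq: "(v x)\<^sup>2 * weight a x = (v x)\<^sup>2 * (?\<eta> x * weight a x) + (v x)\<^sup>2 * c x" for x
    proof (cases "x \<in> \<Omega>")
      case True
      then have "x \<in> ball 0 1" using \<Omega>(2) by blast
      then show ?thesis by (simp add: c_def algebra_simps)
    qed (use sob_off[OF sob] in simp)
    show ?thesis
      unfolding eq G_def[symmetric] V_def[symmetric] using int1 int2 le1 le2 by (simp add: algebra_simps)
  qed
  show ?thesis
    by (rule that[of "C1 / p + C2"]) (use main C p in auto)
qed

section \<open>Completeness of square integrable functions\<close>

lemma square_integrable_diff:
  fixes f g :: "'a \<Rightarrow> 'b::euclidean_space"
  assumes "f \<in> borel_measurable M" "g \<in> borel_measurable M"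
    and "integrable M (\<lambda>x. (norm (f x))\<^sup>2)" "integrable M (\<lambda>x. (norm (g x))\<^sup>2)"
  shows "integrable M (\<lambda>x. (norm (f x - g x))\<^sup>2)"
  using square_integrable_add[of f M "\<lambda>x. - g x"] assms by simp

lemma AE_summable_of_integrals:
  fixes f :: "nat \<Rightarrow> 'a \<Rightarrow> real"
  assumes int: "\<And>n. integrable M (f n)" and nonneg: "\<And>n x. 0 \<le> f n x"
    and s: "summable c" "\<And>n. integral\<^sup>L M (f n) \<le> c n"
  shows "AE x in M. summable (\<lambda>n. f n x)"
proof -
  have [measurable]: "f n \<in> borel_measurable M" for n using int by auto
  have I: "(\<integral>\<^sup>+ x. ennreal (f n x) \<partial>M) \<le> ennreal (c n)" for n
    using nn_integral_eq_integral[OF int[of n]] nonneg s(2) by (simp add: ennreal_leI)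
  have c0: "c n \<ge> 0" for n
    using s(2)[of n] Bochner_Integration.integral_nonneg[of M "f n"] nonneg by (meson order_trans)
  have "(\<integral>\<^sup>+ x. (\<Sum>n. ennreal (f n x)) \<partial>M) = (\<Sum>n. \<integral>\<^sup>+ x. ennreal (f n x) \<partial>M)"
    by (rule nn_integral_suminf) measurable
  also have "\<dots> \<le> (\<Sum>n. ennreal (c n))" by (intro suminf_le I) auto
  also have "\<dots> = ennreal (suminf c)" using c0 s(1) by (intro suminf_ennreal2) auto
  finally have "(\<integral>\<^sup>+ x. (\<Sum>n. ennreal (f n x)) \<partial>M) \<noteq> \<infinity>"
    using ennreal_less_top le_less_trans infinity_ennreal_def by (metis less_irrefl)
  then have "AE x in M. (\<Sum>n. ennreal (f n x)) \<noteq> \<infinity>"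
    by (intro nn_integral_PInf_AE) auto
  then show ?thesis
    by eventually_elim (rule summable_suminf_not_top, use nonneg in auto)
qed

text \<open>The Riesz-Fischer argument without the L2 norm as a norm: along a fast subsequence the
  increments D j satisfy that the sum of 2^j (D j)^2 has finite integral, which gives pointwise
  convergence almost everywhere. Fatou's lemma then yields convergence in mean of the whole
  sequence.\<close>

lemma square_integrable_complete:
  fixes f :: "nat \<Rightarrow> 'a \<Rightarrow> 'b::euclidean_space"
  assumes [measurable]: "\<And>n. f n \<in> borel_measurable M"
    and int: "\<And>n. integrable M (\<lambda>x. (norm (f n x))\<^sup>2)"
    and Cauchy: "\<And>e. e > 0 \<Longrightarrow> \<exists>N. \<forall>m\<ge>N. \<forall>n\<ge>N. (LINT x|M. (norm (f m x - f n x))\<^sup>2) < e"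
  obtains F where "F \<in> borel_measurable M" "integrable M (\<lambda>x. (norm (F x))\<^sup>2)"
    "(\<lambda>n. LINT x|M. (norm (f n x - F x))\<^sup>2) \<longlonglongrightarrow> 0"
proof -
  have intd: "integrable M (\<lambda>x. (norm (f m x - f n x))\<^sup>2)" for m n
    by (intro square_integrable_diff int) measurable
  have "\<forall>j. \<exists>N. \<forall>m\<ge>N. \<forall>n\<ge>N. (LINT x|M. (norm (f m x - f n x))\<^sup>2) < (1 / 4) ^ j"
    by (intro allI Cauchy) simp
  then obtain N where N: "\<And>j m n. m \<ge> N j \<Longrightarrow> n \<ge> N j \<Longrightarrow> (LINT x|M. (norm (f m x - f n x))\<^sup>2) < (1 / 4) ^ j"
    by metis
  \<comment> \<open>Partial sums are increasing and dominate each N j; the summand j makes k j at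
    least j.\<close>
  define k where "k j = (\<Sum>i\<le>j. N i) + j" for j
  have k1: "k j \<le> k (Suc j)" for j by (simp add: k_def)
  have k2: "N j \<le> k j" for j by (simp add: k_def member_le_sum trans_le_add1)
  have k3: "j \<le> k j" for j by (simp add: k_def)
  define D where "D j x = norm (f (k (Suc j)) x - f (k j) x)" for j x
  have "AE x in M. summable (\<lambda>j. 2 ^ j * (D j x)\<^sup>2)"
  proof (rule AE_summable_of_integrals)
    show "summable (\<lambda>j. (1 / 2 :: real) ^ j)" by (rule summable_geometric) simp
    show "integrable M (\<lambda>x. 2 ^ j * (D j x)\<^sup>2)" for j
      unfolding D_def using intd by simp
    show "(LINT x|M. 2 ^ j * (D j x)\<^sup>2) \<le> (1 / 2) ^ j" for j
    proof -
      have "(LINT x|M. (D j x)\<^sup>2) \<le> (1 / 4) ^ j"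
        unfolding D_def using k1[of j] k2[of j] by (intro less_imp_le[OF N]) auto
      then have "2 ^ j * (LINT x|M. (D j x)\<^sup>2) \<le> 2 ^ j * (1 / 4) ^ j" by (intro mult_left_mono) auto
      also have "\<dots> = (1 / 2) ^ j" by (simp add: power_mult_distrib[symmetric])
      finally show ?thesis by simp
    qed
  qed auto
  then have conv: "AE x in M. convergent (\<lambda>j. f (k j) x)"
  proof eventually_elim
    case (elim x)
    have "summable (\<lambda>j. (1 / 2) ^ j + 2 ^ j * (D j x)\<^sup>2)"
      by (intro summable_add summable_geometric elim) simp
    then have "summable (\<lambda>j. f (k (Suc j)) x - f (k j) x)"
    proof (rule summable_comparison_test'[where N = 0])
      fix j :: nat
      \<comment> \<open>Splitting D j against (1/2)^j bounds it by (1/2)^j + 2^j (D j)^2, both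
        summable.\<close>
      have "D j x = 2 ^ j * (D j x * (1 / 2) ^ j)" by (simp add: power_divide)
      also have "\<dots> \<le> 2 ^ j * ((D j x)\<^sup>2 + ((1 / 2) ^ j)\<^sup>2)"
        using abs_mult_le_squares'[of "D j x" "(1 / 2) ^ j"] by (intro mult_left_mono) auto
      also have "\<dots> = (1 / 2) ^ j + 2 ^ j * (D j x)\<^sup>2"
        by (simp add: power_divide power2_eq_square distrib_left)
      finally show "norm (f (k (Suc j)) x - f (k j) x) \<le> (1 / 2) ^ j + 2 ^ j * (D j x)\<^sup>2"
        by (simp add: D_def)
    qed
    then have "(\<lambda>n. (\<Sum>j<n. f (k (Suc j)) x - f (k j) x) + f (k 0) x) \<longlonglongrightarrow>
        (\<Sum>j. f (k (Suc j)) x - f (k j) x) + f (k 0) x"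
      by (intro tendsto_add tendsto_const summable_LIMSEQ)
    moreover have "(\<Sum>j<n. f (k (Suc j)) x - f (k j) x) = f (k n) x - f (k 0) x" for n
      by (rule sum_lessThan_telescope)
    ultimately show ?case by (auto simp: convergent_def)
  qed
  define F where "F x = lim (\<lambda>j. f (k j) x)" for x
  have [measurable]: "F \<in> borel_measurable M" unfolding F_def[abs_def] by measurable
  have lim: "AE x in M. (\<lambda>j. f (k j) x) \<longlonglongrightarrow> F x"
    using conv by eventually_elim (simp add: F_def convergent_LIMSEQ_iff)
  have est: "integrable M (\<lambda>x. (norm (f n x - F x))\<^sup>2) \<and> (LINT x|M. (norm (f n x - F x))\<^sup>2) \<le> e"
    if N0: "\<forall>m\<ge>N0. \<forall>n\<ge>N0. (LINT x|M. (norm (f m x - f n x))\<^sup>2) < e" and n: "n \<ge> N0" for n N0 e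
  proof -
    have 1: "(LINT x|M. (norm (f n x - f (k (j + N0)) x))\<^sup>2) \<le> e" for j
      using N0 n k3[of "j + N0"] by (intro less_imp_le) auto
    have 2: "AE x in M. (\<lambda>j. (norm (f n x - f (k (j + N0)) x))\<^sup>2) \<longlonglongrightarrow> (norm (f n x - F x))\<^sup>2"
      using lim
    proof eventually_elim
      case (elim x)
      show ?case by (intro tendsto_intros LIMSEQ_ignore_initial_segment[OF elim])
    qed
    show ?thesis
      using Fatou_real[where f = "\<lambda>j x. (norm (f n x - f (k (j + N0)) x))\<^sup>2", OF intd _ 1 _ 2] by auto
  qed
  obtain N1 where "\<forall>m\<ge>N1. \<forall>n\<ge>N1. (LINT x|M. (norm (f m x - f n x))\<^sup>2) < 1" using Cauchy[of 1] by auto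
  then have i1: "integrable M (\<lambda>x. (norm (f N1 x - F x))\<^sup>2)" using est by blast
  have "integrable M (\<lambda>x. (norm (f N1 x - (f N1 x - F x)))\<^sup>2)"
    by (intro square_integrable_diff int i1) measurable
  then have F2: "integrable M (\<lambda>x. (norm (F x))\<^sup>2)" by simp
  have "(\<lambda>n. LINT x|M. (norm (f n x - F x))\<^sup>2) \<longlonglongrightarrow> 0"
  proof (rule LIMSEQ_I)
    fix e :: real assume "e > 0"
    then obtain N0 where "\<forall>m\<ge>N0. \<forall>n\<ge>N0. (LINT x|M. (norm (f m x - f n x))\<^sup>2) < e / 2"
      using Cauchy[of "e / 2"] by auto
    then have "\<forall>n\<ge>N0. (LINT x|M. (norm (f n x - F x))\<^sup>2) \<le> e / 2" using est by blast
    then show "\<exists>no. \<forall>n\<ge>no. norm ((LINT x|M. (norm (f n x - F x))\<^sup>2) - 0) < e"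
      using \<open>e > 0\<close> by (intro exI[of _ N0]) (auto intro: le_less_trans)
  qed
  then show ?thesis by (intro that[of F] F2) auto
qed

section \<open>The space of Sobolev pairs\<close>

lemma sob_lincomb:
  assumes v: "sob \<Omega> v g" and w: "sob \<Omega> w h"
  shows "sob \<Omega> (\<lambda>x. \<alpha> * v x + \<beta> * w x) (\<lambda>x. \<alpha> *\<^sub>R g x + \<beta> *\<^sub>R h x)"
proof -
  note [measurable] = sob_measurable[OF v] sob_measurable[OF w]
  have "integrable lborel (\<lambda>x. (norm (\<alpha> * v x + \<beta> * w x))\<^sup>2)"
    using sob_square(1)[OF v] sob_square(1)[OF w] by (intro square_integrable_add) (auto simp: power_mult_distrib)
  moreover have "integrable lborel (\<lambda>x. (norm (\<alpha> *\<^sub>R g x + \<beta> *\<^sub>R h x))\<^sup>2)"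
    using sob_square(2)[OF v] sob_square(2)[OF w] by (intro square_integrable_add) (auto simp: power_mult_distrib)
  moreover have "(LINT x|lborel. (\<alpha> * v x + \<beta> * w x) * dir_deriv (axis i 1) \<phi> x) =
      - (LINT x|lborel. (\<alpha> *\<^sub>R g x + \<beta> *\<^sub>R h x) $ i * \<phi> x)" if \<phi>: "\<phi> \<in> test_functions \<Omega>" for \<phi> i
  proof -
    note [measurable] = test_function_measurable[OF \<phi>]
    note \<phi>2 = test_function_square_integrable[OF \<phi>]
    have comp: "integrable lborel (\<lambda>x. (g x $ i)\<^sup>2)" "integrable lborel (\<lambda>x. (h x $ i)\<^sup>2)"
      using sob_gradient_component(1)[OF v, of "axis i 1"] sob_gradient_component(1)[OF w, of "axis i 1"]
      by (simp_all add: inner_axis)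
    have "integrable lborel (\<lambda>x. v x * dir_deriv (axis i 1) \<phi> x)" "integrable lborel (\<lambda>x. w x * dir_deriv (axis i 1) \<phi> x)"
      "integrable lborel (\<lambda>x. g x $ i * \<phi> x)" "integrable lborel (\<lambda>x. h x $ i * \<phi> x)"
      by (intro square_integrable_mult \<phi>2 comp sob_square[OF v] sob_square[OF w]; measurable)+
    then show ?thesis
      using sob_weak[OF v \<phi>, of i] sob_weak[OF w \<phi>, of i] by (simp add: distrib_right mult.assoc)
  qed
  ultimately show ?thesis
    using sob_off[OF v] sob_off[OF w] unfolding sob_def by simp
qed

lemma sob_diff: "sob \<Omega> v g \<Longrightarrow> sob \<Omega> w h \<Longrightarrow> sob \<Omega> (\<lambda>x. v x - w x) (\<lambda>x. g x - h x)"
  using sob_lincomb[of \<Omega> v g w h 1 "-1"] by simp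

section \<open>The cone condition\<close>

text \<open>At a boundary point \<Omega> lies above a Lipschitz graph, so moving in a direction
  close enough to vertical never leaves it. The same cone works for all points of \<Omega> near p,
  however close to the boundary they are.\<close>

lemma cone_condition:
  assumes "open \<Omega>" "smooth_boundary \<Omega>" "p \<in> closure \<Omega>"
  obtains r \<rho> e where "r > 0" "\<rho> > 0"
    "\<And>x q t. x \<in> \<Omega> \<Longrightarrow> x \<in> ball p r \<Longrightarrow> q \<in> ball e \<rho> \<Longrightarrow> 0 \<le> t \<Longrightarrow> t \<le> r \<Longrightarrow> x + t *\<^sub>R q \<in> \<Omega>"
proof (cases "p \<in> \<Omega>")
  case True
  obtain R where R: "R > 0" "ball p R \<subseteq> \<Omega>" using openE[OF assms(1) True] by blast
  have "x + t *\<^sub>R q \<in> \<Omega>" if "x \<in> ball p (R / 2)" "q \<in> ball 0 1" "0 \<le> t" "t \<le> R / 2" for x q t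
  proof -
    have "dist p (x + t *\<^sub>R q) \<le> dist p x + norm (t *\<^sub>R q)"
      by (metis add_diff_cancel_left' dist_norm dist_triangle norm_minus_commute)
    also have "norm (t *\<^sub>R q) \<le> t" using that by (simp add: mult_left_le)
    finally show ?thesis using that R by auto
  qed
  then show ?thesis using that[of "R / 2" 1 0] R by auto
next
  case False
  then have "p \<in> frontier \<Omega>" using assms by (simp add: frontier_def interior_open)
  then obtain R e1 e2 \<gamma> where R: "R > 0" and e: "norm e1 = 1" "norm e2 = 1" "e1 \<bullet> e2 = 0"
    and sm: "smooth_fun (\<gamma> :: real \<Rightarrow> real)"
    and loc: "\<Omega> \<inter> ball p R = {x \<in> ball p R. \<gamma> (x \<bullet> e1) < x \<bullet> e2}"
    using assms(2) unfolding smooth_boundary_def by blast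
  have in\<Omega>: "x \<in> \<Omega> \<longleftrightarrow> \<gamma> (x \<bullet> e1) < x \<bullet> e2" if "x \<in> ball p R" for x
  proof -
    have "x \<in> \<Omega> \<inter> ball p R \<longleftrightarrow> \<gamma> (x \<bullet> e1) < x \<bullet> e2" unfolding loc using that by simp
    then show ?thesis using that by simp
  qed
  obtain \<Lambda> where \<Lambda>: "\<Lambda> \<ge> 0"
    "\<And>s t. \<bar>s\<bar> \<le> norm p + R \<Longrightarrow> \<bar>t\<bar> \<le> norm p + R \<Longrightarrow> \<bar>\<gamma> s - \<gamma> t\<bar> \<le> \<Lambda> * \<bar>s - t\<bar>"
    using smooth_fun_real_Lipschitz[OF sm, of "norm p + R"] by metis
  \<comment> \<open>A direction within \<rho> of e2 rises by at least 1 - \<rho> and drifts sideways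
    by at most \<rho>, so \<Lambda> \<rho> <= 1 - \<rho> is needed. The choice \<Lambda> + 2 instead
    of \<Lambda> + 1 also gives \<rho> <= 1/2 and thereby |q| <= 2.\<close>
  define \<rho> where "\<rho> = 1 / (\<Lambda> + 2)"
  have \<rho>: "\<rho> > 0" "\<rho> \<le> 1 / 2" "(\<Lambda> + 2) * \<rho> = 1" using \<Lambda>(1) by (auto simp: \<rho>_def divide_simps)
  have b1: "\<bar>x \<bullet> e1\<bar> \<le> norm p + R" if "x \<in> ball p R" for x
  proof -
    have "\<bar>x \<bullet> e1\<bar> \<le> norm x" using Cauchy_Schwarz_ineq2[of x e1] e by simp
    also have "\<dots> \<le> norm p + dist p x" by (metis dist_commute dist_norm norm_triangle_sub)
    finally show ?thesis using that by simp
  qed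
  have "x + t *\<^sub>R q \<in> \<Omega>"
    if x: "x \<in> \<Omega>" "x \<in> ball p (R / 4)" and q: "q \<in> ball e2 \<rho>" and t: "0 \<le> t" "t \<le> R / 4" for x q t
  proof (cases "t = 0")
    case False
    then have t0: "t > 0" using t by simp
    have qe: "norm (q - e2) < \<rho>" using q by (simp add: dist_norm norm_minus_commute)
    have "norm q \<le> norm (q - e2) + norm e2" by (metis diff_add_cancel norm_triangle_ineq)
    then have "norm q \<le> 2" using qe e \<rho> by simp
    then have "norm (t *\<^sub>R q) \<le> R / 4 * 2" using t unfolding norm_scaleR by (intro mult_mono) auto
    moreover have "dist p (x + t *\<^sub>R q) \<le> dist p x + norm (t *\<^sub>R q)"
      by (metis add_diff_cancel_left' dist_norm dist_triangle norm_minus_commute)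
    ultimately have xb: "x + t *\<^sub>R q \<in> ball p R" "x \<in> ball p R" using x R by auto
    have q2: "q \<bullet> e2 > 1 - \<rho>"
    proof -
      have "\<bar>(q - e2) \<bullet> e2\<bar> < \<rho>" using Cauchy_Schwarz_ineq2[of "q - e2" e2] e qe by simp
      moreover have "(q - e2) \<bullet> e2 = q \<bullet> e2 - 1" using e by (simp add: inner_diff_left flip: power2_norm_eq_inner)
      ultimately show ?thesis by simp
    qed
    have q1: "\<bar>q \<bullet> e1\<bar> < \<rho>"
    proof -
      have "\<bar>(q - e2) \<bullet> e1\<bar> < \<rho>" using Cauchy_Schwarz_ineq2[of "q - e2" e1] e qe by simp
      then show ?thesis using e(3) by (simp add: inner_diff_left inner_commute[of e2 e1])
    qed
    have "\<bar>\<gamma> ((x + t *\<^sub>R q) \<bullet> e1) - \<gamma> (x \<bullet> e1)\<bar> \<le> \<Lambda> * \<bar>(x + t *\<^sub>R q) \<bullet> e1 - x \<bullet> e1\<bar>"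
      by (intro \<Lambda>(2) b1 xb)
    also have "\<dots> = \<Lambda> * (t * \<bar>q \<bullet> e1\<bar>)" using t by (simp add: inner_add_left abs_mult)
    also have "\<dots> \<le> \<Lambda> * (t * \<rho>)" using \<Lambda>(1) t q1 by (intro mult_left_mono) auto
    finally have "\<gamma> ((x + t *\<^sub>R q) \<bullet> e1) \<le> \<gamma> (x \<bullet> e1) + \<Lambda> * (t * \<rho>)" by simp
    also have "\<dots> < x \<bullet> e2 + t * (1 - \<rho>)"
    proof -
      have "\<Lambda> * \<rho> \<le> 1 - \<rho>" using \<rho> by (simp add: algebra_simps)
      then have "t * (\<Lambda> * \<rho>) \<le> t * (1 - \<rho>)" using t by (intro mult_left_mono)
      then show ?thesis using in\<Omega>[OF xb(2)] x(1) by (simp add: mult.left_commute)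
    qed
    also have "\<dots> \<le> (x + t *\<^sub>R q) \<bullet> e2"
      using q2 t by (simp add: inner_add_left mult_left_mono)
    finally show ?thesis using in\<Omega>[OF xb(1)] by simp
  qed (use x in simp)
  then show ?thesis using that[of "R / 4" \<rho> e2] R \<rho> by auto
qed

section \<open>Rellich compactness\<close>

lemma integral_on_set_bound:
  fixes v :: "'a::euclidean_space \<Rightarrow> real"
  assumes v: "v \<in> borel_measurable borel" "integrable lborel (\<lambda>x. (v x)\<^sup>2)" "(LINT x|lborel. (v x)\<^sup>2) \<le> M"
    and A: "A \<in> sets borel" "bounded A"
  shows "\<bar>LINT x|lborel. indicator A x * v x\<bar> \<le> sqrt (measure lborel A * M)"
    and "integrable lborel (\<lambda>x. indicator A x * v x)"
proof -
  have A2: "integrable lborel (\<lambda>x. (indicat_real A x)\<^sup>2)"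
    using integrable_indicator_bounded[OF A(2,1)] by (simp add: indicator_power2)
  have "(LINT x|lborel. indicator A x * v x)\<^sup>2 \<le> (LINT x|lborel. (indicat_real A x)\<^sup>2) * (LINT x|lborel. (v x)\<^sup>2)"
    by (rule Cauchy_Schwarz_integral) (use v A A2 in auto)
  also have "(LINT x|lborel. (indicat_real A x)\<^sup>2) = measure lborel A"
    by (simp add: indicator_power2)
  also have "measure lborel A * (LINT x|lborel. (v x)\<^sup>2) \<le> measure lborel A * M"
    using v(3) by (intro mult_left_mono) auto
  finally show "\<bar>LINT x|lborel. indicator A x * v x\<bar> \<le> sqrt (measure lborel A * M)"
    by (metis real_sqrt_abs real_sqrt_le_mono)
  show "integrable lborel (\<lambda>x. indicator A x * v x)"
    by (rule square_integrable_mult) (use v A A2 in auto)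
qed

text \<open>Reduces arbitrary balls to a countable family: the area of a ball depends continuously
  on its radius, so a slightly larger ball with centre in D and rational radius has small excess
  area.\<close>

lemma ball_approximation:
  fixes c :: "real^2"
  assumes D: "\<And>X. open X \<Longrightarrow> X \<noteq> {} \<Longrightarrow> \<exists>d\<in>D. d \<in> X" and t: "t > 0" and \<epsilon>: "\<epsilon> > 0"
  obtains c' t' where "c' \<in> D" "t' \<in> \<rat>" "t' > 0" "ball c t \<subseteq> ball c' t'"
    "measure lborel (ball c' t' - ball c t) \<le> \<epsilon>"
proof -
  have "isCont (\<lambda>x. x\<^sup>2 * pi) t" by (intro continuous_intros)
  then obtain \<eta> where \<eta>: "\<eta> > 0" "\<And>x. dist x t < \<eta> \<Longrightarrow> dist (x\<^sup>2 * pi) (t\<^sup>2 * pi) < \<epsilon>"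
    using \<epsilon> unfolding continuous_at_eps_delta by (metis dist_commute dist_real_def real_norm_def)
  obtain c' where c': "c' \<in> D" "dist c c' < \<eta> / 2"
    using D[of "ball c (\<eta> / 2)"] \<eta>(1) by auto
  obtain t' where t': "t' \<in> \<rat>" "t + \<eta> / 2 < t'" "t' < t + \<eta>"
    using Rats_dense_in_real[of "t + \<eta> / 2" "t + \<eta>"] \<eta>(1) by auto
  have sub: "ball c t \<subseteq> ball c' t'"
  proof
    fix x assume "x \<in> ball c t"
    then have "dist c x < t" by simp
    moreover have "dist c' x \<le> dist c c' + dist c x" by (metis dist_commute dist_triangle)
    ultimately show "x \<in> ball c' t'" using c' t' by simp
  qed
  have "measure lborel (ball c' t' - ball c t) = measure lborel (ball c' t') - measure lborel (ball c t)"
    by (rule measure_Diff) (use sub emeasure_bounded_finite[of "ball c' t'"] in \<open>auto simp: less_top[symmetric]\<close>)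
  also have "\<dots> = t'\<^sup>2 * pi - t\<^sup>2 * pi" using t t' \<eta>(1) by (simp add: circle_area)
  also have "\<dots> \<le> \<epsilon>" using \<eta>(2)[of t'] t' \<eta>(1) by (simp add: dist_real_def)
  finally show ?thesis using that[of c' t'] c' t' sub t \<eta>(1) by auto
qed

text \<open>A substitute for weak compactness of bounded sets in L2, tested only on indicators of
  balls. A diagonal argument treats countably many balls; for any other ball the error is at most
  sqrt(excess area * M), uniformly in n.\<close>

lemma convergent_ball_integrals:
  fixes v :: "nat \<Rightarrow> real^2 \<Rightarrow> real"
  assumes v: "\<And>n. v n \<in> borel_measurable borel" "\<And>n. integrable lborel (\<lambda>x. (v n x)\<^sup>2)"
    "\<And>n. (LINT x|lborel. (v n x)\<^sup>2) \<le> M"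
  obtains k :: "nat \<Rightarrow> nat" where "strict_mono k"
    "\<And>c t. t > 0 \<Longrightarrow> convergent (\<lambda>n. LINT x|lborel. indicator (ball c t) x * v (k n) x)"
proof -
  have "0 \<le> (LINT x|lborel. (v 0 x)\<^sup>2)" by simp
  then have M: "M \<ge> 0" using v(3)[of 0] by linarith
  obtain D :: "(real^2) set" where D: "countable D" "\<And>X. open X \<Longrightarrow> X \<noteq> {} \<Longrightarrow> \<exists>d\<in>D. d \<in> X"
    using countable_dense_exists by blast
  define I where "I n c t = (LINT x|lborel. indicator (ball c t) x * v n x)" for n c t
  define S where "S = D \<times> (\<rat> \<inter> {0::real<..})"
  \<comment> \<open>Division by the radius t gives one bound for all balls, because sqrt(area * M) =
    t sqrt(\<pi> M), as the diagonal argument requires.\<close>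
  define f where "f n ct = I n (fst ct) (snd ct) / snd ct" for n ct
  have cS: "countable S"
    unfolding S_def using D(1) countable_rat by (intro countable_SIGMA) (auto intro: countable_Int1)
  have fM: "norm (f n ct) \<le> sqrt (pi * M)" if ctS: "ct \<in> S" for n ct
  proof -
    obtain c t where ct: "ct = (c, t)" "t > 0" using ctS by (auto simp: S_def)
    have "\<bar>I n c t\<bar> \<le> sqrt (measure lborel (ball c t) * M)"
      unfolding I_def by (rule integral_on_set_bound[OF v]) auto
    also have "\<dots> = t * sqrt (pi * M)"
      using ct by (simp add: circle_area real_sqrt_mult)
    finally show ?thesis using ct by (simp add: f_def divide_le_eq mult.commute)
  qed
  obtain k where k: "strict_mono (k::nat\<Rightarrow>nat)" "\<And>ct. ct \<in> S \<Longrightarrow> \<exists>l. (\<lambda>n. f (k n) ct) \<longlonglongrightarrow> l"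
    using function_convergent_subsequence[of S f "sqrt (pi * M)", OF cS fM] by metis
  have kS: "Cauchy (\<lambda>n. I (k n) c t)" if "c \<in> D" "t \<in> \<rat>" "t > 0" for c t
  proof -
    have "(c, t) \<in> S" using that by (simp add: S_def)
    then obtain l where "(\<lambda>n. I (k n) c t / t) \<longlonglongrightarrow> l" using k(2)[of "(c, t)"] by (auto simp: f_def)
    then have "(\<lambda>n. I (k n) c t / t * t) \<longlonglongrightarrow> l * t" by (intro tendsto_intros)
    then show ?thesis using that by (intro LIMSEQ_imp_Cauchy) simp
  qed
  have "Cauchy (\<lambda>n. I (k n) c t)" if t: "t > 0" for c t
  proof (rule metric_CauchyI)
    fix e :: real assume e: "e > 0"
    \<comment> \<open>Makes sqrt(\<epsilon> M) <= e / 4; the summand 1 covers M = 0.\<close>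
    define \<epsilon> where "\<epsilon> = (e / 4)\<^sup>2 / (M + 1)"
    have \<epsilon>: "\<epsilon> > 0" using e M by (simp add: \<epsilon>_def)
    obtain c' t' where ct: "c' \<in> D" "t' \<in> \<rat>" "t' > 0" "ball c t \<subseteq> ball c' t'"
      "measure lborel (ball c' t' - ball c t) \<le> \<epsilon>"
      using ball_approximation[OF D(2) t \<epsilon>] by metis
    have dif: "\<bar>I n c' t' - I n c t\<bar> \<le> e / 4" for n
    proof -
      have "I n c' t' - I n c t = (LINT x|lborel. indicator (ball c' t') x * v n x - indicator (ball c t) x * v n x)"
        unfolding I_def by (rule Bochner_Integration.integral_diff[symmetric]; rule integral_on_set_bound(2)[OF v]; simp)
      also have "\<dots> = (LINT x|lborel. indicator (ball c' t' - ball c t) x * v n x)"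
        by (rule Bochner_Integration.integral_cong) (use ct(4) in \<open>auto simp: indicator_def\<close>)
      finally have "\<bar>I n c' t' - I n c t\<bar> \<le> sqrt (measure lborel (ball c' t' - ball c t) * M)"
        using integral_on_set_bound(1)[OF v, of "ball c' t' - ball c t"] by (simp add: bounded_diff)
      also have "\<dots> \<le> sqrt ((e / 4)\<^sup>2)"
      proof (rule real_sqrt_le_mono)
        have "measure lborel (ball c' t' - ball c t) * M \<le> \<epsilon> * (M + 1)"
          using ct(5) M \<epsilon> by (intro mult_mono) auto
        then show "measure lborel (ball c' t' - ball c t) * M \<le> (e / 4)\<^sup>2" using M by (simp add: \<epsilon>_def)
      qed
      finally show ?thesis using e by simp
    qed
    obtain N where N: "\<forall>m\<ge>N. \<forall>n\<ge>N. dist (I (k m) c' t') (I (k n) c' t') < e / 4"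
      using metric_CauchyD[OF kS[OF ct(1-3)], of "e / 4"] e by auto
    have "dist (I (k m) c t) (I (k n) c t) < e" if "m \<ge> N" "n \<ge> N" for m n
    proof -
      have "\<bar>I (k m) c' t' - I (k n) c' t'\<bar> < e / 4" using N that by (simp add: dist_real_def)
      then show ?thesis using dif[of "k m"] dif[of "k n"] e unfolding dist_real_def by linarith
    qed
    then show "\<exists>N. \<forall>m\<ge>N. \<forall>n\<ge>N. dist (I (k m) c t) (I (k n) c t) < e" by blast
  qed
  then show ?thesis using that[OF k(1)] by (simp add: I_def Cauchy_convergent)
qed

text \<open>B is a set of displacements, not a neighbourhood of x. It will be a ball inside the
  cone, away from its vertex, so that x + B stays in \<Omega> for x close to the boundary.\<close>

definition ball_average :: "(real^2) set \<Rightarrow> (real^2 \<Rightarrow> real) \<Rightarrow> real^2 \<Rightarrow> real" where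
  "ball_average B v x = (LINT z|lborel. indicator B z * v (x + z)) / measure lborel B"

lemma ball_average_measurable:
  assumes [measurable]: "v \<in> borel_measurable borel" "B \<in> sets borel"
  shows "ball_average B v \<in> borel_measurable borel"
  unfolding ball_average_def[abs_def] by measurable

lemma ball_average_bound:
  fixes v :: "real^2 \<Rightarrow> real"
  assumes v: "v \<in> borel_measurable borel" "integrable lborel (\<lambda>x. (v x)\<^sup>2)" "(LINT x|lborel. (v x)\<^sup>2) \<le> M"
    and B: "B \<in> sets borel" "bounded B"
  shows "\<bar>ball_average B v x\<bar> \<le> sqrt (measure lborel B * M) / measure lborel B"
    and "integrable lborel (\<lambda>z. indicator B z * v (x + z))"
proof -
  note [measurable] = v(1)
  have 1: "integrable lborel (\<lambda>z. (v (x + z))\<^sup>2)"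
    using lborel_integrable_translate[OF v(2), of x] by (simp add: add.commute)
  have 2: "(LINT z|lborel. (v (x + z))\<^sup>2) \<le> M"
    using lborel_integral_translate[of "\<lambda>z. (v z)\<^sup>2" x] v by (simp add: add.commute)
  show "\<bar>ball_average B v x\<bar> \<le> sqrt (measure lborel B * M) / measure lborel B"
    unfolding ball_average_def abs_divide using integral_on_set_bound(1)[OF _ 1 2 B]
    by (auto intro!: divide_right_mono)
  show "integrable lborel (\<lambda>z. indicator B z * v (x + z))"
    by (rule integral_on_set_bound(2)[OF _ 1 2 B]) measurable
qed

lemma ball_average_diff:
  assumes v: "v \<in> borel_measurable borel" "integrable lborel (\<lambda>x. (v x)\<^sup>2)"
    and w: "w \<in> borel_measurable borel" "integrable lborel (\<lambda>x. (w x)\<^sup>2)"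
    and B: "B \<in> sets borel" "bounded B"
  shows "ball_average B (\<lambda>x. v x - w x) x = ball_average B v x - ball_average B w x"
  using ball_average_bound(2)[OF v order_refl B, of x] ball_average_bound(2)[OF w order_refl B, of x]
  by (simp add: ball_average_def right_diff_distrib diff_divide_distrib)

text \<open>By Jensen, the squared distance of v to its average is at most the average over z of the
  squared differences v(x + z) - v(x). Fubini and the difference estimate for each z finish the
  proof.\<close>

lemma sob_ball_average_estimate:
  assumes s: "sob \<Omega> v g" and U: "open U" "bounded U"
    and seg: "\<And>x z t. x \<in> U \<Longrightarrow> z \<in> B \<Longrightarrow> 0 \<le> t \<Longrightarrow> t \<le> 1 \<Longrightarrow> x + t *\<^sub>R z \<in> \<Omega>"
    and B: "B \<in> sets borel" "bounded B" "measure lborel B > 0" and R: "\<And>z. z \<in> B \<Longrightarrow> norm z \<le> R"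
  shows "(LINT x|lborel. indicator U x * (v x - ball_average B v x)\<^sup>2) \<le> R\<^sup>2 * (LINT x|lborel. (norm (g x))\<^sup>2)"
proof -
  note [measurable] = sob_measurable[OF s] B(1)
  have [measurable]: "U \<in> sets borel" using U by simp
  have [measurable]: "ball_average B v \<in> borel_measurable borel" by (rule ball_average_measurable) measurable
  define \<beta> where "\<beta> = measure lborel B"
  define G where "G = (LINT x|lborel. (norm (g x))\<^sup>2)"
  have G0: "G \<ge> 0" by (simp add: G_def)
  have \<beta>: "\<beta> > 0" using B by (simp add: \<beta>_def)
  have iB: "integrable lborel (indicat_real B)" by (rule integrable_indicator_bounded[OF B(2,1)])
  have IB: "(LINT z|lborel. indicat_real B z) = \<beta>" by (simp add: \<beta>_def)
  let ?H = "\<lambda>z x. indicator B z * (indicator U x * (v (x + z) - v x)\<^sup>2)"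
  have est: "(LINT x|lborel. indicator U x * (v (x + z) - v x)\<^sup>2) \<le> R\<^sup>2 * G" if "z \<in> B" for z
  proof -
    have "(LINT x|lborel. indicator U x * (v (x + z) - v x)\<^sup>2) \<le> (norm z)\<^sup>2 * G"
      unfolding G_def by (rule sob_difference_estimate[OF s U]) (use seg that in auto)
    also have "\<dots> \<le> R\<^sup>2 * G" using R[OF that] G0 by (intro mult_right_mono power_mono) auto
    finally show ?thesis .
  qed
  have iU: "integrable lborel (\<lambda>x. indicator U x * (v (x + z) - v x)\<^sup>2)" for z
    using integrable_mult_indicator[OF _ sob_difference_square[OF s, of z], of U] by simp
  have iH: "integrable (lborel \<Otimes>\<^sub>M lborel) (\<lambda>(z, x). ?H z x)"
  proof (rule lborel_pair.Fubini_integrable)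
    show "integrable lborel (\<lambda>z. LINT x|lborel. norm (case (z, x) of (z, x) \<Rightarrow> ?H z x))"
    proof (rule Bochner_Integration.integrable_bound)
      show "integrable lborel (\<lambda>z. indicat_real B z * (R\<^sup>2 * G))" using iB by simp
      show "AE z in lborel. norm (LINT x|lborel. norm (case (z, x) of (z, x) \<Rightarrow> ?H z x))
          \<le> norm (indicat_real B z * (R\<^sup>2 * G))"
        using est G0 by (intro AE_I2) (auto simp: abs_mult indicator_def)
    qed measurable
    show "AE z in lborel. integrable lborel (\<lambda>x. case (z, x) of (z, x) \<Rightarrow> ?H z x)"
      using iU by (intro AE_I2) auto
  qed measurable
  let ?J = "\<lambda>x. LINT z|lborel. ?H z x"
  have iJ: "integrable lborel ?J" using lborel_pair.integrable_snd[OF iH] .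
  have "(LINT x|lborel. ?J x) = (LINT z|lborel. LINT x|lborel. ?H z x)"
    using lborel_pair.Fubini_integral[OF iH] .
  also have "\<dots> \<le> (LINT z|lborel. indicat_real B z * (R\<^sup>2 * G))"
  proof (rule integral_mono)
    show "integrable lborel (\<lambda>z. LINT x|lborel. ?H z x)" using lborel_pair.integrable_fst[OF iH] .
    show "(LINT x|lborel. ?H z x) \<le> indicat_real B z * (R\<^sup>2 * G)" for z
      using est[of z] by (auto simp: indicator_def)
  qed (use iB in simp)
  also have "\<dots> = \<beta> * (R\<^sup>2 * G)" using IB by simp
  finally have J: "(LINT x|lborel. ?J x) \<le> \<beta> * (R\<^sup>2 * G)" .
  have pt: "indicator U x * (v x - ball_average B v x)\<^sup>2 \<le> ?J x / \<beta>" for x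
  proof -
    define f where "f z = v (x + z) - v x" for z
    have [measurable]: "f \<in> borel_measurable borel" unfolding f_def by measurable
    have i1: "integrable lborel (\<lambda>z. indicator B z * v (x + z))"
      by (rule ball_average_bound(2)[OF sob_measurable(1)[OF s] sob_square(1)[OF s] order_refl B(1,2)])
    then have i2: "integrable lborel (\<lambda>z. indicator B z * f z)"
      using iB by (simp add: f_def right_diff_distrib)
    have "integrable lborel (\<lambda>z. (v (x + z))\<^sup>2)"
      using lborel_integrable_translate[OF sob_square(1)[OF s], of x] by (simp add: add.commute)
    from integrable_mult_indicator[OF _ this, of B]
    have "integrable lborel (\<lambda>z. indicator B z * (v (x + z))\<^sup>2 - 2 * v x * (indicator B z * v (x + z)) + (v x)\<^sup>2 * indicator B z)"
      using iB i1 by simp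
    moreover have "indicator B z * (v (x + z))\<^sup>2 - 2 * v x * (indicator B z * v (x + z)) + (v x)\<^sup>2 * indicator B z =
        indicator B z * (f z)\<^sup>2" for z
      by (simp add: f_def power2_eq_square algebra_simps)
    ultimately have i3: "integrable lborel (\<lambda>z. indicator B z * (f z)\<^sup>2)" by simp
    define m where "m = (LINT z|lborel. indicator B z * f z) / \<beta>"
    have m: "m = ball_average B v x - v x"
      using i1 iB IB \<beta> by (simp add: m_def f_def ball_average_def right_diff_distrib diff_divide_distrib flip: \<beta>_def)
    \<comment> \<open>Nonnegativity of the variance, which is Jensen's inequality for the
      square.\<close>
    have "0 \<le> (LINT z|lborel. indicator B z * (f z - m)\<^sup>2)" by simp
    also have "\<dots> = (LINT z|lborel. indicator B z * (f z)\<^sup>2 - 2 * m * (indicator B z * f z) + m\<^sup>2 * indicator B z)"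
      by (rule Bochner_Integration.integral_cong) (auto simp: power2_eq_square algebra_simps)
    also have "\<dots> = (LINT z|lborel. indicator B z * (f z)\<^sup>2) - 2 * m * (LINT z|lborel. indicator B z * f z) + m\<^sup>2 * \<beta>"
      using i2 i3 iB IB by simp
    also have "(LINT z|lborel. indicator B z * f z) = m * \<beta>" using \<beta> by (simp add: m_def)
    finally have "m\<^sup>2 * \<beta> \<le> (LINT z|lborel. indicator B z * (f z)\<^sup>2)"
      by (simp add: power2_eq_square mult.commute mult.left_commute)
    then have "m\<^sup>2 \<le> (LINT z|lborel. indicator B z * (f z)\<^sup>2) / \<beta>" using \<beta> by (simp add: pos_le_divide_eq)
    moreover have "?J x = indicator U x * (LINT z|lborel. indicator B z * (f z)\<^sup>2)"
    proof -
      have "?J x = (LINT z|lborel. indicator U x * (indicator B z * (f z)\<^sup>2))"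
        by (rule Bochner_Integration.integral_cong) (auto simp: f_def)
      then show ?thesis by simp
    qed
    ultimately show ?thesis by (auto simp: m indicator_def power2_commute)
  qed
  have "(LINT x|lborel. indicator U x * (v x - ball_average B v x)\<^sup>2) \<le> (LINT x|lborel. ?J x / \<beta>)"
  proof (rule integral_mono[OF _ _ pt])
    show "integrable lborel (\<lambda>x. indicator U x * (v x - ball_average B v x)\<^sup>2)"
    proof (rule Bochner_Integration.integrable_bound)
      show "integrable lborel (\<lambda>x. ?J x / \<beta>)" using iJ by simp
      show "AE x in lborel. norm (indicator U x * (v x - ball_average B v x)\<^sup>2) \<le> norm (?J x / \<beta>)"
      proof (rule AE_I2)
        fix x
        show "norm (indicator U x * (v x - ball_average B v x)\<^sup>2) \<le> norm (?J x / \<beta>)"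
          using order_trans[OF pt[of x] abs_ge_self] by (simp add: abs_mult)
      qed
    qed measurable
  qed (use iJ in simp)
  also have "\<dots> \<le> R\<^sup>2 * G" using J \<beta> by (simp add: divide_le_eq mult.commute)
  finally show ?thesis by (simp add: G_def)
qed

text \<open>A difference d = v m - v n is split into d minus its average and the average. The first
  part is small uniformly in m and n, by the gradient bound and a small displacement h. With h
  fixed, the averages are ball integrals, so they converge pointwise; being bounded, they converge
  in mean over U.\<close>

lemma rellich_local:
  assumes s: "\<And>n. sob \<Omega> (v n) (g n)"
    and M: "\<And>n. (LINT x|lborel. (v n x)\<^sup>2) \<le> M" "\<And>n. (LINT x|lborel. (norm (g n x))\<^sup>2) \<le> M"
    and conv: "\<And>c t. t > 0 \<Longrightarrow> convergent (\<lambda>n. LINT x|lborel. indicator (ball c t) x * v n x)"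
    and U: "open U" "bounded U" and r: "r > 0" and \<rho>: "\<rho> > 0"
    and cone: "\<And>x q t. x \<in> U \<Longrightarrow> q \<in> ball e \<rho> \<Longrightarrow> 0 \<le> t \<Longrightarrow> t \<le> r \<Longrightarrow> x + t *\<^sub>R q \<in> \<Omega>"
    and "\<epsilon> > 0"
  shows "\<exists>N. \<forall>m\<ge>N. \<forall>n\<ge>N. (LINT x|lborel. indicator U x * (v m x - v n x)\<^sup>2) < \<epsilon>"
proof -
  note [measurable] = sob_measurable(1)[OF s]
  have [measurable]: "U \<in> sets borel" using U by simp
  have "0 \<le> (LINT x|lborel. (v 0 x)\<^sup>2)" by simp
  then have M0: "M \<ge> 0" using M(1)[of 0] by linarith
  define R where "R = norm e + \<rho>"
  \<comment> \<open>Chosen for (h R)^2 * 4 M <= \<epsilon> / 4, where h R bounds the displacements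
    and 4 M the squared gradient norm of a difference. The minimum with r keeps h within the length
    of the cone.\<close>
  define h where "h = min r (sqrt (\<epsilon> / (16 * (M + 1))) / (R + 1))"
  have R0: "R > 0" using \<rho> by (simp add: R_def add_nonneg_pos)
  have h: "0 < h" "h \<le> r" using r M0 R0 \<open>\<epsilon> > 0\<close> by (auto simp: h_def)
  have hR: "(h * R)\<^sup>2 * (4 * M) \<le> \<epsilon> / 4"
  proof -
    have "h * R \<le> h * (R + 1)" using h by simp
    also have "\<dots> \<le> sqrt (\<epsilon> / (16 * (M + 1)))"
    proof -
      have "h \<le> sqrt (\<epsilon> / (16 * (M + 1))) / (R + 1)" by (simp add: h_def)
      then show ?thesis using R0 by (simp add: pos_le_divide_eq)
    qed
    finally have "(h * R)\<^sup>2 \<le> (sqrt (\<epsilon> / (16 * (M + 1))))\<^sup>2"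
      using h R0 by (intro power_mono) auto
    also have "\<dots> = \<epsilon> / (16 * (M + 1))" using M0 \<open>\<epsilon> > 0\<close> by simp
    finally have "(h * R)\<^sup>2 * (4 * M) \<le> \<epsilon> / (16 * (M + 1)) * (4 * (M + 1))"
      using M0 \<open>\<epsilon> > 0\<close> by (intro mult_mono) auto
    also have "\<dots> = \<epsilon> / 4" using M0 by (simp add: divide_simps)
    finally show ?thesis .
  qed
  define B where "B = ball (h *\<^sub>R e) (h * \<rho>)"
  have B: "B \<in> sets borel" "bounded B" "measure lborel B > 0"
    using h \<rho> by (auto simp: B_def)
  have Bq: "\<exists>q\<in>ball e \<rho>. z = h *\<^sub>R q" if "z \<in> B" for z
  proof
    have "norm (h *\<^sub>R e - z) < h * \<rho>" using that by (simp add: B_def dist_norm)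
    moreover have "h *\<^sub>R e - z = h *\<^sub>R (e - (1 / h) *\<^sub>R z)" using h by (simp add: scaleR_diff_right)
    ultimately show "(1 / h) *\<^sub>R z \<in> ball e \<rho>" using h by (simp add: dist_norm)
    show "z = h *\<^sub>R ((1 / h) *\<^sub>R z)" using h by simp
  qed
  have seg: "x + t *\<^sub>R z \<in> \<Omega>" if x: "x \<in> U" and z: "z \<in> B" and t: "0 \<le> t" "t \<le> 1" for x z t
  proof -
    obtain q where q: "q \<in> ball e \<rho>" "z = h *\<^sub>R q" using Bq[OF z] by blast
    have "t * h \<le> r" using t h mult_left_le_one_le[of h t] by linarith
    then show ?thesis using cone[OF x q(1), of "t * h"] t h by (simp add: q(2))
  qed
  have RB: "norm z \<le> h * R" if z: "z \<in> B" for z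
  proof -
    obtain q where q: "q \<in> ball e \<rho>" "z = h *\<^sub>R q" using Bq[OF z] by blast
    have "norm q \<le> norm e + dist e q" by (metis dist_commute dist_norm norm_triangle_sub)
    then show ?thesis using q h by (simp add: R_def)
  qed
  let ?A = "\<lambda>n. ball_average B (v n)"
  define b where "b = sqrt (measure lborel B * M) / measure lborel B"
  have Ab: "\<bar>?A n x\<bar> \<le> b" for n x
    unfolding b_def by (rule ball_average_bound(1)[OF sob_measurable(1)[OF s] sob_square(1)[OF s] M(1) B(1,2)])
  have [measurable]: "?A n \<in> borel_measurable borel" for n
    by (rule ball_average_measurable) (use B in measurable)
  have [measurable]: "ball y t \<in> sets borel" for y :: "real^2" and t by simp
  have Aconv: "convergent (\<lambda>n. ?A n x)" for x
  proof -
    have "(LINT z|lborel. indicator B z * v n (x + z)) = (LINT z|lborel. indicator (ball (x + h *\<^sub>R e) (h * \<rho>)) z * v n z)" for n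
    proof -
      have "(LINT z|lborel. indicator B z * v n (x + z)) =
          (LINT z|lborel. indicator (ball (x + h *\<^sub>R e) (h * \<rho>)) (z + x) * v n (z + x))"
        by (rule Bochner_Integration.integral_cong) (auto simp: indicator_def B_def dist_norm algebra_simps)
      also have "\<dots> = (LINT z|lborel. indicator (ball (x + h *\<^sub>R e) (h * \<rho>)) z * v n z)"
        by (rule lborel_integral_translate) measurable
      finally show ?thesis .
    qed
    moreover obtain l where "(\<lambda>n. LINT z|lborel. indicator (ball (x + h *\<^sub>R e) (h * \<rho>)) z * v n z) \<longlonglongrightarrow> l"
      using conv[of "h * \<rho>" "x + h *\<^sub>R e"] h \<rho> by (auto simp: convergent_def)
    ultimately have "(\<lambda>n. ?A n x) \<longlonglongrightarrow> l / measure lborel B"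
      unfolding ball_average_def using B(3) by (intro tendsto_divide tendsto_const) auto
    then show ?thesis by (auto simp: convergent_def)
  qed
  define w where "w x = lim (\<lambda>n. ?A n x)" for x
  have [measurable]: "w \<in> borel_measurable borel" unfolding w_def[abs_def] by measurable
  have wlim: "(\<lambda>n. ?A n x) \<longlonglongrightarrow> w x" for x
    using Aconv by (simp add: w_def convergent_LIMSEQ_iff)
  have wb: "\<bar>w x\<bar> \<le> b" for x
    using Ab by (intro LIMSEQ_le_const2[OF tendsto_rabs[OF wlim]]) auto
  have iU: "integrable lborel (indicat_real U)" by (rule integrable_indicator_bounded[OF U(2)]) measurable
  have Ab2: "\<bar>(?A n x - w x)\<^sup>2\<bar> \<le> (2 * b)\<^sup>2" for n x
  proof -
    have "\<bar>?A n x - w x\<bar> \<le> \<bar>2 * b\<bar>" using Ab[of n x] wb[of x] by linarith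
    then show ?thesis by (simp add: abs_le_square_iff del: abs_mult)
  qed
  have iA: "integrable lborel (\<lambda>x. indicator U x * (?A n x - w x)\<^sup>2)" for n
  proof (rule Bochner_Integration.integrable_bound[of _ "\<lambda>x. (2 * b)\<^sup>2 * indicat_real U x"])
    show "AE x in lborel. norm (indicator U x * (?A n x - w x)\<^sup>2) \<le> norm ((2 * b)\<^sup>2 * indicat_real U x)"
      using Ab2 by (intro AE_I2) (auto simp: indicator_def)
  qed (use iU in auto)
  have "(\<lambda>n. LINT x|lborel. indicator U x * (?A n x - w x)\<^sup>2) \<longlonglongrightarrow> (LINT x|lborel. indicator U x * (0::real)\<^sup>2)"
  proof (rule integral_dominated_convergence[where w = "\<lambda>x. (2 * b)\<^sup>2 * indicat_real U x"])
    show "AE x in lborel. (\<lambda>n. indicator U x * (?A n x - w x)\<^sup>2) \<longlonglongrightarrow> indicator U x * (0::real)\<^sup>2"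
    proof (rule AE_I2)
      fix x
      have "(\<lambda>n. ?A n x - w x) \<longlonglongrightarrow> w x - w x" by (intro tendsto_diff wlim tendsto_const)
      then have "(\<lambda>n. ?A n x - w x) \<longlonglongrightarrow> 0" by simp
      then show "(\<lambda>n. indicator U x * (?A n x - w x)\<^sup>2) \<longlonglongrightarrow> indicator U x * (0::real)\<^sup>2"
        by (intro tendsto_mult tendsto_const tendsto_power)
    qed
    show "AE x in lborel. norm (indicator U x * (?A n x - w x)\<^sup>2) \<le> (2 * b)\<^sup>2 * indicat_real U x" for n
      using Ab2 by (intro AE_I2) (auto simp: indicator_def)
  qed (use iU in auto)
  then have "(\<lambda>n. LINT x|lborel. indicator U x * (?A n x - w x)\<^sup>2) \<longlonglongrightarrow> 0" by simp
  \<comment> \<open>The budget is 2 * \<epsilon> / 4 for the deviation from the average and 4 *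
    \<epsilon> / 16 for each of the two averages.\<close>
  then obtain N where N: "\<And>n. n \<ge> N \<Longrightarrow> (LINT x|lborel. indicator U x * (?A n x - w x)\<^sup>2) < \<epsilon> / 16"
    using LIMSEQ_D[of _ 0 "\<epsilon> / 16"] \<open>\<epsilon> > 0\<close> by fastforce
  have "(LINT x|lborel. indicator U x * (v m x - v n x)\<^sup>2) < \<epsilon>" if mn: "m \<ge> N" "n \<ge> N" for m n
  proof -
    note sd = sob_diff[OF s[of m] s[of n]]
    note [measurable] = sob_measurable[OF sd]
    let ?d = "\<lambda>x. v m x - v n x"
    let ?Ad = "ball_average B ?d"
    have [measurable]: "?Ad \<in> borel_measurable borel"
      by (rule ball_average_measurable) (use B in measurable)
    have Ad: "?Ad x = ?A m x - ?A n x" for x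
      by (intro ball_average_diff sob_measurable(1)[OF s] sob_square(1)[OF s] B)
    have "(LINT x|lborel. (norm (g m x - g n x))\<^sup>2) \<le> (LINT x|lborel. 2 * (norm (g m x))\<^sup>2 + 2 * (norm (g n x))\<^sup>2)"
      using sob_square(2)[OF sd] sob_square(2)[OF s] norm_add_square_le[of "g m _" "- g n _"]
      by (intro integral_mono) auto
    also have "\<dots> = 2 * (LINT x|lborel. (norm (g m x))\<^sup>2) + 2 * (LINT x|lborel. (norm (g n x))\<^sup>2)"
      using sob_square(2)[OF s] by simp
    also have "\<dots> \<le> 4 * M" using M(2)[of m] M(2)[of n] by linarith
    finally have Gd: "(LINT x|lborel. (norm (g m x - g n x))\<^sup>2) \<le> 4 * M" .
    have "(LINT x|lborel. indicator U x * (?d x - ?Ad x)\<^sup>2) \<le> (h * R)\<^sup>2 * (LINT x|lborel. (norm (g m x - g n x))\<^sup>2)"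
      by (rule sob_ball_average_estimate[OF sd U seg B RB])
    also have "\<dots> \<le> (h * R)\<^sup>2 * (4 * M)" by (intro mult_left_mono Gd) auto
    finally have e1: "(LINT x|lborel. indicator U x * (?d x - ?Ad x)\<^sup>2) \<le> \<epsilon> / 4" using hR by linarith
    have Adb: "\<bar>?Ad x\<bar> \<le> 2 * b" for x unfolding Ad using Ab[of m x] Ab[of n x] by linarith
    have iAd: "integrable lborel (\<lambda>x. indicator U x * (?Ad x)\<^sup>2)"
    proof (rule Bochner_Integration.integrable_bound[of _ "\<lambda>x. (2 * b)\<^sup>2 * indicat_real U x"])
      have "(?Ad x)\<^sup>2 \<le> (2 * b)\<^sup>2" for x using Adb[of x] by (metis abs_ge_zero power2_abs power_mono)
      then show "AE x in lborel. norm (indicator U x * (?Ad x)\<^sup>2) \<le> norm ((2 * b)\<^sup>2 * indicat_real U x)"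
        by (intro AE_I2) (auto simp: indicator_def)
    qed (use iU in auto)
    have id: "integrable lborel (\<lambda>x. indicator U x * (?d x)\<^sup>2)"
      using integrable_mult_indicator[OF _ sob_square(1)[OF sd], of U] by simp
    have ptw: "(s + t)\<^sup>2 \<le> 2 * s\<^sup>2 + 2 * t\<^sup>2" for s t :: real
      using norm_add_square_le[of s t] by simp
    have idA: "integrable lborel (\<lambda>x. indicator U x * (?d x - ?Ad x)\<^sup>2)"
    proof (rule Bochner_Integration.integrable_bound)
      show "integrable lborel (\<lambda>x. 2 * (indicator U x * (?d x)\<^sup>2) + 2 * (indicator U x * (?Ad x)\<^sup>2))"
        using id iAd by simp
      show "AE x in lborel. norm (indicator U x * (?d x - ?Ad x)\<^sup>2) \<le>
          norm (2 * (indicator U x * (?d x)\<^sup>2) + 2 * (indicator U x * (?Ad x)\<^sup>2))"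
        using ptw[of "?d _" "- ?Ad _"] by (intro AE_I2) (auto simp: indicator_def)
    qed measurable
    have "(LINT x|lborel. indicator U x * (?d x)\<^sup>2) \<le>
      (LINT x|lborel. 2 * (indicator U x * (?d x - ?Ad x)\<^sup>2) + (4 * (indicator U x * (?A m x - w x)\<^sup>2) + 4 * (indicator U x * (?A n x - w x)\<^sup>2)))"
    proof (rule integral_mono)
      fix x
      have "(?d x)\<^sup>2 \<le> 2 * (?d x - ?Ad x)\<^sup>2 + 2 * (?Ad x)\<^sup>2"
        using ptw[of "?d x - ?Ad x" "?Ad x"] by simp
      moreover have "(?Ad x)\<^sup>2 \<le> 2 * (?A m x - w x)\<^sup>2 + 2 * (?A n x - w x)\<^sup>2"
        using ptw[of "?A m x - w x" "w x - ?A n x"] by (simp add: Ad power2_commute[of "w x"])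
      ultimately show "indicator U x * (?d x)\<^sup>2 \<le> 2 * (indicator U x * (?d x - ?Ad x)\<^sup>2) +
          (4 * (indicator U x * (?A m x - w x)\<^sup>2) + 4 * (indicator U x * (?A n x - w x)\<^sup>2))"
        by (simp add: indicator_def)
    qed (use id idA iA in auto)
    also have "\<dots> = 2 * (LINT x|lborel. indicator U x * (?d x - ?Ad x)\<^sup>2) +
        (4 * (LINT x|lborel. indicator U x * (?A m x - w x)\<^sup>2) + 4 * (LINT x|lborel. indicator U x * (?A n x - w x)\<^sup>2))"
      using idA iA by simp
    also have "\<dots> < \<epsilon>" using e1 N[OF mn(1)] N[OF mn(2)] \<open>\<epsilon> > 0\<close> by linarith
    finally show ?thesis .
  qed
  then show ?thesis by blast
qed

text \<open>The subsequence is chosen once, from the ball integrals, and serves every point of the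
  closure. Compactness then only has to select finitely many of the local pieces, whose estimates
  are added up.\<close>

lemma rellich:
  assumes \<Omega>: "open \<Omega>" "bounded \<Omega>" "smooth_boundary \<Omega>" and s: "\<And>n. sob \<Omega> (v n) (g n)"
    and M: "\<And>n. (LINT x|lborel. (v n x)\<^sup>2) \<le> M" "\<And>n. (LINT x|lborel. (norm (g n x))\<^sup>2) \<le> M"
  obtains k :: "nat \<Rightarrow> nat" where "strict_mono k"
    "\<And>\<epsilon>. \<epsilon> > 0 \<Longrightarrow> \<exists>N. \<forall>m\<ge>N. \<forall>n\<ge>N. (LINT x|lborel. (v (k m) x - v (k n) x)\<^sup>2) < \<epsilon>"
proof -
  obtain k :: "nat \<Rightarrow> nat" where k: "strict_mono k"
    and conv: "\<And>c t. t > 0 \<Longrightarrow> convergent (\<lambda>n. LINT x|lborel. indicator (ball c t) x * v (k n) x)"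
    using convergent_ball_integrals[of v M, OF sob_measurable(1)[OF s] sob_square(1)[OF s] M(1)] by metis
  have "\<forall>p\<in>closure \<Omega>. \<exists>r>0. \<forall>\<epsilon>>0. \<exists>N. \<forall>m\<ge>N. \<forall>n\<ge>N.
      (LINT x|lborel. indicator (\<Omega> \<inter> ball p r) x * (v (k m) x - v (k n) x)\<^sup>2) < \<epsilon>"
  proof
    fix p assume p: "p \<in> closure \<Omega>"
    obtain r \<rho> e where r: "r > 0" "\<rho> > 0"
      and cone: "\<And>x q t. x \<in> \<Omega> \<Longrightarrow> x \<in> ball p r \<Longrightarrow> q \<in> ball e \<rho> \<Longrightarrow> 0 \<le> t \<Longrightarrow> t \<le> r \<Longrightarrow> x + t *\<^sub>R q \<in> \<Omega>"
      by (rule cone_condition[OF \<Omega>(1,3) p]) blast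
    have "\<exists>N. \<forall>m\<ge>N. \<forall>n\<ge>N. (LINT x|lborel. indicator (\<Omega> \<inter> ball p r) x * (v (k m) x - v (k n) x)\<^sup>2) < \<epsilon>"
      if "\<epsilon> > 0" for \<epsilon>
      by (rule rellich_local[OF s M conv _ _ r _ that]) (use \<Omega> cone in auto)
    then show "\<exists>r>0. \<forall>\<epsilon>>0. \<exists>N. \<forall>m\<ge>N. \<forall>n\<ge>N.
      (LINT x|lborel. indicator (\<Omega> \<inter> ball p r) x * (v (k m) x - v (k n) x)\<^sup>2) < \<epsilon>"
      using r(1) by blast
  qed
  from bchoice[OF this] obtain r where "\<forall>p\<in>closure \<Omega>. r p > 0 \<and> (\<forall>\<epsilon>>0. \<exists>N. \<forall>m\<ge>N. \<forall>n\<ge>N.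
      (LINT x|lborel. indicator (\<Omega> \<inter> ball p (r p)) x * (v (k m) x - v (k n) x)\<^sup>2) < \<epsilon>)" ..
  then have r: "\<And>p. p \<in> closure \<Omega> \<Longrightarrow> r p > 0"
    "\<And>p \<epsilon>. p \<in> closure \<Omega> \<Longrightarrow> \<epsilon> > 0 \<Longrightarrow> \<exists>N. \<forall>m\<ge>N. \<forall>n\<ge>N.
      (LINT x|lborel. indicator (\<Omega> \<inter> ball p (r p)) x * (v (k m) x - v (k n) x)\<^sup>2) < \<epsilon>"
    by simp_all
  have comp: "compact (closure \<Omega>)" using \<Omega>(2) by simp
  have cov: "closure \<Omega> \<subseteq> (\<Union>p\<in>closure \<Omega>. ball p (r p))"
  proof
    fix p assume "p \<in> closure \<Omega>"
    then show "p \<in> (\<Union>p\<in>closure \<Omega>. ball p (r p))" by (rule UN_I) (use r(1) \<open>p \<in> closure \<Omega>\<close> in simp)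
  qed
  obtain P where P: "P \<subseteq> closure \<Omega>" "finite P" "closure \<Omega> \<subseteq> (\<Union>p\<in>P. ball p (r p))"
    by (rule compactE_image[OF comp _ cov]) (simp, blast)
  have "\<exists>N. \<forall>m\<ge>N. \<forall>n\<ge>N. (LINT x|lborel. (v (k m) x - v (k n) x)\<^sup>2) < \<epsilon>" if \<epsilon>: "\<epsilon> > 0" for \<epsilon>
  proof -
    define c where "c = \<epsilon> / (real (card P) + 1)"
    have c: "c > 0" using \<epsilon> by (simp add: c_def add_nonneg_pos)
    have "\<forall>p\<in>P. \<exists>N. \<forall>m\<ge>N. \<forall>n\<ge>N. (LINT x|lborel. indicator (\<Omega> \<inter> ball p (r p)) x * (v (k m) x - v (k n) x)\<^sup>2) < c"
      using r(2) P(1) c by blast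
    from bchoice[OF this] obtain N where "\<forall>p\<in>P. \<forall>m\<ge>N p. \<forall>n\<ge>N p.
        (LINT x|lborel. indicator (\<Omega> \<inter> ball p (r p)) x * (v (k m) x - v (k n) x)\<^sup>2) < c" ..
    then have N: "\<And>p m n. p \<in> P \<Longrightarrow> m \<ge> N p \<Longrightarrow> n \<ge> N p \<Longrightarrow>
        (LINT x|lborel. indicator (\<Omega> \<inter> ball p (r p)) x * (v (k m) x - v (k n) x)\<^sup>2) < c"
      by simp
    have "(LINT x|lborel. (v (k m) x - v (k n) x)\<^sup>2) < \<epsilon>" if mn: "m \<ge> (\<Sum>p\<in>P. N p)" "n \<ge> (\<Sum>p\<in>P. N p)" for m n
    proof -
      note sd = sob_diff[OF s[of "k m"] s[of "k n"]]
      let ?d = "\<lambda>x. (v (k m) x - v (k n) x)\<^sup>2"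
      have i: "integrable lborel (\<lambda>x. indicator (\<Omega> \<inter> ball p (r p)) x * ?d x)" for p
        using integrable_mult_indicator[OF _ sob_square(1)[OF sd], of "\<Omega> \<inter> ball p (r p)"] \<Omega>(1) by simp
      have "(LINT x|lborel. ?d x) \<le> (LINT x|lborel. (\<Sum>p\<in>P. indicator (\<Omega> \<inter> ball p (r p)) x * ?d x))"
      proof (rule integral_mono[OF sob_square(1)[OF sd]])
        show "integrable lborel (\<lambda>x. \<Sum>p\<in>P. indicator (\<Omega> \<inter> ball p (r p)) x * ?d x)" using i by simp
        fix x
        show "?d x \<le> (\<Sum>p\<in>P. indicator (\<Omega> \<inter> ball p (r p)) x * ?d x)"
        proof (cases "x \<in> \<Omega>")
          case True
          then have "x \<in> (\<Union>p\<in>P. ball p (r p))" by (rule subsetD[OF P(3) subsetD[OF closure_subset]])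
          then have "\<exists>p\<in>P. x \<in> ball p (r p)" by simp
          then obtain p where p: "p \<in> P" "x \<in> ball p (r p)" ..
          then have "?d x = indicator (\<Omega> \<inter> ball p (r p)) x * ?d x" using True by simp
          also have "\<dots> \<le> (\<Sum>p\<in>P. indicator (\<Omega> \<inter> ball p (r p)) x * ?d x)"
            using p P(2) by (intro member_le_sum) auto
          finally show ?thesis .
        next
          case False
          then show ?thesis using sob_off(1)[OF sd False] by (simp add: sum_nonneg)
        qed
      qed
      also have "\<dots> = (\<Sum>p\<in>P. (LINT x|lborel. indicator (\<Omega> \<inter> ball p (r p)) x * ?d x))"
        using i by simp
      also have "\<dots> \<le> (\<Sum>p\<in>P. c)"
      proof (rule sum_mono)
        fix p assume p: "p \<in> P"
        have "N p \<le> (\<Sum>p\<in>P. N p)" using p P(2) by (intro member_le_sum) auto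
        then show "(LINT x|lborel. indicator (\<Omega> \<inter> ball p (r p)) x * ?d x) \<le> c"
          using mn by (intro less_imp_le[OF N[OF p]]) auto
      qed
      also have "\<dots> = real (card P) * c" by simp
      also have "\<dots> < (real (card P) + 1) * c" using c by simp
      also have "\<dots> = \<epsilon>" by (simp add: c_def add_nonneg_pos order_less_imp_not_eq2)
      finally show ?thesis .
    qed
    then show ?thesis by blast
  qed
  then show ?thesis using that[OF k] by blast
qed

section \<open>Continuously differentiable functions\<close>

text \<open>By translation invariance each difference quotient has integral zero, and the quotients
  converge dominatedly to the derivative.\<close>

lemma integral_directional_derivative_zero:
  fixes \<psi> :: "real^2 \<Rightarrow> real"
  assumes d\<psi>: "\<And>x. (\<psi> has_derivative \<psi>' x) (at x)" and cont: "continuous_on UNIV (\<lambda>x. \<psi>' x e)"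
    and K: "compact K" and off: "\<And>x. x \<notin> K \<Longrightarrow> \<psi> x = 0"
  shows "(LINT x|lborel. \<psi>' x e) = 0"
proof -
  have c\<psi>: "continuous_on UNIV \<psi>"
    using d\<psi> has_derivative_continuous by (metis continuous_at_imp_continuous_on)
  have [measurable]: "\<psi> \<in> borel_measurable borel" "(\<lambda>x. \<psi>' x e) \<in> borel_measurable borel"
    using c\<psi> cont by (auto intro: borel_measurable_continuous_onI)
  have off': "\<psi>' x e = 0" if "x \<notin> K" for x
    using has_derivative_zero_off_support[OF d\<psi> compact_imp_closed[OF K] off that] by metis
  obtain M1 where M1: "M1 \<ge> 0" "\<And>x. \<bar>\<psi>' x e\<bar> \<le> M1"
    by (rule compact_support_bounded[OF cont K off']) auto
  obtain M0 where M0: "M0 \<ge> 0" "\<And>x. \<bar>\<psi> x\<bar> \<le> M0"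
    by (rule compact_support_bounded[OF c\<psi> K off]) auto
  have d1: "((\<lambda>t. \<psi> (x + t *\<^sub>R e)) has_real_derivative \<psi>' (x + t *\<^sub>R e) e) (at t)" for x t
    by (rule has_real_derivative_along_line[OF d\<psi>])
  have lip: "\<bar>\<psi> (x + r *\<^sub>R e) - \<psi> x\<bar> \<le> M1 * \<bar>r\<bar>" for x r
    by (rule Lipschitz_along_line[where f' = \<psi>', OF d\<psi> M1(2)])
  obtain B where B: "\<forall>x\<in>K. norm x \<le> B" using compact_imp_bounded[OF K] by (auto simp: bounded_iff)
  \<comment> \<open>Enlarged by |e| in order to contain the supports of all translates with step at
    most 1.\<close>
  let ?C = "cball 0 (B + norm e) :: (real^2) set"
  have iC: "integrable lborel (indicat_real ?C)" by (rule integrable_indicator_bounded) auto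
  have i\<psi>: "integrable lborel \<psi>"
  proof (rule Bochner_Integration.integrable_bound)
    show "integrable lborel (\<lambda>x. M0 * indicat_real ?C x)" using iC by simp
    have "\<bar>\<psi> x\<bar> \<le> M0 * indicat_real ?C x" for x
    proof (cases "x \<in> K")
      case True
      then have "norm x \<le> B + norm e" using B by (metis add_increasing2 norm_ge_zero)
      then show ?thesis using M0 by simp
    qed (use M0 off in \<open>simp add: indicator_def\<close>)
    then show "AE x in lborel. norm (\<psi> x) \<le> norm (M0 * indicat_real ?C x)"
      by (auto intro!: AE_I2 order_trans[OF _ abs_ge_self])
  qed simp
  define \<tau> where "\<tau> n = inverse (real (Suc n))" for n
  have \<tau>: "0 < \<tau> n" "\<tau> n \<le> 1" for n by (auto simp: \<tau>_def inverse_le_1_iff)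
  have \<tau>0: "\<tau> \<longlonglongrightarrow> 0" unfolding \<tau>_def[abs_def] by (rule LIMSEQ_inverse_real_of_nat)
  have "(\<lambda>n. LINT x|lborel. (\<psi> (x + \<tau> n *\<^sub>R e) - \<psi> x) / \<tau> n) \<longlonglongrightarrow> (LINT x|lborel. \<psi>' x e)"
  proof (rule integral_dominated_convergence[where w = "\<lambda>x. M1 * indicat_real ?C x"])
    show "AE x in lborel. (\<lambda>n. (\<psi> (x + \<tau> n *\<^sub>R e) - \<psi> x) / \<tau> n) \<longlonglongrightarrow> \<psi>' x e"
    proof (rule AE_I2)
      fix x
      have "((\<lambda>h. (\<psi> (x + h *\<^sub>R e) - \<psi> x) / h) \<longlongrightarrow> \<psi>' x e) (at 0)"
        using d1[of x 0] by (simp add: DERIV_def)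
      then show "(\<lambda>n. (\<psi> (x + \<tau> n *\<^sub>R e) - \<psi> x) / \<tau> n) \<longlonglongrightarrow> \<psi>' x e"
        by (rule filterlim_compose) (use \<tau>0 \<tau>(1) in \<open>auto simp: filterlim_at intro!: always_eventually less_imp_neq[THEN not_sym]\<close>)
    qed
    show "AE x in lborel. norm ((\<psi> (x + \<tau> n *\<^sub>R e) - \<psi> x) / \<tau> n) \<le> M1 * indicat_real ?C x" for n
    proof (rule AE_I2)
      fix x
      show "norm ((\<psi> (x + \<tau> n *\<^sub>R e) - \<psi> x) / \<tau> n) \<le> M1 * indicat_real ?C x"
      proof (cases "x \<in> ?C")
        case True
        then show ?thesis using lip[of x "\<tau> n"] \<tau>(1)[of n] by (simp add: divide_le_eq)
      next
        case False
        have "norm (\<tau> n *\<^sub>R e) \<le> norm e" using \<tau>[of n] by (simp add: mult_left_le_one_le)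
        moreover have "norm x \<le> norm (x + \<tau> n *\<^sub>R e) + norm (\<tau> n *\<^sub>R e)"
          using norm_triangle_ineq4[of "x + \<tau> n *\<^sub>R e" "\<tau> n *\<^sub>R e"] by simp
        ultimately have "norm (x + \<tau> n *\<^sub>R e) > B" using False by simp
        moreover have "norm x > B" using False by (smt (verit) mem_cball_0 norm_ge_zero)
        ultimately have "x + \<tau> n *\<^sub>R e \<notin> K" "x \<notin> K" using B by force+
        then show ?thesis using off M1 by simp
      qed
    qed
  qed (use iC in auto)
  moreover have "(LINT x|lborel. (\<psi> (x + y) - \<psi> x) / t) = 0" for y t
    using lborel_integrable_translate[OF i\<psi>, of y] i\<psi> lborel_integral_translate[of \<psi> y] by simp
  ultimately have "(\<lambda>n. 0) \<longlonglongrightarrow> (LINT x|lborel. \<psi>' x e)" by (simp only:)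
  then show ?thesis by (simp add: LIMSEQ_const_iff)
qed

text \<open>Supplies constants and trial functions. A test function \<phi> kills the boundary, so
  the identity is the vanishing integral of the derivative of u \<phi> over the whole plane.\<close>

lemma sob_C1:
  fixes u :: "real^2 \<Rightarrow> real"
  assumes \<Omega>: "open \<Omega>" "bounded \<Omega>"
    and du: "\<And>x. (u has_derivative u' x) (at x)" and cont: "\<And>h. continuous_on UNIV (\<lambda>x. u' x h)"
  shows "sob \<Omega> (\<lambda>x. indicator \<Omega> x * u x) (\<lambda>x. indicator \<Omega> x *\<^sub>R (\<chi> i. u' x (axis i 1)))"
proof -
  have cu: "continuous_on UNIV u"
    using du has_derivative_continuous by (metis continuous_at_imp_continuous_on)
  have cg: "continuous_on UNIV (\<lambda>x. \<chi> i. u' x (axis i 1))"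
    by (intro continuous_on_vec_lambda cont)
  have [measurable]: "u \<in> borel_measurable borel" "(\<lambda>x. \<chi> i. u' x (axis i 1)) \<in> borel_measurable borel"
    using cu cg by (auto intro: borel_measurable_continuous_onI)
  have [measurable]: "\<Omega> \<in> sets borel" using \<Omega>(1) by simp
  have bd: "integrable lborel (\<lambda>x. (norm (indicator \<Omega> x *\<^sub>R f x))\<^sup>2)"
    if f: "continuous_on UNIV f" for f :: "real^2 \<Rightarrow> 'b::euclidean_space"
  proof -
    have [measurable]: "f \<in> borel_measurable borel" using f by (rule borel_measurable_continuous_onI)
    have "bounded (f ` closure \<Omega>)"
      using \<Omega>(2) by (intro compact_imp_bounded compact_continuous_image continuous_on_subset[OF f]) auto
    then obtain B where B: "\<forall>x\<in>closure \<Omega>. norm (f x) \<le> B" by (auto simp: bounded_iff)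
    show ?thesis
    proof (rule Bochner_Integration.integrable_bound)
      show "integrable lborel (\<lambda>x. B\<^sup>2 * indicat_real \<Omega> x)"
        using integrable_indicator_bounded[OF \<Omega>(2)] by simp
      have "(norm (indicator \<Omega> x *\<^sub>R f x))\<^sup>2 \<le> B\<^sup>2 * indicat_real \<Omega> x" for x
        using B closure_subset[of \<Omega>] by (auto simp: indicator_def intro!: power_mono)
      then show "AE x in lborel. norm ((norm (indicator \<Omega> x *\<^sub>R f x))\<^sup>2) \<le> norm (B\<^sup>2 * indicat_real \<Omega> x)"
        by (intro AE_I2) simp
    qed measurable
  qed
  have weak: "(LINT x|lborel. indicator \<Omega> x * u x * dir_deriv (axis i 1) \<phi> x) =
      - (LINT x|lborel. (indicator \<Omega> x *\<^sub>R (\<chi> i. u' x (axis i 1))) $ i * \<phi> x)"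
    if \<phi>: "\<phi> \<in> test_functions \<Omega>" for \<phi> i
  proof -
    let ?e = "axis i 1 :: real^2"
    have sm: "smooth_fun \<phi>" using \<phi> by (simp add: test_functions_def)
    note [measurable] = test_function_measurable[OF \<phi>]
    obtain K M where K: "compact K" "K \<subseteq> \<Omega>" "\<And>x. x \<notin> K \<Longrightarrow> \<phi> x = 0"
      "\<And>x v. x \<notin> K \<Longrightarrow> dir_deriv v \<phi> x = 0"
      using test_function_bounds[OF \<phi>] by metis
    have "(LINT x|lborel. u x * dir_deriv ?e \<phi> x + u' x ?e * \<phi> x) = 0"
    proof (rule integral_directional_derivative_zero[where \<psi>' = "\<lambda>x h. u x * dir_deriv h \<phi> x + u' x h * \<phi> x" and e = ?e])
      show "((\<lambda>x. u x * \<phi> x) has_derivative (\<lambda>h. u x * dir_deriv h \<phi> x + u' x h * \<phi> x)) (at x)" for x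
        by (rule has_derivative_mult[OF du smooth_fun_has_derivative[OF sm]])
      show "continuous_on UNIV (\<lambda>x. u x * dir_deriv ?e \<phi> x + u' x ?e * \<phi> x)"
        by (intro continuous_intros cu cont smooth_fun_continuous smooth_fun_dir_deriv sm)
    qed (use K in auto)
    moreover have "integrable lborel (\<lambda>x. indicator \<Omega> x * u x * dir_deriv ?e \<phi> x)"
      using bd[OF cu] test_function_square_integrable(2)[OF \<phi>] by (intro square_integrable_mult) auto
    moreover have "integrable lborel (\<lambda>x. indicator \<Omega> x * u' x ?e * \<phi> x)"
    proof (intro square_integrable_mult)
      have [measurable]: "(\<lambda>x. u' x ?e) \<in> borel_measurable borel"
        using cont by (rule borel_measurable_continuous_onI)
      show "(\<lambda>x. indicat_real \<Omega> x * u' x ?e) \<in> borel_measurable lborel" by measurable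
      show "integrable lborel (\<lambda>x. (indicat_real \<Omega> x * u' x ?e)\<^sup>2)" using bd[OF cont[of ?e]] by simp
    qed (use test_function_square_integrable[OF \<phi>] in auto)
    moreover have "u x * dir_deriv ?e \<phi> x + u' x ?e * \<phi> x =
        indicator \<Omega> x * u x * dir_deriv ?e \<phi> x + indicator \<Omega> x * u' x ?e * \<phi> x" for x
    proof (cases "x \<in> \<Omega>")
      case False
      then have "x \<notin> K" using K(2) by blast
      then show ?thesis using K(3,4) False by simp
    qed simp
    ultimately show ?thesis by simp
  qed
  show ?thesis
    unfolding sob_def using bd[OF cu] bd[OF cg] weak by auto
qed

lemma sob_indicator:
  assumes "open \<Omega>" "bounded \<Omega>"
  shows "sob \<Omega> (indicator \<Omega>) (\<lambda>x. 0)"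
proof -
  have "(\<chi> i. (0::real)) = (0 :: real^2)" by (simp add: vec_eq_iff)
  then show ?thesis
    using sob_C1[OF assms, of "\<lambda>x. 1" "\<lambda>x h. 0"] by (simp cong: if_cong)
qed

section \<open>Relating Sobolev pairs to \<open>H1\<close>\<close>

lemma lebesgue_on_borel_representative_real:
  fixes f :: "'a::euclidean_space \<Rightarrow> real"
  assumes "open \<Omega>" "f \<in> borel_measurable (lebesgue_on \<Omega>)"
  shows "\<exists>f'\<in>borel_measurable borel. (\<forall>x. x \<notin> \<Omega> \<longrightarrow> f' x = 0) \<and> (AE x in lborel. x \<in> \<Omega> \<longrightarrow> f x = f' x)"
proof -
  have [measurable]: "\<Omega> \<in> sets borel" using assms(1) by simp
  have "(\<lambda>x. if x \<in> \<Omega> then f x else 0) \<in> borel_measurable lebesgue"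
    using assms by (simp add: borel_measurable_if)
  from completion_ex_borel_measurable_real[OF this]
  obtain h where h[measurable]: "h \<in> borel_measurable borel" and ae: "AE x in lborel. (if x \<in> \<Omega> then f x else 0) = h x"
    by auto
  show ?thesis
  proof (intro bexI[of _ "\<lambda>x. indicator \<Omega> x * h x"] conjI)
    show "AE x in lborel. x \<in> \<Omega> \<longrightarrow> f x = indicator \<Omega> x * h x" using ae by eventually_elim auto
  qed auto
qed

lemma lebesgue_on_borel_representative:
  fixes f :: "'a::euclidean_space \<Rightarrow> real^2"
  assumes "open \<Omega>" "f \<in> borel_measurable (lebesgue_on \<Omega>)"
  shows "\<exists>f'\<in>borel_measurable borel. (\<forall>x. x \<notin> \<Omega> \<longrightarrow> f' x = 0) \<and> (AE x in lborel. x \<in> \<Omega> \<longrightarrow> f x = f' x)"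
proof -
  have "\<forall>i. \<exists>f'. f' \<in> borel_measurable borel \<and> (\<forall>x. x \<notin> \<Omega> \<longrightarrow> f' x = 0) \<and> (AE x in lborel. x \<in> \<Omega> \<longrightarrow> f x $ i = f' x)"
    using lebesgue_on_borel_representative_real[OF assms(1) borel_measurable_component[OF assms(2)]] by blast
  from choice[OF this] obtain F where F: "\<And>i. F i \<in> borel_measurable borel" "\<And>i x. x \<notin> \<Omega> \<Longrightarrow> F i x = 0"
    "\<And>i. AE x in lborel. x \<in> \<Omega> \<longrightarrow> f x $ i = F i x" by auto
  let ?G = "\<lambda>x. \<Sum>i\<in>UNIV. F i x *\<^sub>R axis i (1::real) :: real^2"
  have G: "?G x $ j = F j x" for x j
    by (simp add: axis_def if_distrib cong: if_cong)
  show ?thesis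
  proof (intro bexI[of _ ?G] conjI)
    show "?G \<in> borel_measurable borel"
      by (intro borel_measurable_sum borel_measurable_scaleR F) auto
    show "\<forall>x. x \<notin> \<Omega> \<longrightarrow> ?G x = 0" using F(2) by simp
    have "AE x in lborel. x \<in> \<Omega> \<longrightarrow> f x $ 1 = F 1 x" "AE x in lborel. x \<in> \<Omega> \<longrightarrow> f x $ 2 = F 2 x" by (rule F(3))+
    then show "AE x in lborel. x \<in> \<Omega> \<longrightarrow> f x = ?G x"
      by eventually_elim (simp only: vec_eq_iff G forall_2, blast)
  qed
qed

lemma AE_lebesgue_on_iff:
  fixes \<Omega> :: "'a::euclidean_space set"
  assumes "open \<Omega>"
  shows "(AE x in lebesgue_on \<Omega>. P x) \<longleftrightarrow> (AE x in lborel. x \<in> \<Omega> \<longrightarrow> P x)"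
  using assms by (simp add: AE_restrict_space_iff AE_completion_iff)

lemma lebesgue_on_transfer:
  fixes f h :: "'a::euclidean_space \<Rightarrow> real"
  assumes "open \<Omega>" "f \<in> borel_measurable (lebesgue_on \<Omega>)" "h \<in> borel_measurable borel"
    "\<And>x. x \<notin> \<Omega> \<Longrightarrow> h x = 0" "AE x in lborel. x \<in> \<Omega> \<longrightarrow> f x = h x"
  shows "(LINT x|lebesgue_on \<Omega>. f x) = (LINT x|lborel. h x)"
    and "integrable (lebesgue_on \<Omega>) f \<longleftrightarrow> integrable lborel h"
proof -
  have O: "\<Omega> \<inter> space lebesgue \<in> sets lebesgue" using assms(1) by simp
  let ?f = "\<lambda>x. indicator \<Omega> x *\<^sub>R f x"
  have m: "?f \<in> borel_measurable lebesgue"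
    using assms(2) borel_measurable_restrict_space_iff[OF O, of f] by simp
  have m': "h \<in> borel_measurable lebesgue" using assms(3) by (simp add: measurable_completion)
  have "AE x in lborel. ?f x = h x" using assms(5) by eventually_elim (use assms(4) in \<open>auto simp: indicator_def\<close>)
  then have ae: "AE x in lebesgue. ?f x = h x" by (rule AE_completion)
  show "(LINT x|lebesgue_on \<Omega>. f x) = (LINT x|lborel. h x)"
    using integral_restrict_space[OF O, of f] integral_cong_AE[OF m m' ae] integral_completion[of h lborel] assms(3) by simp
  show "integrable (lebesgue_on \<Omega>) f \<longleftrightarrow> integrable lborel h"
    using integrable_restrict_space[OF O, of f] integrable_cong_AE[OF m m' ae] integrable_completion[of h lborel] assms(3) by simp
qed

lemma sob_L2_weak_gradient:
  assumes "open \<Omega>" and s: "sob \<Omega> v g"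
  shows "v \<in> L2 \<Omega>" "g \<in> L2 \<Omega>" "has_weak_gradient \<Omega> v g" "v \<in> H1 \<Omega>"
proof -
  note [measurable] = sob_measurable[OF s]
  have bm: "f \<in> borel_measurable (lebesgue_on \<Omega>)" if "f \<in> borel_measurable borel" for f :: "real^2 \<Rightarrow> 'b::euclidean_space"
    using that by (intro measurable_restrict_space1 measurable_completion) simp
  show 1: "v \<in> L2 \<Omega>" "g \<in> L2 \<Omega>"
    using lebesgue_on_transfer(2)[OF assms(1) bm, of "\<lambda>x. (norm (v x))\<^sup>2" "\<lambda>x. (norm (v x))\<^sup>2"]
      lebesgue_on_transfer(2)[OF assms(1) bm, of "\<lambda>x. (norm (g x))\<^sup>2" "\<lambda>x. (norm (g x))\<^sup>2"]
      sob_square[OF s] sob_off[OF s]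
    by (auto simp: L2_def bm)
  show 2: "has_weak_gradient \<Omega> v g"
    unfolding has_weak_gradient_def
  proof (intro ballI allI)
    fix \<phi> i assume \<phi>: "\<phi> \<in> test_functions \<Omega>"
    note [measurable] = test_function_measurable[OF \<phi>]
    have "(LINT x|lebesgue_on \<Omega>. v x * dir_deriv (axis i 1) \<phi> x) = (LINT x|lborel. v x * dir_deriv (axis i 1) \<phi> x)"
      by (rule lebesgue_on_transfer(1)[OF assms(1) bm]) (use sob_off[OF s] in auto)
    moreover have "(LINT x|lebesgue_on \<Omega>. g x $ i * \<phi> x) = (LINT x|lborel. g x $ i * \<phi> x)"
      by (rule lebesgue_on_transfer(1)[OF assms(1) bm]) (use sob_off[OF s] in auto)
    ultimately show "(LINT x|lebesgue_on \<Omega>. v x * dir_deriv (axis i 1) \<phi> x) = - (LINT x|lebesgue_on \<Omega>. g x $ i * \<phi> x)"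
      using sob_weak[OF s \<phi>, of i] by simp
  qed
  show "v \<in> H1 \<Omega>" using 1 2 by (auto simp: H1_def)
qed

lemma weak_gradient_sob:
  assumes "open \<Omega>" and u: "u \<in> L2 \<Omega>" "f \<in> L2 \<Omega>" "has_weak_gradient \<Omega> u f"
  shows "\<exists>v g. sob \<Omega> v g \<and> (AE x in lborel. x \<in> \<Omega> \<longrightarrow> u x = v x) \<and> (AE x in lborel. x \<in> \<Omega> \<longrightarrow> f x = g x)"
proof -
  have um: "u \<in> borel_measurable (lebesgue_on \<Omega>)" "f \<in> borel_measurable (lebesgue_on \<Omega>)" using u by (auto simp: L2_def)
  obtain v where v[measurable]: "v \<in> borel_measurable borel" and v0: "\<And>x. x \<notin> \<Omega> \<Longrightarrow> v x = 0"
    and uv: "AE x in lborel. x \<in> \<Omega> \<longrightarrow> u x = v x"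
    using lebesgue_on_borel_representative_real[OF assms(1) um(1)] by auto
  obtain g where g[measurable]: "g \<in> borel_measurable borel" and g0: "\<And>x. x \<notin> \<Omega> \<Longrightarrow> g x = 0"
    and fg: "AE x in lborel. x \<in> \<Omega> \<longrightarrow> f x = g x"
    using lebesgue_on_borel_representative[OF assms(1) um(2)] by auto
  have bm: "h \<in> borel_measurable (lebesgue_on \<Omega>)" if "h \<in> borel_measurable borel" for h :: "real^2 \<Rightarrow> real"
    using that by (intro measurable_restrict_space1 measurable_completion) simp
  have sq: "AE x in lborel. x \<in> \<Omega> \<longrightarrow> (norm (u x))\<^sup>2 = (v x)\<^sup>2" "AE x in lborel. x \<in> \<Omega> \<longrightarrow> (norm (f x))\<^sup>2 = (norm (g x))\<^sup>2"
    using uv by (eventually_elim, simp) (use fg in \<open>eventually_elim, simp\<close>)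
  have "integrable lborel (\<lambda>x. (v x)\<^sup>2)"
    using lebesgue_on_transfer(2)[OF assms(1), of "\<lambda>x. (norm (u x))\<^sup>2" "\<lambda>x. (v x)\<^sup>2"] um u(1) v0 sq(1)
    by (auto simp: L2_def)
  moreover have "integrable lborel (\<lambda>x. (norm (g x))\<^sup>2)"
    using lebesgue_on_transfer(2)[OF assms(1), of "\<lambda>x. (norm (f x))\<^sup>2" "\<lambda>x. (norm (g x))\<^sup>2"] um u(2) g0 sq(2)
    by (auto simp: L2_def)
  moreover have "(LINT x|lborel. v x * dir_deriv (axis i 1) \<phi> x) = - (LINT x|lborel. g x $ i * \<phi> x)"
    if \<phi>: "\<phi> \<in> test_functions \<Omega>" for \<phi> i
  proof -
    note m = test_function_measurable[OF \<phi>]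
    note [measurable] = m bm[OF m(1)] bm[OF m(2)] um
    have "(LINT x|lebesgue_on \<Omega>. u x * dir_deriv (axis i 1) \<phi> x) = (LINT x|lborel. v x * dir_deriv (axis i 1) \<phi> x)"
      by (rule lebesgue_on_transfer(1)[OF assms(1)]) (use uv v0 in \<open>auto elim: eventually_mono\<close>)
    moreover have "(LINT x|lebesgue_on \<Omega>. f x $ i * \<phi> x) = (LINT x|lborel. g x $ i * \<phi> x)"
      by (rule lebesgue_on_transfer(1)[OF assms(1)]) (use fg g0 in \<open>auto elim: eventually_mono\<close>)
    ultimately show ?thesis using u(3) \<phi> by (auto simp: has_weak_gradient_def)
  qed
  ultimately have "sob \<Omega> v g" unfolding sob_def using v g v0 g0 by blast
  then show ?thesis using uv fg by blast
qed

lemma sob_gradient_unique: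
  assumes \<Omega>: "open \<Omega>" "bounded \<Omega>" and s: "sob \<Omega> v g" "sob \<Omega> w h"
    and vw: "AE x in lborel. x \<in> \<Omega> \<longrightarrow> v x = w x"
  shows "AE x in lborel. x \<in> \<Omega> \<longrightarrow> g x = h x"
proof -
  note sd = sob_diff[OF s]
  note [measurable] = sob_measurable[OF sd] sob_measurable[OF s(1)] sob_measurable[OF s(2)]
  have ae: "AE x in lborel. x \<in> \<Omega> \<longrightarrow> (g x - h x) $ i = 0" for i
  proof (rule fundamental_lemma[OF _ \<Omega>(1)])
    show "integrable lborel (\<lambda>x. (g x - h x) $ i)"
    proof (rule integrable_of_square_bounded_support[OF _ _ \<Omega>(2)])
      show "(\<lambda>x. (g x - h x) $ i) \<in> borel_measurable borel" by measurable
      show "integrable lborel (\<lambda>x. (norm ((g x - h x) $ i))\<^sup>2)"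
        using sob_gradient_component(1)[OF sd, of "axis i 1"]
        by (simp only: inner_axis inner_real_def mult_1_right real_norm_def power2_abs)
      show "(g x - h x) $ i = 0" if "x \<notin> \<Omega>" for x
        by (simp only: sob_off(2)[OF sd that] zero_index)
    qed
    fix \<phi> assume \<phi>: "\<phi> \<in> test_functions \<Omega>"
    note [measurable] = test_function_measurable[OF \<phi>]
    have "AE x in lborel. (v x - w x) * dir_deriv (axis i 1) \<phi> x = 0"
      using vw by eventually_elim (use sob_off(1)[OF sd] in fastforce)
    then have "(LINT x|lborel. (v x - w x) * dir_deriv (axis i 1) \<phi> x) = 0" by (rule integral_eq_zero_AE)
    then show "(LINT x|lborel. (g x - h x) $ i * \<phi> x) = 0" using sob_weak[OF sd \<phi>, of i] by simp
  qed
  from ae[of 1] ae[of 2] show ?thesis by eventually_elim (simp add: vec_eq_iff forall_2)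
qed

lemma H1_representative:
  assumes "open \<Omega>" "u \<in> H1 \<Omega>"
  obtains v g where "sob \<Omega> v g" "AE x in lborel. x \<in> \<Omega> \<longrightarrow> u x = v x"
    "AE x in lborel. x \<in> \<Omega> \<longrightarrow> weak_grad \<Omega> u x = g x"
proof -
  have "\<exists>g. g \<in> L2 \<Omega> \<and> has_weak_gradient \<Omega> u g" using assms(2) by (auto simp: H1_def)
  then have "weak_grad \<Omega> u \<in> L2 \<Omega> \<and> has_weak_gradient \<Omega> u (weak_grad \<Omega> u)"
    unfolding weak_grad_def by (rule someI_ex)
  moreover have "u \<in> L2 \<Omega>" using assms(2) by (simp add: H1_def)
  ultimately have "\<exists>v g. sob \<Omega> v g \<and> (AE x in lborel. x \<in> \<Omega> \<longrightarrow> u x = v x) \<and>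
      (AE x in lborel. x \<in> \<Omega> \<longrightarrow> weak_grad \<Omega> u x = g x)"
    by (intro weak_gradient_sob[OF assms(1)]) auto
  then show ?thesis by (elim exE conjE) (rule that)
qed

lemma weak_grad_sob:
  assumes \<Omega>: "open \<Omega>" "bounded \<Omega>" and s: "sob \<Omega> v g"
  shows "AE x in lborel. x \<in> \<Omega> \<longrightarrow> weak_grad \<Omega> v x = g x"
proof -
  obtain w h where w: "sob \<Omega> w h" "AE x in lborel. x \<in> \<Omega> \<longrightarrow> v x = w x"
    "AE x in lborel. x \<in> \<Omega> \<longrightarrow> weak_grad \<Omega> v x = h x"
    by (rule H1_representative[OF \<Omega>(1) sob_L2_weak_gradient(4)[OF \<Omega>(1) s]])
  have "AE x in lborel. x \<in> \<Omega> \<longrightarrow> g x = h x" by (rule sob_gradient_unique[OF \<Omega> s w(1,2)])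
  with w(3) show ?thesis by eventually_elim auto
qed

lemma weak_grad_measurable:
  assumes "u \<in> H1 \<Omega>"
  shows "weak_grad \<Omega> u \<in> borel_measurable (lebesgue_on \<Omega>)"
proof -
  have "\<exists>g. g \<in> L2 \<Omega> \<and> has_weak_gradient \<Omega> u g" using assms by (auto simp: H1_def)
  then have "weak_grad \<Omega> u \<in> L2 \<Omega> \<and> has_weak_gradient \<Omega> u (weak_grad \<Omega> u)"
    unfolding weak_grad_def by (rule someI_ex)
  then show ?thesis by (simp add: L2_def)
qed

text \<open>Completeness of H1. For a fixed test function both sides of the weak gradient identity
  are continuous under L2 convergence by Cauchy-Schwarz.\<close>

lemma sob_limit:
  assumes \<Omega>: "open \<Omega>" and s: "\<And>n. sob \<Omega> (v n) (g n)"
    and Cv: "\<And>e. e > 0 \<Longrightarrow> \<exists>N. \<forall>m\<ge>N. \<forall>n\<ge>N. (LINT x|lborel. (v m x - v n x)\<^sup>2) < e"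
    and Cg: "\<And>e. e > 0 \<Longrightarrow> \<exists>N. \<forall>m\<ge>N. \<forall>n\<ge>N. (LINT x|lborel. (norm (g m x - g n x))\<^sup>2) < e"
  obtains w h where "sob \<Omega> w h" "(\<lambda>n. LINT x|lborel. (v n x - w x)\<^sup>2) \<longlonglongrightarrow> 0"
    "(\<lambda>n. LINT x|lborel. (norm (g n x - h x))\<^sup>2) \<longlonglongrightarrow> 0"
proof -
  note [measurable] = sob_measurable[OF s]
  have [measurable]: "\<Omega> \<in> sets borel" using \<Omega> by simp
  \<comment> \<open>An L2 limit is determined only almost everywhere; multiplying by the indicator
    of \<Omega> restores the exact vanishing outside that \<open>sob\<close> asks for.\<close>
  have cut: "\<exists>F'. F' \<in> borel_measurable borel \<and> (\<forall>x. x \<notin> \<Omega> \<longrightarrow> F' x = 0) \<and> integrable lborel (\<lambda>x. (norm (F' x))\<^sup>2) \<and>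
      (\<lambda>n. LINT x|lborel. (norm (f n x - F' x))\<^sup>2) \<longlonglongrightarrow> 0"
    if fm[measurable]: "\<And>n. f n \<in> borel_measurable borel" and f2: "\<And>n. integrable lborel (\<lambda>x. (norm (f n x))\<^sup>2)"
      and f0: "\<And>n x. x \<notin> \<Omega> \<Longrightarrow> f n x = 0"
      and C: "\<And>e. e > 0 \<Longrightarrow> \<exists>N. \<forall>m\<ge>N. \<forall>n\<ge>N. (LINT x|lborel. (norm (f m x - f n x))\<^sup>2) < e"
    for f :: "nat \<Rightarrow> real^2 \<Rightarrow> 'b::euclidean_space"
  proof -
    have "\<And>n. f n \<in> borel_measurable lborel" by simp
    then obtain F where F: "F \<in> borel_measurable lborel" "integrable lborel (\<lambda>x. (norm (F x))\<^sup>2)"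
      "(\<lambda>n. LINT x|lborel. (norm (f n x - F x))\<^sup>2) \<longlonglongrightarrow> 0"
      by (rule square_integrable_complete[OF _ f2 C]) auto
    have [measurable]: "F \<in> borel_measurable borel" using F(1) by simp
    let ?F = "\<lambda>x. indicator \<Omega> x *\<^sub>R F x"
    have i: "integrable lborel (\<lambda>x. (norm (f n x - F x))\<^sup>2)" for n
      using f2 F(2) by (intro square_integrable_diff) auto
    have le: "(norm (f n x - ?F x))\<^sup>2 \<le> (norm (f n x - F x))\<^sup>2" for n x
      using f0[of x n] by (cases "x \<in> \<Omega>") auto
    have i': "integrable lborel (\<lambda>x. (norm (f n x - ?F x))\<^sup>2)" for n
      by (rule Bochner_Integration.integrable_bound[OF i[of n]]) (use le in \<open>auto intro!: AE_I2\<close>)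
    have "(\<lambda>n. LINT x|lborel. (norm (f n x - ?F x))\<^sup>2) \<longlonglongrightarrow> 0"
    proof (rule tendsto_sandwich[OF _ _ tendsto_const F(3)])
      show "\<forall>\<^sub>F n in sequentially. (LINT x|lborel. (norm (f n x - ?F x))\<^sup>2) \<le> (LINT x|lborel. (norm (f n x - F x))\<^sup>2)"
        by (intro always_eventually allI integral_mono i i' le)
    qed (auto intro!: always_eventually)
    moreover have "integrable lborel (\<lambda>x. (norm (?F x))\<^sup>2)"
      by (rule Bochner_Integration.integrable_bound[OF F(2)]) (auto intro!: AE_I2 simp: indicator_def)
    ultimately show ?thesis by (intro exI[of _ ?F]) auto
  qed
  obtain w where w: "w \<in> borel_measurable borel" "\<forall>x. x \<notin> \<Omega> \<longrightarrow> w x = 0" "integrable lborel (\<lambda>x. (w x)\<^sup>2)"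
    "(\<lambda>n. LINT x|lborel. (v n x - w x)\<^sup>2) \<longlonglongrightarrow> 0"
    using cut[of v] sob_measurable(1)[OF s] sob_square(1)[OF s] sob_off(1)[OF s] Cv by auto
  obtain h where h: "h \<in> borel_measurable borel" "\<forall>x. x \<notin> \<Omega> \<longrightarrow> h x = 0" "integrable lborel (\<lambda>x. (norm (h x))\<^sup>2)"
    "(\<lambda>n. LINT x|lborel. (norm (g n x - h x))\<^sup>2) \<longlonglongrightarrow> 0"
    using cut[of g] sob_measurable(2)[OF s] sob_square(2)[OF s] sob_off(2)[OF s] Cg by auto
  note [measurable] = w(1) h(1)
  have lim: "(\<lambda>n. LINT x|lborel. f n x * \<phi> x) \<longlonglongrightarrow> (LINT x|lborel. F x * \<phi> x)"
    if [measurable]: "\<And>n. f n \<in> borel_measurable borel" "F \<in> borel_measurable borel" "\<phi> \<in> borel_measurable borel"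
      and f2: "\<And>n. integrable lborel (\<lambda>x. (f n x)\<^sup>2)" and F2: "integrable lborel (\<lambda>x. (F x)\<^sup>2)"
      and \<phi>2: "integrable lborel (\<lambda>x. (\<phi> x)\<^sup>2)" and c: "(\<lambda>n. LINT x|lborel. (f n x - F x)\<^sup>2) \<longlonglongrightarrow> 0"
    for f :: "nat \<Rightarrow> real^2 \<Rightarrow> real" and F \<phi>
  proof -
    have i: "integrable lborel (\<lambda>x. f n x * \<phi> x)" "integrable lborel (\<lambda>x. F x * \<phi> x)" for n
      by (intro square_integrable_mult f2 F2 \<phi>2; measurable)+
    have d2: "integrable lborel (\<lambda>x. (f n x - F x)\<^sup>2)" for n
      using square_integrable_diff[of "f n" lborel F] f2 F2 by simp
    have le: "((LINT x|lborel. f n x * \<phi> x) - (LINT x|lborel. F x * \<phi> x))\<^sup>2 \<le>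
        (LINT x|lborel. (f n x - F x)\<^sup>2) * (LINT x|lborel. (\<phi> x)\<^sup>2)" for n
      using Cauchy_Schwarz_integral[OF _ _ d2 \<phi>2, of n] i by (simp add: left_diff_distrib)
    have "(\<lambda>n. ((LINT x|lborel. f n x * \<phi> x) - (LINT x|lborel. F x * \<phi> x))\<^sup>2) \<longlonglongrightarrow> 0"
    proof (rule tendsto_sandwich[OF _ _ tendsto_const tendsto_mult_left_zero[OF c]])
      show "\<forall>\<^sub>F n in sequentially. ((LINT x|lborel. f n x * \<phi> x) - (LINT x|lborel. F x * \<phi> x))\<^sup>2 \<le>
          (LINT x|lborel. (f n x - F x)\<^sup>2) * (LINT x|lborel. (\<phi> x)\<^sup>2)"
        by (intro always_eventually allI le)
    qed (auto intro!: always_eventually)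
    then have "(\<lambda>n. (LINT x|lborel. f n x * \<phi> x) - (LINT x|lborel. F x * \<phi> x)) \<longlonglongrightarrow> 0"
      by (simp only: power_tendsto_0_iff[OF pos2])
    then show ?thesis by (simp add: LIM_zero_iff)
  qed
  have "(LINT x|lborel. w x * dir_deriv (axis i 1) \<phi> x) = - (LINT x|lborel. h x $ i * \<phi> x)"
    if \<phi>: "\<phi> \<in> test_functions \<Omega>" for \<phi> i
  proof -
    note tm = test_function_measurable[OF \<phi>] and t2 = test_function_square_integrable[OF \<phi>]
    note [measurable] = tm
    have l1: "(\<lambda>n. LINT x|lborel. v n x * dir_deriv (axis i 1) \<phi> x) \<longlonglongrightarrow> (LINT x|lborel. w x * dir_deriv (axis i 1) \<phi> x)"
      using w sob_square(1)[OF s] t2 by (intro lim) auto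
    have comp: "integrable lborel (\<lambda>x. (f x $ i)\<^sup>2) \<and> (LINT x|lborel. (f x $ i)\<^sup>2) \<le> (LINT x|lborel. (norm (f x))\<^sup>2)"
      if [measurable]: "f \<in> borel_measurable borel" and f: "integrable lborel (\<lambda>x. (norm (f x))\<^sup>2)" for f :: "real^2 \<Rightarrow> real^2"
    proof -
      have le: "(f x $ i)\<^sup>2 \<le> (norm (f x))\<^sup>2" for x
        using component_le_norm_cart[of "f x" i] by (metis abs_ge_zero power2_abs power_mono)
      have "integrable lborel (\<lambda>x. (f x $ i)\<^sup>2)"
        by (rule Bochner_Integration.integrable_bound[OF f]) (use le in \<open>auto intro!: AE_I2\<close>)
      then show ?thesis using integral_mono[OF _ f le] by simp
    qed
    have dh: "integrable lborel (\<lambda>x. (norm (g n x - h x))\<^sup>2)" for n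
      using sob_square(2)[OF s] h(3) by (intro square_integrable_diff) auto
    have "(\<lambda>n. LINT x|lborel. (g n x $ i - h x $ i)\<^sup>2) \<longlonglongrightarrow> 0"
    proof (rule tendsto_sandwich[OF _ _ tendsto_const h(4)])
      show "\<forall>\<^sub>F n in sequentially. (LINT x|lborel. (g n x $ i - h x $ i)\<^sup>2) \<le> (LINT x|lborel. (norm (g n x - h x))\<^sup>2)"
        using comp[OF _ dh] by (intro always_eventually allI) simp
    qed (auto intro!: always_eventually)
    then have l2: "(\<lambda>n. LINT x|lborel. g n x $ i * \<phi> x) \<longlonglongrightarrow> (LINT x|lborel. h x $ i * \<phi> x)"
      using comp sob_square(2)[OF s] h(3) t2 by (intro lim) auto
    have "(\<lambda>n. LINT x|lborel. v n x * dir_deriv (axis i 1) \<phi> x) \<longlonglongrightarrow> - (LINT x|lborel. h x $ i * \<phi> x)"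
      using tendsto_minus[OF l2] sob_weak[OF s \<phi>, of _ i] by simp
    then show ?thesis using l1 LIMSEQ_unique by blast
  qed
  then have "sob \<Omega> w h" unfolding sob_def using w h by blast
  then show ?thesis by (rule that[OF _ w(4) h(4)])
qed

section \<open>Existence of a minimizer\<close>

definition energy :: "(real^2 \<Rightarrow> real^2) \<Rightarrow> (real^2 \<Rightarrow> real^2) \<Rightarrow> real" where
  "energy g h = (LINT x|lborel. g x \<bullet> h x)"

definition wprod :: "real \<Rightarrow> (real^2 \<Rightarrow> real) \<Rightarrow> (real^2 \<Rightarrow> real) \<Rightarrow> real" where
  "wprod a v w = (LINT x|lborel. v x * w x * weight a x)"

lemma energy_sym: "energy g h = energy h g"
  by (simp add: energy_def inner_commute)

lemma wprod_sym: "wprod a v w = wprod a w v"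
  by (simp add: wprod_def mult.commute)

lemma energy_self: "energy g g = (LINT x|lborel. (norm (g x))\<^sup>2)"
  by (simp add: energy_def power2_norm_eq_inner)

lemma wprod_self: "wprod a v v = (LINT x|lborel. (v x)\<^sup>2 * weight a x)"
  by (simp add: wprod_def power2_eq_square)

lemma energy_nonneg: "0 \<le> energy g g"
  by (simp add: energy_self)

lemma wprod_nonneg: "0 \<le> wprod a v v"
  unfolding wprod_self by (intro Bochner_Integration.integral_nonneg) (simp add: weight_nonneg)

lemma energy_lincomb:
  assumes "sob \<Omega> v g" "sob \<Omega> w h" "sob \<Omega> u k"
  shows "energy (\<lambda>x. \<alpha> *\<^sub>R g x + \<beta> *\<^sub>R h x) k = \<alpha> * energy g k + \<beta> * energy h k"
proof -
  note [measurable] = sob_measurable(2)[OF assms(1)] sob_measurable(2)[OF assms(2)] sob_measurable(2)[OF assms(3)]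
  have "integrable lborel (\<lambda>x. g x \<bullet> k x)" "integrable lborel (\<lambda>x. h x \<bullet> k x)"
    by (intro square_integrable_inner sob_square(2)[OF assms(1)] sob_square(2)[OF assms(2)] sob_square(2)[OF assms(3)]; measurable)+
  then show ?thesis by (simp add: energy_def inner_add_left)
qed

lemma energy_quadratic:
  assumes "sob \<Omega> v g" "sob \<Omega> w h"
  shows "energy (\<lambda>x. \<alpha> *\<^sub>R g x + \<beta> *\<^sub>R h x) (\<lambda>x. \<alpha> *\<^sub>R g x + \<beta> *\<^sub>R h x) =
     \<alpha>\<^sup>2 * energy g g + 2 * \<alpha> * \<beta> * energy g h + \<beta>\<^sup>2 * energy h h"
proof -
  let ?s = "\<lambda>x. \<alpha> *\<^sub>R g x + \<beta> *\<^sub>R h x"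
  have 1: "energy g ?s = \<alpha> * energy g g + \<beta> * energy g h"
    using energy_lincomb[OF assms assms(1), of \<alpha> \<beta>] unfolding energy_sym[of g ?s] energy_sym[of g h] .
  have 2: "energy h ?s = \<alpha> * energy g h + \<beta> * energy h h"
    using energy_lincomb[OF assms assms(2), of \<alpha> \<beta>] unfolding energy_sym[of h ?s] .
  have "energy ?s ?s = \<alpha> * energy g ?s + \<beta> * energy h ?s"
    by (rule energy_lincomb[OF assms sob_lincomb[OF assms]])
  then show ?thesis unfolding 1 2 by (simp add: power2_eq_square algebra_simps)
qed

locale hardy_domain =
  fixes \<Omega> :: "(real^2) set" and a :: real
  assumes open_domain: "open \<Omega>" and in_ball: "\<Omega> \<subseteq> ball 0 1" and nonempty: "\<Omega> \<noteq> {}"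
    and smooth: "smooth_boundary \<Omega>" and origin: "0 \<in> closure \<Omega>" and a_gt_1: "a > 1"
begin

lemma bounded_domain: "bounded \<Omega>"
  by (rule bounded_subset[OF bounded_ball in_ball])

lemma domain_measurable [measurable]: "\<Omega> \<in> sets borel"
  using open_domain by simp

lemma weighted_square_integrable:
  assumes "sob \<Omega> v g"
  shows "integrable lborel (\<lambda>x. (v x)\<^sup>2 * weight a x)"
proof -
  have "(4::real) < 5" by simp
  from hardy_inequality[OF open_domain in_ball smooth origin a_gt_1 this] assms show ?thesis by metis
qed

lemma weighted_product_integrable:
  assumes v: "sob \<Omega> v g" and w: "sob \<Omega> w h"
  shows "integrable lborel (\<lambda>x. v x * w x * weight a x)"
proof (rule Bochner_Integration.integrable_bound)
  note [measurable] = sob_measurable(1)[OF v] sob_measurable(1)[OF w]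
  show "integrable lborel (\<lambda>x. (v x)\<^sup>2 * weight a x + (w x)\<^sup>2 * weight a x)"
    using weighted_square_integrable[OF v] weighted_square_integrable[OF w] by simp
  show "(\<lambda>x. v x * w x * weight a x) \<in> borel_measurable lborel" by measurable
  show "AE x in lborel. norm (v x * w x * weight a x) \<le> norm ((v x)\<^sup>2 * weight a x + (w x)\<^sup>2 * weight a x)"
  proof (rule AE_I2)
    fix x
    have "\<bar>v x * w x\<bar> * weight a x \<le> ((v x)\<^sup>2 + (w x)\<^sup>2) * weight a x"
      by (intro mult_right_mono abs_mult_le_squares' weight_nonneg)
    then show "norm (v x * w x * weight a x) \<le> norm ((v x)\<^sup>2 * weight a x + (w x)\<^sup>2 * weight a x)"
      using weight_nonneg[of a x] by (simp add: abs_mult distrib_right)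
  qed
qed

lemma wprod_lincomb:
  assumes "sob \<Omega> v g" "sob \<Omega> w h" "sob \<Omega> u k"
  shows "wprod a (\<lambda>x. \<alpha> * v x + \<beta> * w x) u = \<alpha> * wprod a v u + \<beta> * wprod a w u"
  using weighted_product_integrable[OF assms(1,3)] weighted_product_integrable[OF assms(2,3)]
  by (simp add: wprod_def distrib_right mult.assoc)

lemma wprod_quadratic:
  assumes "sob \<Omega> v g" "sob \<Omega> w h"
  shows "wprod a (\<lambda>x. \<alpha> * v x + \<beta> * w x) (\<lambda>x. \<alpha> * v x + \<beta> * w x) =
     \<alpha>\<^sup>2 * wprod a v v + 2 * \<alpha> * \<beta> * wprod a v w + \<beta>\<^sup>2 * wprod a w w"
proof -
  let ?s = "\<lambda>x. \<alpha> * v x + \<beta> * w x"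
  have 1: "wprod a v ?s = \<alpha> * wprod a v v + \<beta> * wprod a v w"
    using wprod_lincomb[OF assms assms(1), of \<alpha> \<beta>] unfolding wprod_sym[of a v ?s] wprod_sym[of a v w] .
  have 2: "wprod a w ?s = \<alpha> * wprod a v w + \<beta> * wprod a w w"
    using wprod_lincomb[OF assms assms(2), of \<alpha> \<beta>] unfolding wprod_sym[of a w ?s] .
  have "wprod a ?s ?s = \<alpha> * wprod a v ?s + \<beta> * wprod a w ?s"
    by (rule wprod_lincomb[OF assms sob_lincomb[OF assms]])
  then show ?thesis unfolding 1 2 by (simp add: power2_eq_square algebra_simps)
qed

abbreviation one :: "real^2 \<Rightarrow> real" where "one \<equiv> indicator \<Omega>"

lemmas sob_one = sob_indicator[OF open_domain bounded_domain]

text \<open>The logarithm is below its argument, so |x| ln(a / |x|) <= a. A positive lower bound for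
  the weight makes the weighted norm dominate the L2 norm, which bounds minimizing sequences in
  H1.\<close>

lemma weight_pos:
  assumes "x \<in> \<Omega>" "x \<noteq> 0"
  shows "1 \<le> a\<^sup>2 * weight a x"
proof -
  have n: "0 < norm x" "norm x < 1" using subsetD[OF in_ball assms(1)] assms(2) by auto
  define l where "l = ln (a / norm x)"
  have l: "0 < l" using ln_quotient_ge[OF a_gt_1 n] by (simp add: l_def)
  have "l \<le> a / norm x"
    unfolding l_def using ln_le_minus_one[of "a / norm x"] n a_gt_1 by simp
  then have "norm x * l \<le> a" using n by (simp add: pos_le_divide_eq mult.commute)
  then have "(norm x * l)\<^sup>2 \<le> a\<^sup>2" using n l by (intro power_mono) auto
  moreover have "(norm x * l)\<^sup>2 > 0" using n l by simp
  ultimately have "1 \<le> a\<^sup>2 / (norm x * l)\<^sup>2" by simp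
  then show ?thesis by (simp add: weight_def l_def power_mult_distrib)
qed

lemma square_le_weighted:
  assumes s: "sob \<Omega> v g"
  shows "(LINT x|lborel. (v x)\<^sup>2) \<le> a\<^sup>2 * wprod a v v"
proof -
  have "(LINT x|lborel. (v x)\<^sup>2) \<le> (LINT x|lborel. a\<^sup>2 * ((v x)\<^sup>2 * weight a x))"
  proof (rule integral_mono_AE)
    have "AE x in lborel. x \<noteq> (0::real^2)" by (rule AE_lborel_singleton)
    then show "AE x in lborel. (v x)\<^sup>2 \<le> a\<^sup>2 * ((v x)\<^sup>2 * weight a x)"
    proof eventually_elim
      case (elim x)
      show ?case
      proof (cases "x \<in> \<Omega>")
        case True
        from mult_left_mono[OF weight_pos[OF True elim], of "(v x)\<^sup>2"] show ?thesis by (simp add: mult_ac)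
      qed (simp add: sob_off[OF s])
    qed
  qed (use sob_square(1)[OF s] weighted_square_integrable[OF s] in auto)
  then show ?thesis by (simp add: wprod_self)
qed

lemma wprod_eq_0_iff:
  assumes s: "sob \<Omega> v g"
  shows "wprod a v v = 0 \<longleftrightarrow> (AE x in lborel. v x = 0)"
proof
  assume "wprod a v v = 0"
  then have "(LINT x|lborel. (v x)\<^sup>2) = 0"
    using square_le_weighted[OF s] by (intro antisym) simp_all
  then have "AE x in lborel. (v x)\<^sup>2 = 0"
    using integral_nonneg_eq_0_iff_AE[OF sob_square(1)[OF s]] by simp
  then show "AE x in lborel. v x = 0" by simp
next
  assume "AE x in lborel. v x = 0"
  then have "AE x in lborel. (v x)\<^sup>2 * weight a x = 0" by eventually_elim simp
  then show "wprod a v v = 0" unfolding wprod_self by (rule integral_eq_zero_AE)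
qed

lemma wprod_Cauchy_Schwarz:
  assumes v: "sob \<Omega> v g" and w: "sob \<Omega> w h"
  shows "(wprod a v w)\<^sup>2 \<le> wprod a v v * wprod a w w"
proof -
  note [measurable] = sob_measurable(1)[OF v] sob_measurable(1)[OF w]
  have sq: "(u x * sqrt (weight a x))\<^sup>2 = (u x)\<^sup>2 * weight a x" for u x
    by (simp add: power_mult_distrib weight_nonneg)
  have "(LINT x|lborel. (v x * sqrt (weight a x)) * (w x * sqrt (weight a x)))\<^sup>2 \<le>
     (LINT x|lborel. (v x * sqrt (weight a x))\<^sup>2) * (LINT x|lborel. (w x * sqrt (weight a x))\<^sup>2)"
    using weighted_square_integrable[OF v] weighted_square_integrable[OF w]
    by (intro Cauchy_Schwarz_integral) (auto simp: sq)
  moreover have "(v x * sqrt (weight a x)) * (w x * sqrt (weight a x)) = v x * w x * weight a x" for x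
    using weight_nonneg[of a x] real_sqrt_mult_self[of "weight a x"] by (simp add: mult_ac)
  ultimately show ?thesis by (simp add: sq wprod_self wprod_def[of a v w])
qed

definition quotients :: "real set" where
  "quotients = {energy g g / wprod a v v | v g. sob \<Omega> v g \<and> wprod a v one = 0 \<and> 0 < wprod a v v}"

lemma quotients_bdd: "bdd_below quotients"
  by (rule bdd_belowI[of _ 0]) (auto simp: quotients_def energy_nonneg)

text \<open>Below the Hardy constant \<open>1/4\<close> every minimizing sequence is Cauchy: by the parallelogram law
  \<open>energy - \<mu> wprod\<close> tends to \<open>0\<close> on its differences, and the Hardy inequality then bounds the energy of
  a difference by its \<open>L\<^sup>2\<close> norm, which Rellich's theorem makes small.\<close>

theorem minimizer_exists:
  assumes ne: "quotients \<noteq> {}" and lt: "Inf quotients < 1 / 4"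
  obtains v g where "sob \<Omega> v g" "wprod a v one = 0" "0 < wprod a v v"
    "energy g g = Inf quotients * wprod a v v"
    "\<And>w h. sob \<Omega> w h \<Longrightarrow> energy g h = Inf quotients * wprod a v w"
proof -
  define \<mu> where "\<mu> = Inf quotients"
  have \<mu>0: "\<mu> \<ge> 0" unfolding \<mu>_def
    by (rule cInf_greatest[OF ne]) (auto simp: quotients_def energy_nonneg)
  have \<mu>1: "\<mu> < 1 / 4" using lt by (simp add: \<mu>_def)
  define q where "q v g = energy g g - \<mu> * wprod a v v" for v g
  have q0: "0 \<le> q v g" if s: "sob \<Omega> v g" and m: "wprod a v one = 0" for v g
  proof (cases "wprod a v v = 0")
    case True
    then show ?thesis by (simp add: q_def energy_nonneg)
  next
    case False
    then have p: "0 < wprod a v v" using wprod_nonneg[of a v] by linarith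
    then have "\<mu> \<le> energy g g / wprod a v v" unfolding \<mu>_def
      using s m by (intro cInf_lower quotients_bdd) (auto simp: quotients_def)
    then show ?thesis using p by (simp add: q_def pos_le_divide_eq)
  qed
  have q_comb: "q (\<lambda>x. \<alpha> * v x + \<beta> * w x) (\<lambda>x. \<alpha> *\<^sub>R g x + \<beta> *\<^sub>R h x) =
      \<alpha>\<^sup>2 * q v g + 2 * \<alpha> * \<beta> * (energy g h - \<mu> * wprod a v w) + \<beta>\<^sup>2 * q w h"
    if "sob \<Omega> v g" "sob \<Omega> w h" for \<alpha> \<beta> v g w h
    unfolding q_def energy_quadratic[OF that] wprod_quadratic[OF that] by (simp add: algebra_simps)
  have m_comb: "wprod a (\<lambda>x. \<alpha> * v x + \<beta> * w x) one = 0"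
    if "sob \<Omega> v g" "sob \<Omega> w h" "wprod a v one = 0" "wprod a w one = 0" for \<alpha> \<beta> v g w h
    using wprod_lincomb[OF that(1,2) sob_one] that(3,4) by simp
  have parallelogram: "q (\<lambda>x. v x - w x) (\<lambda>x. g x - h x) \<le> 2 * q v g + 2 * q w h"
    if "sob \<Omega> v g" "sob \<Omega> w h" "wprod a v one = 0" "wprod a w one = 0" for v g w h
    using q_comb[OF that(1,2), of 1 1] q_comb[OF that(1,2), of 1 "-1"]
      q0[OF sob_lincomb[OF that(1,2)] m_comb[OF that], of 1 1] by simp
  have mean_diff: "wprod a (\<lambda>x. v x - w x) one = 0"
    if "sob \<Omega> v g" "sob \<Omega> w h" "wprod a v one = 0" "wprod a w one = 0" for v g w h
    using m_comb[OF that, of 1 "-1"] by simp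
  \<comment> \<open>1 / \<kappa> is the midpoint of \<mu> and 1/4, whence \<kappa> > 4 and \<mu>
    \<kappa> < 1.\<close>
  define \<kappa> where "\<kappa> = 2 / (\<mu> + 1 / 4)"
  have \<kappa>: "\<kappa> > 4" using \<mu>0 \<mu>1 by (simp add: \<kappa>_def less_divide_eq)
  have \<mu>\<kappa>: "\<mu> * \<kappa> < 1" using \<mu>0 \<mu>1 by (simp add: \<kappa>_def divide_less_eq)
  obtain C where C: "C \<ge> 0"
    "\<And>v g. sob \<Omega> v g \<Longrightarrow> integrable lborel (\<lambda>x. (v x)\<^sup>2 * weight a x)"
    "\<And>v g. sob \<Omega> v g \<Longrightarrow> (LINT x|lborel. (v x)\<^sup>2 * weight a x) \<le>
        \<kappa> * (LINT x|lborel. (norm (g x))\<^sup>2) + C * (LINT x|lborel. (v x)\<^sup>2)"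
    by (rule hardy_inequality[OF open_domain in_ball smooth origin a_gt_1 \<kappa>]) blast
  have hardy: "wprod a v v \<le> \<kappa> * energy g g + C * (LINT x|lborel. (v x)\<^sup>2)" if "sob \<Omega> v g" for v g
    using C(3)[OF that] by (simp add: wprod_self energy_self)
  have "\<exists>v g. sob \<Omega> v g \<and> wprod a v one = 0 \<and> wprod a v v = 1 \<and> energy g g < \<mu> + 1 / real (Suc n)" for n
  proof -
    have "Inf quotients < \<mu> + 1 / real (Suc n)" by (simp add: \<mu>_def)
    then obtain y where y: "y \<in> quotients" "y < \<mu> + 1 / real (Suc n)"
      using cInf_lessD[OF ne] by blast
    then obtain v g where vg: "sob \<Omega> v g" "wprod a v one = 0" "0 < wprod a v v" "y = energy g g / wprod a v v"
      unfolding quotients_def by blast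
    define t where "t = 1 / sqrt (wprod a v v)"
    have t: "t\<^sup>2 * wprod a v v = 1" using vg(3) by (simp add: t_def power_divide)
    have t2: "t\<^sup>2 = 1 / wprod a v v" using t vg(3) by (simp add: field_simps)
    let ?v = "\<lambda>x. t * v x + 0 * v x" and ?g = "\<lambda>x. t *\<^sub>R g x + 0 *\<^sub>R g x"
    have "sob \<Omega> ?v ?g" by (rule sob_lincomb[OF vg(1,1)])
    moreover have "wprod a ?v one = 0" by (rule m_comb[OF vg(1,1,2,2)])
    moreover have "wprod a ?v ?v = 1" using wprod_quadratic[OF vg(1,1), of t 0] t by simp
    moreover have "energy ?g ?g = y" using energy_quadratic[OF vg(1,1), of t 0] t2 vg(4) by simp
    ultimately show ?thesis using y(2) by blast
  qed
  then obtain v g where vg: "\<And>n. sob \<Omega> (v n) (g n)" "\<And>n. wprod a (v n) one = 0"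
    "\<And>n. wprod a (v n) (v n) = 1" "\<And>n. energy (g n) (g n) < \<mu> + 1 / real (Suc n)"
    by metis
  have qn: "q (v n) (g n) \<le> 1 / real (Suc n)" for n
    using vg(3,4)[of n] by (simp add: q_def)
  define M where "M = max (a\<^sup>2) (\<mu> + 1)"
  have M1: "(LINT x|lborel. (v n x)\<^sup>2) \<le> M" for n
    using square_le_weighted[OF vg(1), of n] vg(3)[of n] by (simp add: M_def)
  have M2: "(LINT x|lborel. (norm (g n x))\<^sup>2) \<le> M" for n
  proof -
    have "1 / real (Suc n) \<le> 1" by simp
    then have "energy (g n) (g n) \<le> \<mu> + 1" using vg(4)[of n] by linarith
    then show ?thesis unfolding M_def energy_self by (rule max.coboundedI2)
  qed
  obtain k :: "nat \<Rightarrow> nat" where k: "strict_mono k"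
    and Cv: "\<And>e. e > 0 \<Longrightarrow> \<exists>N. \<forall>m\<ge>N. \<forall>n\<ge>N. (LINT x|lborel. (v (k m) x - v (k n) x)\<^sup>2) < e"
    by (rule rellich[of \<Omega> v g M, OF open_domain bounded_domain smooth vg(1) M1 M2]) blast
  have qk: "q (v (k n)) (g (k n)) \<le> 1 / real (Suc n)" for n
  proof -
    have "n \<le> k n" using seq_suble[OF k] .
    then have "1 / real (Suc (k n)) \<le> 1 / real (Suc n)" by (intro divide_left_mono) auto
    then show ?thesis using qn[of "k n"] by linarith
  qed
  have Cg: "\<exists>N. \<forall>m\<ge>N. \<forall>n\<ge>N. (LINT x|lborel. (norm (g (k m) x - g (k n) x))\<^sup>2) < e" if e: "e > 0" for e
  proof -
    define \<theta> where "\<theta> = 1 - \<mu> * \<kappa>"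
    have \<theta>: "\<theta> > 0" using \<mu>\<kappa> by (simp add: \<theta>_def)
    \<comment> \<open>The target is \<theta> D < \<theta> e for the energy D of a difference: half
      of the right-hand side is allotted to the L2 norm through d, the other half to the form
      q.\<close>
    define d where "d = e * \<theta> / (2 * (\<mu> * C + 1))"
    have lc: "\<mu> * C + 1 > 0" using \<mu>0 C(1) by (simp add: add_nonneg_pos)
    have d: "d > 0" using e \<theta> lc by (simp add: d_def)
    obtain N1 where N1: "\<forall>m\<ge>N1. \<forall>n\<ge>N1. (LINT x|lborel. (v (k m) x - v (k n) x)\<^sup>2) < d" using Cv[OF d] by blast
    obtain N2 where N2: "1 / real (Suc N2) < e * \<theta> / 8"
      using reals_Archimedean[of "e * \<theta> / 8"] e \<theta> by (auto simp: inverse_eq_divide)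
    have "(LINT x|lborel. (norm (g (k m) x - g (k n) x))\<^sup>2) < e" if mn: "m \<ge> max N1 N2" "n \<ge> max N1 N2" for m n
    proof -
      define D V where "D = energy (\<lambda>x. g (k m) x - g (k n) x) (\<lambda>x. g (k m) x - g (k n) x)"
        and "V = (LINT x|lborel. (v (k m) x - v (k n) x)\<^sup>2)"
      have V: "V < d" using N1 mn by (simp add: V_def)
      have "1 / real (Suc m) \<le> 1 / real (Suc N2)" "1 / real (Suc n) \<le> 1 / real (Suc N2)"
        using mn by (auto intro!: divide_left_mono)
      then have "q (v (k m)) (g (k m)) < e * \<theta> / 8" "q (v (k n)) (g (k n)) < e * \<theta> / 8"
        using qk[of m] qk[of n] N2 by linarith+
      then have "q (\<lambda>x. v (k m) x - v (k n) x) (\<lambda>x. g (k m) x - g (k n) x) < e * \<theta> / 2"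
        using parallelogram[OF vg(1,1,2,2), of "k m" "k n"] by linarith
      then have "D < \<mu> * wprod a (\<lambda>x. v (k m) x - v (k n) x) (\<lambda>x. v (k m) x - v (k n) x) + e * \<theta> / 2"
        by (simp add: q_def D_def)
      also have "\<dots> \<le> \<mu> * (\<kappa> * D + C * V) + e * \<theta> / 2"
        using hardy[OF sob_diff[OF vg(1,1)], of "k m" "k n"] \<mu>0 by (simp add: D_def V_def mult_left_mono)
      finally have "\<theta> * D < \<mu> * C * V + e * \<theta> / 2" by (simp add: \<theta>_def algebra_simps)
      also have "\<mu> * C * V \<le> (\<mu> * C + 1) * d"
        using V \<mu>0 C(1) d by (intro mult_mono) (auto simp: V_def)
      also have "(\<mu> * C + 1) * d = e * \<theta> / 2"
      proof -
        have "X * (Y / (2 * X)) = Y / 2" if "X > 0" for X Y :: real using that by simp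
        from this[OF lc] show ?thesis unfolding d_def .
      qed
      finally have "\<theta> * D < \<theta> * e" by (simp add: mult.commute)
      then have "D < e" using \<theta> by simp
      then show ?thesis by (simp add: D_def energy_self)
    qed
    then show ?thesis by blast
  qed
  obtain w h where wh: "sob \<Omega> w h" and lv: "(\<lambda>n. LINT x|lborel. (v (k n) x - w x)\<^sup>2) \<longlonglongrightarrow> 0"
    and lg: "(\<lambda>n. LINT x|lborel. (norm (g (k n) x - h x))\<^sup>2) \<longlonglongrightarrow> 0"
    by (rule sob_limit[of \<Omega> "\<lambda>n. v (k n)" "\<lambda>n. g (k n)", OF open_domain vg(1) Cv Cg])
  let ?dv = "\<lambda>n x. v (k n) x - w x" and ?dg = "\<lambda>n x. g (k n) x - h x"
  have sd: "sob \<Omega> (?dv n) (?dg n)" for n by (rule sob_diff[OF vg(1) wh])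
  have le_: "(\<lambda>n. energy (?dg n) (?dg n)) \<longlonglongrightarrow> 0" using lg by (simp add: energy_self)
  have lw: "(\<lambda>n. wprod a (?dv n) (?dv n)) \<longlonglongrightarrow> 0"
  proof (rule tendsto_sandwich[OF _ _ tendsto_const])
    show "\<forall>\<^sub>F n in sequentially. 0 \<le> wprod a (?dv n) (?dv n)" by (intro always_eventually allI wprod_nonneg)
    show "\<forall>\<^sub>F n in sequentially. wprod a (?dv n) (?dv n) \<le> \<kappa> * energy (?dg n) (?dg n) + C * (LINT x|lborel. (?dv n x)\<^sup>2)"
      by (intro always_eventually allI hardy sd)
    show "(\<lambda>n. \<kappa> * energy (?dg n) (?dg n) + C * (LINT x|lborel. (?dv n x)\<^sup>2)) \<longlonglongrightarrow> 0"
      using tendsto_add[OF tendsto_mult_right_zero[OF le_, of \<kappa>] tendsto_mult_right_zero[OF lv, of C]] by simp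
  qed
  \<comment> \<open>The zero mean passes to the limit because constants lie in the weighted space,
    so the mean is continuous in the weighted norm.\<close>
  have mw: "wprod a w one = 0"
  proof -
    have "(\<lambda>n. (wprod a (?dv n) one)\<^sup>2) \<longlonglongrightarrow> 0"
    proof (rule tendsto_sandwich[OF _ _ tendsto_const])
      show "\<forall>\<^sub>F n in sequentially. (wprod a (?dv n) one)\<^sup>2 \<le> wprod a (?dv n) (?dv n) * wprod a one one"
        by (intro always_eventually allI wprod_Cauchy_Schwarz[OF sd sob_one])
      show "(\<lambda>n. wprod a (?dv n) (?dv n) * wprod a one one) \<longlonglongrightarrow> 0" by (rule tendsto_mult_left_zero[OF lw])
    qed auto
    moreover have "wprod a (?dv n) one = - wprod a w one" for n
      using wprod_lincomb[OF vg(1)[of "k n"] wh sob_one, of 1 "-1"] vg(2)[of "k n"] by simp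
    ultimately show ?thesis by (simp add: LIMSEQ_const_iff)
  qed
  \<comment> \<open>The normalisation survives: if w had weighted norm 0, every v (k n) - w would
    have weighted norm 1, against \<open>lw\<close>.\<close>
  have half: "0 < wprod a w w"
  proof (rule ccontr)
    assume "\<not> 0 < wprod a w w"
    then have z: "wprod a w w = 0" using wprod_nonneg[of a w] by linarith
    have "wprod a (?dv n) (?dv n) = 1" for n
    proof -
      have "(wprod a (v (k n)) w)\<^sup>2 \<le> 0" using wprod_Cauchy_Schwarz[OF vg(1)[of "k n"] wh] z by simp
      then show ?thesis using wprod_quadratic[OF vg(1)[of "k n"] wh, of 1 "-1"] vg(3)[of "k n"] z by simp
    qed
    then show False using lw by (simp add: LIMSEQ_const_iff)
  qed
  \<comment> \<open>The parallelogram bound again, for w as v (k n) minus the difference v (k n) -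
    w; both forms on the right tend to at most 0.\<close>
  have qw: "q w h = 0"
  proof (rule antisym)
    show "0 \<le> q w h" by (rule q0[OF wh mw])
    have "q w h \<le> 2 * (1 / real (Suc n)) + 2 * energy (?dg n) (?dg n)" for n
    proof -
      have "q w h = q (\<lambda>x. v (k n) x - ?dv n x) (\<lambda>x. g (k n) x - ?dg n x)" by simp
      also have "\<dots> \<le> 2 * q (v (k n)) (g (k n)) + 2 * q (?dv n) (?dg n)"
        by (rule parallelogram[OF vg(1) sd vg(2) mean_diff[OF vg(1) wh vg(2) mw]])
      also have "\<dots> \<le> 2 * (1 / real (Suc n)) + 2 * energy (?dg n) (?dg n)"
        using qk[of n] mult_nonneg_nonneg[OF \<mu>0 wprod_nonneg[of a "?dv n"]] by (simp add: q_def)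
      finally show ?thesis .
    qed
    moreover have "(\<lambda>n. 2 * (1 / real (Suc n)) + 2 * energy (?dg n) (?dg n)) \<longlonglongrightarrow> 0"
      using tendsto_add[OF tendsto_mult_right_zero[OF LIMSEQ_inverse_real_of_nat, of 2] tendsto_mult_right_zero[OF le_, of 2]]
      by (simp add: inverse_eq_divide)
    ultimately show "q w h \<le> 0" by (intro LIMSEQ_le_const) auto
  qed
  have EL0: "energy h k' = \<mu> * wprod a w u" if u: "sob \<Omega> u k'" "wprod a u one = 0" for u k'
  proof -
    define b where "b = energy h k' - \<mu> * wprod a w u"
    \<comment> \<open>First variation: q vanishes at w and is nonnegative on functions of zero mean,
      so in direction u only the linear term 2 t b and t^2 q remain.\<close>
    have nn: "0 \<le> 2 * t * b + t\<^sup>2 * q u k'" for t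
      using q0[OF sob_lincomb[OF wh u(1)] m_comb[OF wh u(1) mw u(2)], of 1 t] q_comb[OF wh u(1), of 1 t] qw
      by (simp add: b_def)
    have "b = 0"
    proof (rule ccontr)
      assume b: "b \<noteq> 0"
      define Q where "Q = q u k'"
      have Q: "Q \<ge> 0" using q0[OF u] by (simp add: Q_def)
      \<comment> \<open>A step against the sign of b, small enough for the linear term to win; Q + 1
        also covers Q = 0.\<close>
      have "0 \<le> 2 * (- b / (Q + 1)) * b + (- b / (Q + 1))\<^sup>2 * Q" using nn[of "- b / (Q + 1)"] by (simp add: Q_def)
      also have "\<dots> = (b / (Q + 1))\<^sup>2 * (Q - 2 * (Q + 1))"
        using Q by (simp add: power2_eq_square divide_simps) (simp add: algebra_simps)
      also have "\<dots> < 0" using b Q by (intro mult_pos_neg) auto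
      finally show False by simp
    qed
    then show ?thesis by (simp add: b_def)
  qed
  \<comment> \<open>The constraint on the test function is dropped by subtracting a constant: its
    gradient is zero and w is orthogonal to it in the weighted product, so no Lagrange multiplier
    for the mean appears.\<close>
  have EL: "energy h k' = \<mu> * wprod a w u" if u: "sob \<Omega> u k'" for u k'
  proof -
    have o: "wprod a one one > 0"
    proof -
      have "\<not> (AE x in lborel. one x = (0::real))"
      proof
        assume "AE x in lborel. one x = (0::real)"
        then have "AE x in lborel. x \<notin> \<Omega>" by eventually_elim (auto simp: indicator_def)
        then have "emeasure lborel {x \<in> space lborel. x \<in> \<Omega>} = 0" by (rule emeasure_eq_0_AE)
        then have "\<Omega> \<in> null_sets lborel" by (simp add: null_sets_def)
        then have "negligible \<Omega>" unfolding negligible_iff_null_sets by (rule null_sets_completionI)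
        then show False using open_not_negligible[OF open_domain nonempty] by blast
      qed
      then show ?thesis using wprod_eq_0_iff[OF sob_one] wprod_nonneg[of a one] by linarith
    qed
    define c where "c = wprod a u one / wprod a one one"
    have s: "sob \<Omega> (\<lambda>x. 1 * u x + (- c) * one x) (\<lambda>x. 1 *\<^sub>R k' x + (- c) *\<^sub>R 0)"
      by (rule sob_lincomb[OF u sob_one])
    have "wprod a (\<lambda>x. 1 * u x + (- c) * one x) one = 0"
      using wprod_lincomb[OF u sob_one sob_one, of 1 "- c"] o by (simp add: c_def)
    from EL0[OF s this] have "energy h k' = \<mu> * wprod a w (\<lambda>x. 1 * u x + (- c) * one x)" by simp
    also have "wprod a w (\<lambda>x. 1 * u x + (- c) * one x) = wprod a w u - c * wprod a w one"
      using wprod_lincomb[OF u sob_one wh, of 1 "- c"]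
      by (simp add: wprod_sym[of a w])
    finally show ?thesis using mw by simp
  qed
  have "energy h h = \<mu> * wprod a w w" using qw by (simp add: q_def)
  then show ?thesis using that[OF wh mw half] EL by (simp add: \<mu>_def)
qed

section \<open>Back to \<open>H1\<close>, \<open>rayleigh\<close> and
  \<open>weak_solution\<close>\<close>

lemma H1_transfer:
  assumes u: "u \<in> H1 \<Omega>" "sob \<Omega> v g" "AE x in lborel. x \<in> \<Omega> \<longrightarrow> u x = v x"
      "AE x in lborel. x \<in> \<Omega> \<longrightarrow> weak_grad \<Omega> u x = g x"
    and p: "p \<in> H1 \<Omega>" "sob \<Omega> w h" "AE x in lborel. x \<in> \<Omega> \<longrightarrow> p x = w x"
      "AE x in lborel. x \<in> \<Omega> \<longrightarrow> weak_grad \<Omega> p x = h x"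
  shows "(LINT x|lebesgue_on \<Omega>. weak_grad \<Omega> u x \<bullet> weak_grad \<Omega> p x) = energy g h"
    and "(LINT x|lebesgue_on \<Omega>. u x * p x * weight a x) = wprod a v w"
proof -
  note [measurable] = sob_measurable[OF u(2)] sob_measurable[OF p(2)] weak_grad_measurable[OF u(1)] weak_grad_measurable[OF p(1)]
  have [measurable]: "u \<in> borel_measurable (lebesgue_on \<Omega>)" "p \<in> borel_measurable (lebesgue_on \<Omega>)"
    using u(1) p(1) by (auto simp: H1_def L2_def)
  have [measurable]: "weight a \<in> borel_measurable (lebesgue_on \<Omega>)"
    by (intro measurable_restrict_space1 measurable_completion) simp
  show "(LINT x|lebesgue_on \<Omega>. weak_grad \<Omega> u x \<bullet> weak_grad \<Omega> p x) = energy g h"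
    unfolding energy_def
  proof (rule lebesgue_on_transfer(1)[OF open_domain])
    show "AE x in lborel. x \<in> \<Omega> \<longrightarrow> weak_grad \<Omega> u x \<bullet> weak_grad \<Omega> p x = g x \<bullet> h x"
      using u(4) p(4) by eventually_elim simp
  qed (use sob_off[OF u(2)] in auto)
  show "(LINT x|lebesgue_on \<Omega>. u x * p x * weight a x) = wprod a v w"
    unfolding wprod_def
  proof (rule lebesgue_on_transfer(1)[OF open_domain])
    show "AE x in lborel. x \<in> \<Omega> \<longrightarrow> u x * p x * weight a x = v x * w x * weight a x"
      using u(3) p(3) by eventually_elim simp
  qed (use sob_off[OF u(2)] in auto)
qed

lemma H1_mean_transfer:
  assumes u: "u \<in> H1 \<Omega>" "sob \<Omega> v g" "AE x in lborel. x \<in> \<Omega> \<longrightarrow> u x = v x"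
  shows "(LINT x|lebesgue_on \<Omega>. u x * weight a x) = wprod a v one"
proof -
  note [measurable] = sob_measurable[OF u(2)]
  have [measurable]: "u \<in> borel_measurable (lebesgue_on \<Omega>)"
    using u(1) by (auto simp: H1_def L2_def)
  have [measurable]: "weight a \<in> borel_measurable (lebesgue_on \<Omega>)"
    by (intro measurable_restrict_space1 measurable_completion) simp
  show ?thesis
    unfolding wprod_def
  proof (rule lebesgue_on_transfer(1)[OF open_domain])
    show "AE x in lborel. x \<in> \<Omega> \<longrightarrow> u x * weight a x = v x * one x * weight a x"
      using u(3) by eventually_elim simp
  qed (use sob_off[OF u(2)] in auto)
qed

lemma rayleigh_eq:
  assumes "u \<in> H1 \<Omega>" "sob \<Omega> v g" "AE x in lborel. x \<in> \<Omega> \<longrightarrow> u x = v x"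
      "AE x in lborel. x \<in> \<Omega> \<longrightarrow> weak_grad \<Omega> u x = g x"
  shows "rayleigh a \<Omega> u = energy g g / wprod a v v"
  using H1_transfer[OF assms assms] by (simp add: rayleigh_def power2_norm_eq_inner power2_eq_square[of "u _"])

lemma H1_zero_iff:
  assumes "sob \<Omega> v g" "AE x in lborel. x \<in> \<Omega> \<longrightarrow> u x = v x"
  shows "H1_zero \<Omega> u \<longleftrightarrow> wprod a v v = 0"
proof -
  have "(AE x in lborel. x \<in> \<Omega> \<longrightarrow> u x = 0) \<longleftrightarrow> (AE x in lborel. v x = 0)"
  proof
    assume "AE x in lborel. x \<in> \<Omega> \<longrightarrow> u x = 0"
    with assms(2) show "AE x in lborel. v x = 0"
      by eventually_elim (use sob_off(1)[OF assms(1)] in auto)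
  next
    assume "AE x in lborel. v x = 0"
    with assms(2) show "AE x in lborel. x \<in> \<Omega> \<longrightarrow> u x = 0" by eventually_elim auto
  qed
  then show ?thesis
    by (simp add: H1_zero_def AE_lebesgue_on_iff[OF open_domain] wprod_eq_0_iff[OF assms(1)])
qed

lemma sob_representative:
  assumes "sob \<Omega> v g"
  shows "v \<in> H1 \<Omega>" "AE x in lborel. x \<in> \<Omega> \<longrightarrow> v x = v x" "AE x in lborel. x \<in> \<Omega> \<longrightarrow> weak_grad \<Omega> v x = g x"
  using sob_L2_weak_gradient(4)[OF open_domain assms] weak_grad_sob[OF open_domain bounded_domain assms] by auto

lemma lambda_inf_eq: "lambda_inf a \<Omega> = Inf quotients"
proof -
  have "rayleigh a \<Omega> ` admissible_functions a \<Omega> = quotients"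
  proof (intro set_eqI iffI)
    fix y assume "y \<in> rayleigh a \<Omega> ` admissible_functions a \<Omega>"
    then obtain u where u: "u \<in> H1 \<Omega>" "\<not> H1_zero \<Omega> u" "(LINT x|lebesgue_on \<Omega>. u x * weight a x) = 0" "y = rayleigh a \<Omega> u"
      by (auto simp: admissible_functions_def)
    obtain v g where v: "sob \<Omega> v g" "AE x in lborel. x \<in> \<Omega> \<longrightarrow> u x = v x" "AE x in lborel. x \<in> \<Omega> \<longrightarrow> weak_grad \<Omega> u x = g x"
      by (rule H1_representative[OF open_domain u(1)])
    have "wprod a v v \<noteq> 0" using u(2) H1_zero_iff[OF v(1,2)] by simp
    then have "0 < wprod a v v" using wprod_nonneg[of a v] by linarith
    moreover have "wprod a v one = 0" using u(3) H1_mean_transfer[OF u(1) v(1,2)] by simp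
    moreover have "y = energy g g / wprod a v v" using u(4) rayleigh_eq[OF u(1) v] by simp
    ultimately show "y \<in> quotients" using v(1) by (auto simp: quotients_def)
  next
    fix y assume "y \<in> quotients"
    then obtain v g where v: "sob \<Omega> v g" "wprod a v one = 0" "0 < wprod a v v" "y = energy g g / wprod a v v"
      unfolding quotients_def by blast
    note r = sob_representative[OF v(1)]
    have "v \<in> admissible_functions a \<Omega>"
      using r v H1_zero_iff[OF v(1) r(2)] H1_mean_transfer[OF r(1) v(1) r(2)] by (simp add: admissible_functions_def)
    moreover have "y = rayleigh a \<Omega> v" using rayleigh_eq[OF r(1) v(1) r(2,3)] v(4) by simp
    ultimately show "y \<in> rayleigh a \<Omega> ` admissible_functions a \<Omega>" by blast
  qed
  then show ?thesis by (simp add: lambda_inf_def)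
qed

text \<open>Reduces both cases of the theorem to exhibiting one function of zero weighted mean with
  quotient below 1/4.\<close>

theorem second_eigenfunction_exists:
  assumes t: "sob \<Omega> t \<tau>" "wprod a t one = 0" "energy \<tau> \<tau> < wprod a t t / 4"
  shows "\<exists>u. second_eigenfunction a \<Omega> u"
proof -
  have pos: "0 < wprod a t t" using t(3) energy_nonneg[of \<tau>] by linarith
  have el: "energy \<tau> \<tau> / wprod a t t \<in> quotients" using t pos by (auto simp: quotients_def)
  have "energy \<tau> \<tau> / wprod a t t < 1 / 4" using t(3) pos by (simp add: divide_less_eq)
  then have "Inf quotients < 1 / 4" using cInf_lower[OF el quotients_bdd] by linarith
  then obtain v g where v: "sob \<Omega> v g" "wprod a v one = 0" "0 < wprod a v v"
    "energy g g = Inf quotients * wprod a v v"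
    and EL: "\<And>w h. sob \<Omega> w h \<Longrightarrow> energy g h = Inf quotients * wprod a v w"
    using minimizer_exists el by (metis empty_iff)
  note r = sob_representative[OF v(1)]
  have "v \<in> admissible_functions a \<Omega>"
    using r v H1_zero_iff[OF v(1) r(2)] H1_mean_transfer[OF r(1) v(1) r(2)] by (simp add: admissible_functions_def)
  moreover have "rayleigh a \<Omega> v = lambda_inf a \<Omega>"
    using rayleigh_eq[OF r(1) v(1) r(2,3)] v(3,4) by (simp add: lambda_inf_eq)
  moreover have "weak_solution a \<Omega> (lambda_inf a \<Omega>) v"
    unfolding weak_solution_def
  proof (intro conjI ballI)
    fix p assume p: "p \<in> H1 \<Omega>"
    obtain w h where w: "sob \<Omega> w h" "AE x in lborel. x \<in> \<Omega> \<longrightarrow> p x = w x" "AE x in lborel. x \<in> \<Omega> \<longrightarrow> weak_grad \<Omega> p x = h x"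
      by (rule H1_representative[OF open_domain p])
    show "(LINT x|lebesgue_on \<Omega>. weak_grad \<Omega> v x \<bullet> weak_grad \<Omega> p x) =
        lambda_inf a \<Omega> * (LINT x|lebesgue_on \<Omega>. v x * p x * weight a x)"
      using H1_transfer[OF r(1) v(1) r(2,3) p w] EL[OF w(1)] by (simp add: lambda_inf_eq)
  qed (rule r(1))
  ultimately show ?thesis by (auto simp: second_eigenfunction_def)
qed

end

section \<open>Reflections\<close>

definition reflection :: "'a::euclidean_space \<Rightarrow> 'a \<Rightarrow> 'a" where
  "reflection n x = x - (2 * (x \<bullet> n)) *\<^sub>R n"

lemma reflection_orthogonal:
  assumes "norm n = 1"
  shows "orthogonal_transformation (reflection n)" "reflection n (reflection n x) = x"
    "reflection n x \<bullet> y = x \<bullet> reflection n y" "norm (reflection n x) = norm x"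
proof -
  have n: "n \<bullet> n = 1" using assms by (simp add: norm_eq_1)
  have lin: "linear (reflection n)"
    by (rule linearI) (simp_all add: reflection_def inner_add_left algebra_simps)
  have inn: "reflection n x \<bullet> reflection n y = x \<bullet> y" for x y
    by (simp add: reflection_def inner_diff_left inner_diff_right n inner_commute algebra_simps)
  show o: "orthogonal_transformation (reflection n)"
    using lin inn by (simp add: orthogonal_transformation_def)
  show "reflection n (reflection n x) = x"
    by (simp add: reflection_def inner_diff_left n algebra_simps)
  show "reflection n x \<bullet> y = x \<bullet> reflection n y"
    by (simp add: reflection_def inner_diff_left inner_diff_right inner_commute)
  show "norm (reflection n x) = norm x"
    using inn[of x x] by (simp add: norm_eq_sqrt_inner)
qed

text \<open>An orthogonal map preserves the measure of every box, and the values on boxes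
  characterise \<open>lborel\<close>.\<close>

lemma lborel_reflection:
  fixes n :: "real^2"
  assumes n: "norm n = 1"
  shows "distr lborel borel (reflection n) = lborel"
proof (rule lborel_eqI[symmetric])
  note r = reflection_orthogonal[OF n]
  have m[measurable]: "reflection n \<in> borel_measurable borel"
    unfolding reflection_def[abs_def] by measurable
  fix l u :: "real^2"
  assume lu: "\<And>b. b \<in> Basis \<Longrightarrow> l \<bullet> b \<le> u \<bullet> b"
  let ?B = "box l u"
  have eq: "reflection n -` ?B = reflection n ` ?B"
    using r(2) by (auto simp: image_iff) metis
  have S: "reflection n -` ?B \<in> sets borel"
    using measurable_sets[OF m, of ?B] by simp
  have bd: "bounded (reflection n ` ?B)"
    using r(1) by (intro bounded_linear_image bounded_box) (simp add: orthogonal_transformation_linear linear_conv_bounded_linear[symmetric])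
  have "measure lborel (reflection n ` ?B) = measure lebesgue (reflection n ` ?B)"
    using S eq by (simp add: measure_completion)
  also have "\<dots> = measure lebesgue ?B"
    by (rule measure_orthogonal_image[OF r(1)]) simp
  also have "\<dots> = measure lborel ?B" by (simp add: measure_completion)
  finally have me: "measure lborel (reflection n ` ?B) = measure lborel ?B" .
  have "emeasure (distr lborel borel (reflection n)) ?B = emeasure lborel (reflection n ` ?B)"
    by (simp add: emeasure_distr eq)
  also have "\<dots> = ennreal (measure lborel (reflection n ` ?B))"
    using emeasure_bounded_finite[OF bd] by (intro emeasure_eq_ennreal_measure) (auto simp: less_top)
  also have "\<dots> = ennreal (measure lborel ?B)" by (simp only: me)
  also have "\<dots> = emeasure lborel ?B"
    using emeasure_bounded_finite[of ?B] by (intro emeasure_eq_ennreal_measure[symmetric]) (auto simp: less_top)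
  also have "\<dots> = (\<Prod>b\<in>Basis. (u - l) \<bullet> b)" using lu by (simp add: emeasure_lborel_box)
  finally show "emeasure (distr lborel borel (reflection n)) ?B = (\<Prod>b\<in>Basis. (u - l) \<bullet> b)" .
qed simp

lemma integral_reflection:
  fixes n :: "real^2" and f :: "real^2 \<Rightarrow> real"
  assumes "norm n = 1" and [measurable]: "f \<in> borel_measurable borel"
  shows "(LINT x|lborel. f (reflection n x)) = (LINT x|lborel. f x)"
proof -
  have [measurable]: "reflection n \<in> borel_measurable borel"
    unfolding reflection_def[abs_def] by measurable
  have "(LINT x|lborel. f x) = (LINT x|distr lborel borel (reflection n). f x)"
    by (simp add: lborel_reflection[OF assms(1)])
  also have "\<dots> = (LINT x|lborel. f (reflection n x))" by (rule integral_distr) auto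
  finally show ?thesis by simp
qed

lemma weight_cong_norm: "norm x = norm y \<Longrightarrow> weight a x = weight a y"
  by (simp add: weight_def)

section \<open>The linear trial function\<close>

lemma orthonormal_coordinates:
  fixes e :: "real^2"
  assumes "norm e = 1"
  defines "f \<equiv> vector [- (e $ 2), e $ 1]"
  shows "norm f = 1" "e \<bullet> f = 0" "(x \<bullet> e)\<^sup>2 + (x \<bullet> f)\<^sup>2 = (norm x)\<^sup>2"
    "x = (x \<bullet> e) *\<^sub>R e + (x \<bullet> f) *\<^sub>R f"
proof -
  have e: "(e $ 1)\<^sup>2 + (e $ 2)\<^sup>2 = 1"
    using assms(1) unfolding norm_eq_1 by (simp add: inner_vec_def sum_2 power2_eq_square)
  have f: "f $ 1 = - (e $ 2)" "f $ 2 = e $ 1" by (simp_all add: f_def)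
  show "norm f = 1" unfolding norm_eq_1 using e by (simp add: inner_vec_def sum_2 f power2_eq_square add.commute)
  show "e \<bullet> f = 0" by (simp add: inner_vec_def sum_2 f)
  have "(x \<bullet> e)\<^sup>2 + (x \<bullet> f)\<^sup>2 = ((e $ 1)\<^sup>2 + (e $ 2)\<^sup>2) * ((x $ 1)\<^sup>2 + (x $ 2)\<^sup>2)"
    by (simp add: inner_vec_def sum_2 f power2_eq_square algebra_simps)
  also have "(x $ 1)\<^sup>2 + (x $ 2)\<^sup>2 = (norm x)\<^sup>2"
    unfolding power2_norm_eq_inner by (simp add: inner_vec_def sum_2 power2_eq_square)
  finally show "(x \<bullet> e)\<^sup>2 + (x \<bullet> f)\<^sup>2 = (norm x)\<^sup>2" using e by simp
  have "(x \<bullet> e) * e $ 1 + (x \<bullet> f) * f $ 1 = ((e $ 1)\<^sup>2 + (e $ 2)\<^sup>2) * x $ 1"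
    "(x \<bullet> e) * e $ 2 + (x \<bullet> f) * f $ 2 = ((e $ 1)\<^sup>2 + (e $ 2)\<^sup>2) * x $ 2"
    by (simp_all add: inner_vec_def sum_2 f power2_eq_square algebra_simps)
  then show "x = (x \<bullet> e) *\<^sub>R e + (x \<bullet> f) *\<^sub>R f"
    using e by (simp add: vec_eq_iff forall_2)
qed

text \<open>The mirror is the bisector of e and f, so its unit normal is (e - f) / sqrt 2. It
  carries the integral of (x \<bullet> e)^2 W over a centred ball to the one with f.\<close>

lemma orthonormal_reflection:
  assumes "norm e = 1" "norm f = 1" "e \<bullet> f = 0"
  obtains n where "norm n = 1" "reflection n e = f"
proof -
  let ?n = "(1 / sqrt 2) *\<^sub>R (e - f)"
  have ef: "e \<bullet> e = 1" "f \<bullet> f = 1" using assms by (simp_all add: norm_eq_1)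
  have "(e - f) \<bullet> (e - f) = 2"
    using ef assms(3) by (simp add: inner_diff_left inner_diff_right inner_commute)
  then have "norm (e - f) = sqrt 2" by (simp add: norm_eq_sqrt_inner)
  then have "norm ?n = 1" by simp
  moreover have "reflection ?n e = f"
  proof -
    have en: "e \<bullet> ?n = 1 / sqrt 2" using ef assms(3) by (simp add: inner_diff_right)
    have "2 * (1 / sqrt 2) * (1 / sqrt 2) = (1::real)" by simp
    moreover have "reflection ?n e = e - (2 * (1 / sqrt 2) * (1 / sqrt 2)) *\<^sub>R (e - f)"
      unfolding reflection_def en by (simp only: scaleR_scaleR)
    ultimately show ?thesis by simp
  qed
  ultimately show ?thesis using that by blast
qed

context hardy_domain
begin

lemma linear_trial:
  assumes L: "ball 0 L \<subseteq> \<Omega>" "8 * pi < (LINT x|lebesgue_on (ball (0 :: real^2) L). 1 / (ln (a / norm x))\<^sup>2)"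
  shows "\<exists>u. second_eigenfunction a \<Omega> u"
proof -
  have lin: "sob \<Omega> (\<lambda>x. one x * (x \<bullet> e)) (\<lambda>x. one x *\<^sub>R e)" for e :: "real^2"
  proof -
    have "(\<chi> i. axis i 1 \<bullet> e) = e" by (simp add: vec_eq_iff inner_axis')
    moreover have "((\<lambda>x. x \<bullet> e) has_derivative (\<lambda>h. h \<bullet> e)) (at x)" for x
      by (auto intro!: derivative_eq_intros)
    ultimately show ?thesis
      using sob_C1[OF open_domain bounded_domain, of "\<lambda>x. x \<bullet> e" "\<lambda>x h. h \<bullet> e"] by simp
  qed
  define m where "m i = wprod a (\<lambda>x. one x * (x \<bullet> axis i 1)) one" for i :: 2
  \<comment> \<open>The moment vector m turned by a right angle and normalised; any unit vector will
    do if m = 0.\<close>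
  obtain e :: "real^2" where e: "norm e = 1" "e $ 1 * m 1 + e $ 2 * m 2 = 0"
  proof (cases "m 1 = 0 \<and> m 2 = 0")
    case True
    then show ?thesis using that[of "axis 1 1"] by simp
  next
    case False
    define s where "s = sqrt ((m 1)\<^sup>2 + (m 2)\<^sup>2)"
    have s: "s > 0" using False by (simp add: s_def sum_power2_gt_zero_iff)
    let ?e = "vector [- m 2 / s, m 1 / s] :: real^2"
    have s2: "(m 2)\<^sup>2 + (m 1)\<^sup>2 = s\<^sup>2" by (simp add: s_def)
    have "?e \<bullet> ?e = ((m 2)\<^sup>2 + (m 1)\<^sup>2) / s\<^sup>2"
      by (simp add: inner_vec_def sum_2 power2_eq_square add_divide_distrib)
    then have "?e \<bullet> ?e = 1" unfolding s2 using s by simp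
    then show ?thesis using that[of ?e] by (simp add: norm_eq_1 mult.commute)
  qed
  let ?t = "\<lambda>x. one x * (x \<bullet> e)" and ?g = "\<lambda>x. one x *\<^sub>R e"
  have mean: "wprod a ?t one = 0"
  proof -
    have "?t = (\<lambda>x. e $ 1 * (one x * (x \<bullet> axis 1 1)) + e $ 2 * (one x * (x \<bullet> axis 2 1)))"
      by (rule ext) (simp add: inner_axis inner_vec_def[of _ e] sum_2 algebra_simps)
    then show ?thesis using wprod_lincomb[OF lin lin sob_one, of "e $ 1" "axis 1 1" "e $ 2" "axis 2 1"] e(2)
      by (simp add: m_def)
  qed
  have energy: "energy ?g ?g \<le> pi"
  proof -
    have "energy ?g ?g = (LINT x|lborel. one x)"
      unfolding energy_self by (rule Bochner_Integration.integral_cong) (auto simp: indicator_def e(1))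
    also have "\<dots> \<le> (LINT x|lborel. indicat_real (ball 0 1 :: (real^2) set) x)"
      using in_ball by (intro integral_mono integrable_indicator_bounded bounded_domain) (auto simp: indicator_def)
    also have "\<dots> = pi" using circle_area[of 1 0] by simp
    finally show ?thesis .
  qed
  let ?B = "ball 0 L :: (real^2) set"
  have [measurable]: "?B \<in> sets borel" by simp
  define f :: "real^2" where "f = vector [- (e $ 2), e $ 1]"
  note f = orthonormal_coordinates[OF e(1), folded f_def]
  obtain n where n: "norm n = 1" "reflection n e = f" by (rule orthonormal_reflection[OF e(1) f(1,2)])
  define I where "I z = (LINT x|lborel. indicator ?B x * ((x \<bullet> z)\<^sup>2 * weight a x))" for z
  have Iint: "integrable lborel (\<lambda>x. indicator ?B x * ((x \<bullet> z)\<^sup>2 * weight a x))" for z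
  proof -
    have "integrable lborel (\<lambda>x. indicator ?B x *\<^sub>R ((one x * (x \<bullet> z))\<^sup>2 * weight a x))"
      by (intro integrable_mult_indicator weighted_square_integrable[OF lin]) simp
    moreover have "indicator ?B x *\<^sub>R ((one x * (x \<bullet> z))\<^sup>2 * weight a x) = indicator ?B x * ((x \<bullet> z)\<^sup>2 * weight a x)" for x
      using L(1) by (auto simp: indicator_def)
    ultimately show ?thesis by (simp only:)
  qed
  have "I e = (LINT x|lborel. indicator ?B (reflection n x) * ((reflection n x \<bullet> e)\<^sup>2 * weight a (reflection n x)))"
    unfolding I_def by (rule integral_reflection[OF n(1), symmetric]) measurable
  also have "\<dots> = I f"
    unfolding I_def by (rule Bochner_Integration.integral_cong)
      (simp_all add: reflection_orthogonal[OF n(1)] n(2) indicator_def weight_cong_norm[OF reflection_orthogonal(4)[OF n(1)]])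
  finally have Ief: "I e = I f" .
  have bm: "h \<in> borel_measurable (lebesgue_on ?B)" if "h \<in> borel_measurable borel" for h :: "real^2 \<Rightarrow> real"
    using that by (intro measurable_restrict_space1 measurable_completion) simp
  have "(LINT x|lebesgue_on ?B. 1 / (ln (a / norm x))\<^sup>2) = (LINT x|lborel. indicator ?B x * ((norm x)\<^sup>2 * weight a x))"
  proof (rule lebesgue_on_transfer(1))
    have "AE x in lborel. x \<noteq> (0::real^2)" by (rule AE_lborel_singleton)
    then show "AE x in lborel. x \<in> ?B \<longrightarrow> 1 / (ln (a / norm x))\<^sup>2 = indicator ?B x * ((norm x)\<^sup>2 * weight a x)"
      by eventually_elim (simp add: weight_def)
    show "(\<lambda>x. 1 / (ln (a / norm x))\<^sup>2) \<in> borel_measurable (lebesgue_on ?B)" by (rule bm) measurable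
    show "(\<lambda>x. indicator ?B x * ((norm x)\<^sup>2 * weight a x)) \<in> borel_measurable borel" by measurable
  qed auto
  also have "\<dots> = (LINT x|lborel. indicator ?B x * ((x \<bullet> e)\<^sup>2 * weight a x) + indicator ?B x * ((x \<bullet> f)\<^sup>2 * weight a x))"
    by (rule Bochner_Integration.integral_cong) (simp_all add: f(3)[symmetric] distrib_left distrib_right)
  also have "\<dots> = I e + I f" using Iint by (simp add: I_def)
  \<comment> \<open>The two coordinate integrals are equal and add up to more than 8 \<pi>.\<close>
  finally have "4 * pi < I e" using L(2) Ief by simp
  also have "I e \<le> wprod a ?t ?t"
    unfolding I_def wprod_self
  proof (rule integral_mono[OF Iint weighted_square_integrable[OF lin]])
    show "indicator ?B x * ((x \<bullet> e)\<^sup>2 * weight a x) \<le> (one x * (x \<bullet> e))\<^sup>2 * weight a x" for x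
      using L(1) weight_nonneg[of a x] by (auto simp: indicator_def)
  qed
  finally have "energy ?g ?g < wprod a ?t ?t / 4" using energy by simp
  then show ?thesis by (rule second_eigenfunction_exists[OF lin mean])
qed

end

section \<open>A trial function near the unit circle\<close>

text \<open>A point of the disc near the middle of the arc has polar angle \<theta> + \<phi> with
  \<phi> the arcsine of its normalised tangential coordinate. Measuring the angle relative to
  \<theta> avoids any choice of branch.\<close>

lemma sector_contains_cap:
  assumes "\<delta> > 0" "\<theta>1 < \<theta>2"
    and sector: "\<And>r \<theta>. 0 < r \<Longrightarrow> 1 - \<delta> < r \<Longrightarrow> r < 1 \<Longrightarrow> \<theta>1 < \<theta> \<Longrightarrow> \<theta> < \<theta>2 \<Longrightarrow>
        (vector [r * cos \<theta>, r * sin \<theta>] :: real^2) \<in> \<Omega>"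
  shows "\<exists>p \<rho>. norm p = 1 \<and> \<rho> > 0 \<and> (\<forall>x. norm x < 1 \<longrightarrow> dist x p < \<rho> \<longrightarrow> x \<in> \<Omega>)"
proof -
  define \<theta> where "\<theta> = (\<theta>1 + \<theta>2) / 2"
  \<comment> \<open>Half the width of the sector, capped at \<pi> / 2 so that the sine can be
    inverted on [-w, w].\<close>
  define w where "w = min ((\<theta>2 - \<theta>1) / 2) (pi / 2)"
  have "0 < w" using assms(2) by (simp add: w_def)
  moreover have "w \<le> pi / 2" unfolding w_def by (rule min.cobounded2)
  moreover have "w \<le> (\<theta>2 - \<theta>1) / 2" unfolding w_def by (rule min.cobounded1)
  ultimately have w: "0 < w" "w \<le> pi / 2" "w \<le> (\<theta>2 - \<theta>1) / 2" by blast+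
  have sw: "0 < sin w" using w pi_gt_zero by (intro sin_gt_zero) linarith+
  \<comment> \<open>\<delta> takes care of the radius; 1/2 gives r > 1/2 and a positive coordinate
    along p; and sin w / 2 gives |B / r| < 2 \<rho> <= sin w.\<close>
  define \<rho> where "\<rho> = min \<delta> (min (1 / 2) (sin w / 2))"
  have "\<rho> \<le> \<delta>" unfolding \<rho>_def by (rule min.cobounded1)
  moreover have "\<rho> \<le> 1 / 2" unfolding \<rho>_def by (rule min.coboundedI2[OF min.cobounded1])
  moreover have "\<rho> \<le> sin w / 2" unfolding \<rho>_def by (rule min.coboundedI2[OF min.cobounded2])
  moreover have "0 < \<rho>" using assms(1) sw by (simp add: \<rho>_def)
  ultimately have \<rho>: "0 < \<rho>" "\<rho> \<le> \<delta>" "\<rho> \<le> 1 / 2" "2 * \<rho> \<le> sin w" by simp_all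
  define p :: "real^2" where "p = vector [cos \<theta>, sin \<theta>]"
  define \<tau> :: "real^2" where "\<tau> = vector [- sin \<theta>, cos \<theta>]"
  have p: "norm p = 1" unfolding norm_eq_1 by (simp add: p_def inner_vec_def sum_2 flip: power2_eq_square)
  have \<tau>: "\<tau> = vector [- (p $ 2), p $ 1]" by (simp add: \<tau>_def p_def)
  note o = orthonormal_coordinates[OF p, folded \<tau>]
  have "x \<in> \<Omega>" if x: "norm x < 1" "dist x p < \<rho>" for x
  proof -
    define r A B where "r = norm x" and "A = x \<bullet> p" and "B = x \<bullet> \<tau>"
    have "norm p \<le> norm x + dist x p" by (metis dist_commute dist_norm norm_triangle_sub)
    then have r: "r > 1 - \<rho>" "r < 1" using x p by (auto simp: r_def)
    have r0: "r > 1 / 2" using r \<rho> by simp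
    have AB: "A\<^sup>2 + B\<^sup>2 = r\<^sup>2" using o(3)[of x] by (simp add: A_def B_def r_def)
    have "\<bar>(x - p) \<bullet> \<tau>\<bar> \<le> norm (x - p)" using Cauchy_Schwarz_ineq2[of "x - p" \<tau>] o(1) by simp
    then have B: "\<bar>B\<bar> < \<rho>" using x(2) o(2) by (simp add: B_def inner_diff_left dist_norm)
    have "\<bar>(x - p) \<bullet> p\<bar> \<le> norm (x - p)" using Cauchy_Schwarz_ineq2[of "x - p" p] p by simp
    moreover have "(x - p) \<bullet> p = A - 1" using p by (simp add: A_def inner_diff_left norm_eq_1)
    ultimately have A: "A > 0" using x(2) \<rho> by (simp add: dist_norm abs_le_iff)
    have Br: "\<bar>B / r\<bar> < sin w"
    proof -
      have "\<bar>B\<bar> < (2 * \<rho>) * (1 / 2)" using B by simp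
      also have "\<dots> \<le> sin w * r" using \<rho> r0 by (intro mult_mono) auto
      finally show ?thesis using r0 by (simp add: abs_divide divide_less_eq)
    qed
    define \<phi> where "\<phi> = arcsin (B / r)"
    have B1: "-1 \<le> B / r" "B / r \<le> 1" using Br sin_le_one[of w] by linarith+
    have s\<phi>: "sin \<phi> = B / r" unfolding \<phi>_def by (rule sin_arcsin[OF B1])
    have c\<phi>: "cos \<phi> = A / r"
    proof -
      have "cos \<phi> = sqrt (1 - (B / r)\<^sup>2)" unfolding \<phi>_def by (rule cos_arcsin[OF B1])
      also have "1 - (B / r)\<^sup>2 = (A / r)\<^sup>2" using AB r0 by (simp add: power_divide field_simps)
      finally show ?thesis using A r0 by simp
    qed
    have \<phi>: "\<bar>\<phi>\<bar> < w"
    proof -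
      have "B / r < sin w" "- sin w < B / r" using Br by linarith+
      then have "arcsin (B / r) < arcsin (sin w)" "arcsin (- sin w) < arcsin (B / r)"
        using B1 sin_le_one[of w] by (intro arcsin_less_arcsin; linarith)+
      moreover have "arcsin (sin w) = w" using w by (intro arcsin_sin) auto
      moreover have "arcsin (- sin w) = - w"
        using arcsin_sin[of "- w"] w by simp
      ultimately show ?thesis by (simp add: \<phi>_def)
    qed
    have "x = vector [r * cos (\<theta> + \<phi>), r * sin (\<theta> + \<phi>)]"
    proof -
      have "x $ 1 = A * p $ 1 + B * \<tau> $ 1" "x $ 2 = A * p $ 2 + B * \<tau> $ 2"
        using o(4)[of x] unfolding A_def B_def
        by (metis vector_add_component vector_scaleR_component real_scaleR_def)+
      moreover have "r * cos (\<theta> + \<phi>) = A * cos \<theta> - B * sin \<theta>" "r * sin (\<theta> + \<phi>) = A * sin \<theta> + B * cos \<theta>"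
        unfolding cos_add sin_add s\<phi> c\<phi> using r0 by (simp_all add: field_simps)
      ultimately show ?thesis by (simp add: vec_eq_iff forall_2 p_def \<tau>_def)
    qed
    moreover have "vector [r * cos (\<theta> + \<phi>), r * sin (\<theta> + \<phi>)] \<in> \<Omega>"
      using r r0 \<phi> w \<rho> by (intro sector) (auto simp: \<theta>_def field_simps abs_less_iff)
    ultimately show ?thesis by simp
  qed
  then show ?thesis using p \<rho>(1) by blast
qed

lemma weight_ge_near_sphere:
  fixes x :: "real^2"
  assumes "1 < a" "a - 1 \<le> t" "0 < t" "t \<le> 1 / 4" "1 - 3 / 2 * t < norm x" "norm x < 1"
  shows "1 / (16 * t\<^sup>2) \<le> weight a x"
proof -
  define r where "r = norm x"
  have r: "5 / 8 < r" "r < 1" "1 - r < 3 / 2 * t" using assms by (auto simp: r_def)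
  have l0: "0 < ln (a / r)" using ln_quotient_ge(2)[of a r] assms(1) r by simp
  have "ln (a / r) \<le> a / r - 1" using ln_le_minus_one[of "a / r"] assms(1) r by simp
  also have "\<dots> = (a - r) / r" using r by (simp add: diff_divide_distrib)
  \<comment> \<open>Here a - r <= (a - 1) + (1 - r) <= t + 3 t / 2, and r > 1 - (3/2) (1/4) = 5/8;
    the quotient is 4 t.\<close>
  also have "\<dots> \<le> (5 / 2 * t) / (5 / 8)"
    using r assms(1,2,3) by (intro frac_le) linarith+
  finally have "ln (a / r) \<le> 4 * t" by simp
  then have "r * ln (a / r) \<le> 1 * (4 * t)" using l0 r by (intro mult_mono) auto
  then have "(r * ln (a / r))\<^sup>2 \<le> (4 * t)\<^sup>2" using l0 r by (intro power_mono) auto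
  then have "r\<^sup>2 * (ln (a / r))\<^sup>2 \<le> 16 * t\<^sup>2" by (simp add: power_mult_distrib)
  moreover have "0 < r\<^sup>2 * (ln (a / r))\<^sup>2" using l0 r by simp
  ultimately have "1 / (16 * t\<^sup>2) \<le> 1 / (r\<^sup>2 * (ln (a / r))\<^sup>2)"
    using assms(3) by (intro divide_left_mono) auto
  then show ?thesis by (simp add: weight_def r_def)
qed

text \<open>The odd trial function vanishes on the axis through p, so its mass has to be collected
  at a nearby point of the circle off the axis: p is moved along \<tau> and projected back, each by
  at most \<rho> / 4.\<close>

lemma near_point_with_positive_coordinate:
  fixes p \<tau> :: "real^2"
  assumes p: "norm p = 1" "norm \<tau> = 1" "p \<bullet> \<tau> = 0" and "\<rho> > 0"
  obtains q where "norm q = 1" "dist q p < \<rho>" "0 < q \<bullet> \<tau>"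
proof -
  define s where "s = \<rho> / 4"
  have s: "s > 0" using \<open>\<rho> > 0\<close> by (simp add: s_def)
  define z where "z = p + s *\<^sub>R \<tau>"
  have pt: "p \<bullet> p = 1" "\<tau> \<bullet> \<tau> = 1" using p by (simp_all add: norm_eq_1)
  have "(norm z)\<^sup>2 = 1 + s\<^sup>2"
    unfolding power2_norm_eq_inner z_def using pt p(3)
    by (simp add: inner_add_left inner_add_right inner_commute power2_eq_square)
  then have "1\<^sup>2 \<le> (norm z)\<^sup>2" by simp
  then have z1: "norm z \<ge> 1" by (rule power2_le_imp_le) simp
  have z2: "norm z \<le> 1 + s"
    unfolding z_def using norm_triangle_ineq[of p "s *\<^sub>R \<tau>"] p s by simp
  define q where "q = (1 / norm z) *\<^sub>R z"
  have "norm q = 1" using z1 by (auto simp: q_def)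
  moreover have "dist q p < \<rho>"
  proof -
    have "q - z = (1 / norm z - 1) *\<^sub>R z" by (simp add: q_def scaleR_diff_left)
    then have "norm (q - z) = \<bar>1 / norm z - 1\<bar> * norm z" by simp
    also have "\<bar>1 / norm z - 1\<bar> = 1 - 1 / norm z"
    proof -
      have "1 / norm z \<le> 1" using z1 by (simp add: divide_le_eq_1)
      then show ?thesis by linarith
    qed
    also have "(1 - 1 / norm z) * norm z = norm z - 1" using z1 by (auto simp: algebra_simps)
    finally have "norm (q - z) \<le> s" using z2 by simp
    moreover have "norm (z - p) = s" using p s by (simp add: z_def)
    moreover have "norm (q - p) \<le> norm (q - z) + norm (z - p)"
      using norm_triangle_ineq[of "q - z" "z - p"] by simp
    ultimately show ?thesis using s by (simp add: dist_norm s_def)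
  qed
  moreover have "0 < q \<bullet> \<tau>"
  proof -
    have "z \<bullet> \<tau> = s" using pt p(3) by (simp add: z_def inner_add_left)
    then have "q \<bullet> \<tau> = s / norm z" by (simp add: q_def)
    moreover have "norm z > 0" using z1 by linarith
    ultimately show ?thesis using divide_pos_pos[OF s] by simp
  qed
  ultimately show ?thesis using that by blast
qed

text \<open>The weight is not integrable up to the unit circle when \<open>a = 1\<close>: disjoint balls of radius
  comparable to their distance from the circle all carry the same weighted mass.\<close>

lemma weighted_mass_near_sphere:
  fixes q :: "real^2"
  assumes q: "norm q = 1" and "\<eta> > 0" "c > 0"
  obtains a0 where "a0 > 1" "\<And>a f. 1 < a \<Longrightarrow> a < a0 \<Longrightarrow> integrable lborel (\<lambda>x. f x * weight a x) \<Longrightarrow>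
     (\<And>x. 0 \<le> f x) \<Longrightarrow> (\<And>x. x \<in> ball q \<eta> \<Longrightarrow> norm x < 1 \<Longrightarrow> c \<le> f x) \<Longrightarrow> E < (LINT x|lborel. f x * weight a x)"
proof -
  \<comment> \<open>Points of the balls lie within 3 t / 2 of q, hence within \<eta>; 1/4 is the
    range of \<open>weight_ge_near_sphere\<close>.\<close>
  define t0 where "t0 = min (1 / 4) (\<eta> / 2)"
  have t0: "0 < t0" "t0 \<le> 1 / 4" "3 / 2 * t0 < \<eta>" using \<open>\<eta> > 0\<close> by (auto simp: t0_def min_def)
  \<comment> \<open>The ball with parameter t lies in the annulus 1 - 3 t / 2 < |x| < 1 - t / 2.
    Consecutive annuli are disjoint once the ratio is at least 3; here it is 4.\<close>
  define t where "t j = t0 / 4 ^ j" for j :: nat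
  have t: "0 < t j" "t j \<le> t0" for j using t0 by (auto simp: t_def divide_le_eq mult_le_cancel_left1)
  have tj: "4 * t j \<le> t i" if ij: "i < j" for i j
  proof -
    have "(4::real) ^ Suc i \<le> 4 ^ j" using ij by (intro power_increasing) auto
    then have "4 * t0 * 4 ^ i \<le> t0 * 4 ^ j" using t0 by (simp add: mult.commute[of t0] mult_left_mono)
    then show ?thesis by (simp add: t_def divide_simps mult.commute mult.left_commute)
  qed
  define B where "B j = ball ((1 - t j) *\<^sub>R q) (t j / 2)" for j
  have Bx: "1 - 3 / 2 * t j < norm x" "norm x < 1 - t j / 2" "x \<in> ball q \<eta>" if x: "x \<in> B j" for x j
  proof -
    have d: "norm (x - (1 - t j) *\<^sub>R q) < t j / 2" using x by (simp add: B_def dist_norm norm_minus_commute)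
    have nq: "norm ((1 - t j) *\<^sub>R q) = 1 - t j" using q t[of j] t0 by simp
    show "1 - 3 / 2 * t j < norm x" using norm_triangle_ineq2[of "(1 - t j) *\<^sub>R q" x] d nq
      by (simp add: norm_minus_commute)
    show "norm x < 1 - t j / 2" using norm_triangle_ineq2[of x "(1 - t j) *\<^sub>R q"] d nq by simp
    have "q - x = ((1 - t j) *\<^sub>R q - x) + t j *\<^sub>R q" by (simp add: algebra_simps)
    then have "norm (q - x) \<le> norm ((1 - t j) *\<^sub>R q - x) + norm (t j *\<^sub>R q)" by (metis norm_triangle_ineq)
    then show "x \<in> ball q \<eta>" using d q t[of j] t0 by (simp add: dist_norm norm_minus_commute)
  qed
  have disj: "x \<notin> B j" if x: "x \<in> B i" and ij: "i \<noteq> j" for x i j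
  proof
    assume xj: "x \<in> B j"
    show False
    proof (cases "i < j")
      case True
      then show ?thesis using Bx[OF x] Bx[OF xj] tj[of i j] t(1)[of i] by linarith
    next
      case False
      then have "j < i" using ij by simp
      then show ?thesis using Bx[OF x] Bx[OF xj] tj[of j i] t(1)[of j] by linarith
    qed
  qed
  \<comment> \<open>Each ball contributes c * 1 / (16 t^2) * \<pi> (t / 2)^2 = c \<pi> / 64,
    independently of t.\<close>
  obtain n :: nat where n: "E < real n * (c * pi / 64)"
    using reals_Archimedean3[of "c * pi / 64"] \<open>c > 0\<close> by auto
  \<comment> \<open>The scale t n is below all those used, so a - 1 < t n makes the lower bound for
    the weight valid on all n balls at once.\<close>
  define a0 where "a0 = 1 + t n"
  have main: "E < (LINT x|lborel. f x * weight a x)"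
    if a: "1 < a" "a < a0" and int: "integrable lborel (\<lambda>x. f x * weight a x)"
      and f: "\<And>x. 0 \<le> f x" "\<And>x. x \<in> ball q \<eta> \<Longrightarrow> norm x < 1 \<Longrightarrow> c \<le> f x" for a f
  proof -
    have tn: "t n \<le> t j" if "j < n" for j using tj[OF that] t(1)[of n] by linarith
    have iB: "integrable lborel (indicat_real (B j))" for j
      by (rule integrable_indicator_bounded) (auto simp: B_def)
    have "(LINT x|lborel. (\<Sum>j<n. c / (16 * (t j)\<^sup>2) * indicat_real (B j) x)) \<le> (LINT x|lborel. f x * weight a x)"
    proof (rule integral_mono[OF _ int])
      show "integrable lborel (\<lambda>x. \<Sum>j<n. c / (16 * (t j)\<^sup>2) * indicat_real (B j) x)" using iB by simp
      fix x
      show "(\<Sum>j<n. c / (16 * (t j)\<^sup>2) * indicat_real (B j) x) \<le> f x * weight a x"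
      proof (cases "\<exists>i<n. x \<in> B i")
        case True
        then obtain i where i: "i < n" "x \<in> B i" by blast
        have "(\<Sum>j<n. c / (16 * (t j)\<^sup>2) * indicat_real (B j) x) = (\<Sum>j\<in>{i}. c / (16 * (t j)\<^sup>2) * indicat_real (B j) x)"
          using i disj[OF i(2)] by (intro sum.mono_neutral_right) (auto simp: indicator_def)
        also have "\<dots> = c * (1 / (16 * (t i)\<^sup>2))" using i by simp
        also have "\<dots> \<le> f x * weight a x"
        proof (rule mult_mono)
          have nx: "norm x < 1" using Bx(2)[OF i(2)] t(1)[of i] by simp
          show "c \<le> f x" by (rule f(2)[OF Bx(3)[OF i(2)] nx])
          show "1 / (16 * (t i)\<^sup>2) \<le> weight a x"
            by (rule weight_ge_near_sphere[OF a(1) _ t(1)])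
              (use a(2) tn[OF i(1)] t(2)[of i] t0 nx Bx(1)[OF i(2)] in \<open>auto simp: a0_def\<close>)
        qed (use f(1) in auto)
        finally show ?thesis .
      next
        case False
        then have "(\<Sum>j<n. c / (16 * (t j)\<^sup>2) * indicat_real (B j) x) = 0" by (intro sum.neutral) (auto simp: indicator_def)
        then show ?thesis using f(1)[of x] weight_nonneg[of a x] by simp
      qed
    qed
    moreover have "(LINT x|lborel. (\<Sum>j<n. c / (16 * (t j)\<^sup>2) * indicat_real (B j) x)) = real n * (c * pi / 64)"
    proof -
      have "(LINT x|lborel. (\<Sum>j<n. c / (16 * (t j)\<^sup>2) * indicat_real (B j) x)) =
          (\<Sum>j<n. c / (16 * (t j)\<^sup>2) * measure lborel (B j))" using iB by simp
      also have "\<dots> = (\<Sum>j<n. c * pi / 64)"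
      proof (rule sum.cong[OF refl])
        fix j
        have m: "measure lborel (B j) = (t j / 2)\<^sup>2 * pi"
          unfolding B_def using t(1)[of j] by (intro circle_area) simp
        show "c / (16 * (t j)\<^sup>2) * measure lborel (B j) = c * pi / 64"
          unfolding m using t(1)[of j] by (simp add: power_divide)
      qed
      finally show ?thesis by simp
    qed
    ultimately show ?thesis using n by linarith
  qed
  have "a0 > 1" using t(1)[of n] by (simp add: a0_def)
  then show ?thesis using that[of a0] main by blast
qed

text \<open>The trial function \<open>(x \<bullet> \<tau>) (\<rho>\<^sup>2 - |x - p|\<^sup>2)\<^sub>+\<^sup>2\<close> is odd under the reflection in \<open>\<tau>\<close>, which fixes \<open>p\<close>, so
  its weighted mean vanishes for every \<open>a\<close>.\<close>

lemma cap_trial: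
  assumes \<Omega>: "\<And>a. 1 < a \<Longrightarrow> hardy_domain \<Omega> a" and p: "norm p = 1" and \<rho>: "\<rho> > 0"
    and cap: "\<And>x. norm x < 1 \<Longrightarrow> dist x p < \<rho> \<Longrightarrow> x \<in> \<Omega>"
  shows "\<exists>a0>1. \<forall>a. 1 < a \<and> a < a0 \<longrightarrow> (\<exists>u. second_eigenfunction a \<Omega> u)"
proof -
  interpret d: hardy_domain \<Omega> 2 by (rule \<Omega>) simp
  define \<tau> :: "real^2" where "\<tau> = vector [- (p $ 2), p $ 1]"
  note o = orthonormal_coordinates[OF p, folded \<tau>_def]
  define u where "u x = (x \<bullet> \<tau>) * (max 0 (\<rho>\<^sup>2 - (norm (x - p))\<^sup>2))\<^sup>2" for x
  define u' where "u' x h = (x \<bullet> \<tau>) * (2 * max 0 (\<rho>\<^sup>2 - (norm (x - p))\<^sup>2) * (- (2 * ((x - p) \<bullet> h)))) +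
     (h \<bullet> \<tau>) * (max 0 (\<rho>\<^sup>2 - (norm (x - p))\<^sup>2))\<^sup>2" for x h
  have du: "(u has_derivative u' x) (at x)" for x
  proof -
    have "((\<lambda>x. x - p) has_derivative (\<lambda>h. h)) (at x)" by (auto intro!: derivative_eq_intros)
    from has_derivative_compose[OF this norm_square_deriv]
    have "((\<lambda>x. (norm (x - p))\<^sup>2) has_derivative (\<lambda>h. 2 * ((x - p) \<bullet> h))) (at x)" .
    from has_derivative_diff[OF has_derivative_const this]
    have "((\<lambda>x. \<rho>\<^sup>2 - (norm (x - p))\<^sup>2) has_derivative (\<lambda>h. - (2 * ((x - p) \<bullet> h)))) (at x)"
      by (simp only: diff_0)
    from has_derivative_compose[OF this max0_square_deriv[unfolded has_field_derivative_def]]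
    have "((\<lambda>x. (max 0 (\<rho>\<^sup>2 - (norm (x - p))\<^sup>2))\<^sup>2) has_derivative
       (\<lambda>h. 2 * max 0 (\<rho>\<^sup>2 - (norm (x - p))\<^sup>2) * (- (2 * ((x - p) \<bullet> h))))) (at x)" .
    moreover have "((\<lambda>x. x \<bullet> \<tau>) has_derivative (\<lambda>h. h \<bullet> \<tau>)) (at x)" by (auto intro!: derivative_eq_intros)
    ultimately show ?thesis unfolding u_def[abs_def] u'_def by (intro has_derivative_mult)
  qed
  have cu': "continuous_on UNIV (\<lambda>x. u' x h)" for h unfolding u'_def by (intro continuous_intros)
  have cu: "continuous_on UNIV u" unfolding u_def[abs_def] by (intro continuous_intros)
  have [measurable]: "u \<in> borel_measurable borel" using cu by (rule borel_measurable_continuous_onI)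
  have near: "dist x p < \<rho>" if "u x \<noteq> 0" for x
  proof -
    have "\<rho>\<^sup>2 - (norm (x - p))\<^sup>2 > 0"
    proof (rule ccontr)
      assume "\<not> \<rho>\<^sup>2 - (norm (x - p))\<^sup>2 > 0"
      then have "max 0 (\<rho>\<^sup>2 - (norm (x - p))\<^sup>2) = 0" by simp
      then show False using that by (simp add: u_def)
    qed
    then have "(norm (x - p))\<^sup>2 < \<rho>\<^sup>2" by simp
    then show ?thesis using \<rho> by (simp add: dist_norm power2_less_imp_less)
  qed
  let ?t = "\<lambda>x. indicator \<Omega> x * u x" and ?g = "\<lambda>x. indicator \<Omega> x *\<^sub>R (\<chi> i. u' x (axis i 1))"
  have sob: "sob \<Omega> ?t ?g" by (rule sob_C1[OF d.open_domain d.bounded_domain du cu'])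
  \<comment> \<open>The support of u meets the unit disc only inside \<Omega>, so \<Omega> may be
    replaced by the disc, which is symmetric under the reflection although \<Omega> need not
    be.\<close>
  have t_ball: "?t x = indicator (ball 0 1) x * u x" for x
    using cap[of x] near[of x] d.in_ball by (cases "u x = 0") (auto simp: indicator_def)
  have mean: "wprod a ?t (indicator \<Omega>) = 0" for a
  proof -
    let ?f = "\<lambda>x. indicator (ball 0 1) x * u x * weight a x"
    have eq: "wprod a ?t (indicator \<Omega>) = (LINT x|lborel. ?f x)"
    proof -
      have "?t x * indicator \<Omega> x = ?t x" for x by (simp add: indicator_def)
      then show ?thesis unfolding wprod_def by (simp only: t_ball)
    qed
    have [measurable]: "ball (0::real^2) 1 \<in> sets borel" by simp
    have odd: "?f (reflection \<tau> x) = - ?f x" for x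
    proof -
      note r = reflection_orthogonal[OF o(1)]
      have "reflection \<tau> p = p" using o(2) by (simp add: reflection_def)
      moreover have "reflection \<tau> (x - p) = reflection \<tau> x - reflection \<tau> p"
        using r(1) by (intro linear_diff) (simp add: orthogonal_transformation_def)
      ultimately have np: "norm (reflection \<tau> x - p) = norm (x - p)" using r(4)[of "x - p"] by simp
      have "\<tau> \<bullet> \<tau> = 1" using o(1) by (simp add: norm_eq_1)
      then have "reflection \<tau> x \<bullet> \<tau> = - (x \<bullet> \<tau>)" by (simp add: reflection_def inner_diff_left)
      then have "u (reflection \<tau> x) = - u x" by (simp add: u_def np)
      then show ?thesis using r(4)[of x] weight_cong_norm[OF r(4), of a x] by (simp add: indicator_def)
    qed
    have "(LINT x|lborel. ?f x) = (LINT x|lborel. ?f (reflection \<tau> x))"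
      by (rule integral_reflection[OF o(1), symmetric]) measurable
    also have "\<dots> = - (LINT x|lborel. ?f x)" unfolding odd by simp
    finally show ?thesis using eq by simp
  qed
  obtain q where q: "norm q = 1" "dist q p < \<rho>" "0 < q \<bullet> \<tau>"
    by (rule near_point_with_positive_coordinate[OF p o(1,2) \<rho>])
  have uq: "u q > 0"
  proof -
    have "(norm (q - p))\<^sup>2 < \<rho>\<^sup>2" using q(2) by (intro power_strict_mono) (auto simp: dist_norm)
    then show ?thesis using q(3) by (simp add: u_def)
  qed
  have "isCont u q" using cu by (simp add: continuous_on_eq_continuous_at)
  then obtain \<eta> where \<eta>: "\<eta> > 0" "\<And>x. dist x q < \<eta> \<Longrightarrow> dist (u x) (u q) < u q / 2"
    using uq unfolding continuous_at_eps_delta by (metis half_gt_zero)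
  have ub: "u q / 2 \<le> u x" if "x \<in> ball q \<eta>" for x
  proof -
    have "dist x q < \<eta>" using that by (simp add: dist_commute)
    from \<eta>(2)[OF this] show ?thesis unfolding dist_real_def by linarith
  qed
  obtain a0 where a0: "a0 > 1" "\<And>a f. 1 < a \<Longrightarrow> a < a0 \<Longrightarrow> integrable lborel (\<lambda>x. f x * weight a x) \<Longrightarrow>
     (\<And>x. 0 \<le> f x) \<Longrightarrow> (\<And>x. x \<in> ball q \<eta> \<Longrightarrow> norm x < 1 \<Longrightarrow> (u q / 2)\<^sup>2 \<le> f x) \<Longrightarrow>
     4 * energy ?g ?g < (LINT x|lborel. f x * weight a x)"
    \<comment> \<open>The energy of the trial function does not depend on a, so it can be used as
      the bound to be exceeded by the weighted mass.\<close>
    by (rule weighted_mass_near_sphere[OF q(1) \<eta>(1), of "(u q / 2)\<^sup>2" "4 * energy ?g ?g"]) (use uq in auto)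
  have "\<exists>u. second_eigenfunction a \<Omega> u" if a: "1 < a" "a < a0" for a
  proof -
    interpret h: hardy_domain \<Omega> a by (rule \<Omega>[OF a(1)])
    have "4 * energy ?g ?g < (LINT x|lborel. (?t x)\<^sup>2 * weight a x)"
    proof (rule a0(2)[OF a h.weighted_square_integrable[OF sob]])
      show "(u q / 2)\<^sup>2 \<le> (?t x)\<^sup>2" if x: "x \<in> ball q \<eta>" "norm x < 1" for x
        unfolding t_ball using ub[OF x(1)] x(2) uq by (auto intro!: power_mono)
    qed simp
    then have "energy ?g ?g < wprod a ?t ?t / 4" by (simp add: wprod_self)
    then show ?thesis by (rule h.second_eigenfunction_exists[OF sob mean])
  qed
  then show ?thesis using a0(1) by blast
qed

theorem corollary1:
  fixes \<Omega> :: "(real^2) set"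
  assumes "smooth_bounded_domain \<Omega>"
    and "0 \<in> closure \<Omega>"
    and "(SUP x\<in>\<Omega>. norm x) = 1"
  shows "(condition_A \<Omega> \<longrightarrow>
            (\<exists>a0>1. \<forall>a. 1 < a \<and> a < a0 \<longrightarrow> (\<exists>u. second_eigenfunction a \<Omega> u))) \<and>
         (\<forall>a L. admissible_pair a L \<and> condition_L a L \<Omega> \<longrightarrow>
            (\<exists>u. second_eigenfunction a \<Omega> u))"
proof -
  have d: "open \<Omega>" "bounded \<Omega>" "\<Omega> \<noteq> {}" "smooth_boundary \<Omega>"
    using assms(1) by (auto simp: smooth_bounded_domain_def)
  have le1: "norm x \<le> 1" if "x \<in> \<Omega>" for x
  proof -
    have "bdd_above (norm ` \<Omega>)" using d(2) by (auto simp: bounded_iff bdd_above_def)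
    from cSUP_upper[OF that this] show ?thesis using assms(3) by simp
  qed
  have "\<Omega> \<subseteq> ball 0 1"
  proof
    fix x assume x: "x \<in> \<Omega>"
    obtain r where r: "r > 0" "ball x r \<subseteq> \<Omega>" using openE[OF d(1) x] by blast
    \<comment> \<open>A point of norm 1 in the open set \<Omega> could be pushed outward along its
      ray, to norm above 1.\<close>
    have "norm x \<noteq> 1"
    proof
      assume nx: "norm x = 1"
      have "(1 + r / 2) *\<^sub>R x \<in> ball x r"
        using r nx by (simp add: dist_norm scaleR_add_left)
      then have "norm ((1 + r / 2) *\<^sub>R x) \<le> 1" using le1 r(2) by blast
      then show False using r(1) nx by simp
    qed
    then show "x \<in> ball 0 1" using le1[OF x] by simp
  qed
  then have dom: "hardy_domain \<Omega> a" if "1 < a" for a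
    using d assms(2) that by unfold_locales auto
  show ?thesis
  proof (intro conjI impI allI)
    assume "condition_A \<Omega>"
    then obtain \<delta> \<theta>1 \<theta>2 where A: "\<delta> > 0" "\<theta>1 < \<theta>2"
      "\<And>r \<theta>. 0 < r \<Longrightarrow> 1 - \<delta> < r \<Longrightarrow> r < 1 \<Longrightarrow> \<theta>1 < \<theta> \<Longrightarrow> \<theta> < \<theta>2 \<Longrightarrow>
        (vector [r * cos \<theta>, r * sin \<theta>] :: real^2) \<in> \<Omega>"
      unfolding condition_A_def by blast
    have "\<exists>p \<rho>. norm p = 1 \<and> \<rho> > 0 \<and> (\<forall>x. norm x < 1 \<longrightarrow> dist x p < \<rho> \<longrightarrow> x \<in> \<Omega>)"
      by (rule sector_contains_cap[of \<delta> \<theta>1 \<theta>2]) (use A in auto)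
    then obtain p \<rho> where "norm p = 1" "\<rho> > 0" "\<forall>x. norm x < 1 \<longrightarrow> dist x p < \<rho> \<longrightarrow> x \<in> \<Omega>"
      by blast
    then show "\<exists>a0>1. \<forall>a. 1 < a \<and> a < a0 \<longrightarrow> (\<exists>u. second_eigenfunction a \<Omega> u)"
      by (intro cap_trial[OF dom]) auto
  next
    fix a L assume "admissible_pair a L \<and> condition_L a L \<Omega>"
    then have a: "1 < a" and L: "ball 0 L \<subseteq> \<Omega>"
      "8 * pi < (LINT x|lebesgue_on (ball (0 :: real^2) L). 1 / (ln (a / norm x))\<^sup>2)"
      by (auto simp: admissible_pair_def condition_L_def)
    show "\<exists>u. second_eigenfunction a \<Omega> u"
      by (rule hardy_domain.linear_trial[OF dom[OF a] L])
  qed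
qed

end
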